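(* Let $\alpha_0,\alpha_1,\alpha_2,\alpha_3$ be complex parameters with $\alpha_0+2\alpha_1+2\alpha_2+\alpha_3=1$ and consider the Hamiltonian system $$\frac{dx}{dt}=\frac{\partial H}{\partial y},\quad \frac{dy}{dt}=-\frac{\partial H}{\partial x},\quad \frac{dz}{dt}=\frac{\partial H}{\partial w},\quad \frac{dw}{dt}=-\frac{\partial H}{\partial z}$$ with the polynomial Hamiltonian $H$ given by $$\begin{aligned} t^2H =\;&x^2y^3-(tx+2\alpha_1+\alpha_2+\alpha_3)xy^2-\{(\alpha_0 t-1)x-\alpha_1(\alpha_1+\alpha_2+\alpha_3)\}y-tx\\ &-\frac{z^2w^4}{4}+\frac{\alpha_3}{2}zw^3+\frac{1}{4}(2tz^2-\alpha_3^2)w^2-\frac{1}{2}\{(\alpha_3+1)t-1\}zw-\frac{t^2 z^2}{4}\\ &+(xy-\alpha_1)yzw. \end{aligned}$$ This system admits the affine Weyl group symmetry of type $C_3^{(1)}$ as the group of its Bäcklund transformations, whose generators $S_0,S_1,S_2,S_3$ are defined as follows, with the notation $( * ):=(x,y,z,w,t;\alpha_0,\alpha_1,\alpha_2,\alpha_3)$: $$\begin{aligned} S_0:( * ) \to &\left(-\left(x+\frac{\alpha_0}{y}+\frac{1}{y^2} \right),-y,\sqrt{-1}\,z,\frac{w}{\sqrt{-1}},-t;-\alpha_0,\alpha_1+\alpha_0,\alpha_2,\alpha_3 \right),\\ S_1:( * ) \to &\left(x,y-\frac{\alpha_1}{x},z,w,t;\alpha_0+2\alpha_1,-\alpha_1,\alpha_2+\alpha_1,\alpha_3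 \right),\\ S_2:( * ) \to &\left(x+\frac{\alpha_2}{y+w^2-t},y,z+\frac{2\alpha_2 w}{y+w^2-t},w,t;\alpha_0,\alpha_1+\alpha_2,-\alpha_2,\alpha_3+2\alpha_2 \right),\\ S_3:( * ) \to &\left(x,y,z,w-\frac{\alpha_3}{z},t;\alpha_0,\alpha_1,\alpha_2+\alpha_3,-\alpha_3 \right). \end{aligned}$$
   Context: Here $x,y,z,w$ are unknown complex variables depending on $t$. A transformation written $(x,y,z,w,t;\alpha)\to(\tilde x,\tilde y,\tilde z,\tilde w,\tilde t;\tilde\alpha)$ is a Bäcklund transformation of the system if it is birational in $x,y,z,w$ and carries solutions of the system with parameters $\alpha$ and independent variable $t$ to solutions of the same system with parameters $\tilde\alpha$ and independent variable $\tilde t$. The affine Weyl group of type $C_3^{(1)}$ is the Coxeter group with generators $S_0,S_1,S_2,S_3$ and defining relations $S_i^2=1$, $(S_0S_1)^4=(S_2S_3)^4=1$, $(S_1S_2)^3=1$, and $S_iS_j=S_jS_i$ for all other pairs.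
   Formalization: Read literally, S_0^2=1 fails: S_0^2 sends (z,w) to (-z,-w). The formal theorem states this, proves all other relations exactly, and shows that the group generated by S_0,...,S_3 modulo this sign change is the affine Weyl group of type C_3^(1). *)

theory Defs
  imports "HOL-Analysis.Analysis" "HOL-Algebra.Algebra"
begin

(* A point is (x, y, z, w); a parameter is (\<alpha>0, \<alpha>1, \<alpha>2, \<alpha>3). *)
type_synonym point = "complex \<times> complex \<times> complex \<times> complex"
type_synonym param = "complex \<times> complex \<times> complex \<times> complex"

definition params :: "param set" where
  "params = {(a0, a1, a2, a3). a0 + 2 * a1 + 2 * a2 + a3 = 1}"

fun ham :: "param \<Rightarrow> complex \<Rightarrow> point \<Rightarrow> complex" where
  "ham (a0, a1, a2, a3) t (x, y, z, w) =
    (x^2 * y^3 - (t * x + 2 * a1 + a2 + a3) * x * y^2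
      - ((a0 * t - 1) * x - a1 * (a1 + a2 + a3)) * y - t * x
      - z^2 * w^4 / 4 + a3 / 2 * z * w^3 + 1 / 4 * (2 * t * z^2 - a3^2) * w^2
      - 1 / 2 * ((a3 + 1) * t - 1) * z * w - t^2 * z^2 / 4
      + (x * y - a1) * y * z * w) / t^2"

(* The system is singular at t = 0, so solutions live on open subsets of the punctured plane. *)
definition solution :: "param \<Rightarrow> complex set \<Rightarrow> (complex \<Rightarrow> point) \<Rightarrow> bool" where
  "solution \<alpha> U \<phi> \<longleftrightarrow> open U \<and> U \<subseteq> - {0} \<and>
    (\<exists>x y z w. \<phi> = (\<lambda>t. (x t, y t, z t, w t)) \<and>
      (\<forall>t\<in>U.
        (x has_field_derivative deriv (\<lambda>\<eta>. ham \<alpha> t (x t, \<eta>, z t, w t)) (y t)) (at t) \<and>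
        (y has_field_derivative - deriv (\<lambda>\<xi>. ham \<alpha> t (\<xi>, y t, z t, w t)) (x t)) (at t) \<and>
        (z has_field_derivative deriv (\<lambda>\<omega>. ham \<alpha> t (x t, y t, z t, \<omega>)) (w t)) (at t) \<and>
        (w has_field_derivative - deriv (\<lambda>\<zeta>. ham \<alpha> t (x t, y t, \<zeta>, w t)) (z t)) (at t)))"

inductive_set polyfun :: "(point \<Rightarrow> complex) set" where
  const: "(\<lambda>_. c) \<in> polyfun"
| x: "(\<lambda>(x, y, z, w). x) \<in> polyfun"
| y: "(\<lambda>(x, y, z, w). y) \<in> polyfun"
| z: "(\<lambda>(x, y, z, w). z) \<in> polyfun"
| w: "(\<lambda>(x, y, z, w). w) \<in> polyfun"
| add: "f \<in> polyfun \<Longrightarrow> g \<in> polyfun \<Longrightarrow> (\<lambda>v. f v + g v) \<in> polyfun"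
| mult: "f \<in> polyfun \<Longrightarrow> g \<in> polyfun \<Longrightarrow> (\<lambda>v. f v * g v) \<in> polyfun"

(* Holds off a proper Zariski-closed subset. *)
definition generically :: "(point \<Rightarrow> bool) \<Rightarrow> bool" where
  "generically P \<longleftrightarrow> (\<exists>q\<in>polyfun. q \<noteq> (\<lambda>_. 0) \<and> (\<forall>v. q v \<noteq> 0 \<longrightarrow> P v))"

(* A rational map is a partial map, given by polynomial numerators and a common denominator and
   defined exactly where that denominator does not vanish.  Different presentations of the same
   rational map are different partial maps that agree generically. *)
definition rational_map :: "(point \<rightharpoonup> point) \<Rightarrow> bool" where
  "rational_map F \<longleftrightarrow>
    (\<exists>p1\<in>polyfun. \<exists>p2\<in>polyfun. \<exists>p3\<in>polyfun. \<exists>p4\<in>polyfun. \<exists>q\<in>polyfun. q \<noteq> (\<lambda>_. 0) \<and>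
      F = (\<lambda>v. if q v = 0 then None
               else Some (p1 v / q v, p2 v / q v, p3 v / q v, p4 v / q v)))"

definition birational :: "(point \<rightharpoonup> point) \<Rightarrow> bool" where
  "birational F \<longleftrightarrow> rational_map F \<and>
    (\<exists>G. rational_map G \<and> generically (\<lambda>v. (G \<circ>\<^sub>m F) v = Some v)
                       \<and> generically (\<lambda>v. (F \<circ>\<^sub>m G) v = Some v))"

(* A transformation (x, y, z, w, t; \<alpha>) \<rightarrow> (x', y', z', w', t'; \<alpha>'); None: a denominator vanishes. *)
type_synonym transf = "point \<times> complex \<times> param \<rightharpoonup> point \<times> complex \<times> param"

(* t' depends on t only and \<alpha>' on \<alpha> only.  Solutions are transformed wherever the transformation
   is defined along them.  Without the openness and continuity clause, the exceptional hypersurface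
   could vary so wildly with t that no solution stays in the domain, and the last clause would be
   vacuous. *)
definition backlund :: "transf \<Rightarrow> bool" where
  "backlund T \<longleftrightarrow> (\<exists>\<tau> a. bij_betw \<tau> (- {0}) (- {0}) \<and> bij_betw a params params \<and>
    (\<forall>\<alpha>\<in>params. \<forall>t. t \<noteq> 0 \<longrightarrow>
      (\<exists>F. birational F \<and> (\<forall>v. T (v, t, \<alpha>) = map_option (\<lambda>u. (u, \<tau> t, a \<alpha>)) (F v)))) \<and>
    (\<forall>\<alpha>\<in>params. open {(v, t). t \<noteq> 0 \<and> T (v, t, \<alpha>) \<noteq> None} \<and>
      continuous_on {(v, t). t \<noteq> 0 \<and> T (v, t, \<alpha>) \<noteq> None} (\<lambda>(v, t). the (T (v, t, \<alpha>)))) \<and>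
    (\<forall>\<alpha>\<in>params. \<forall>U \<phi> \<psi>.
      solution \<alpha> U \<phi> \<and> (\<forall>t\<in>U. T (\<phi> t, t, \<alpha>) = Some (\<psi> (\<tau> t), \<tau> t, a \<alpha>)) \<longrightarrow>
      solution (a \<alpha>) (\<tau> ` U) \<psi>))"

(* Two Baecklund transformations are the same if, for all t and \<alpha>, they agree as rational maps. *)
definition backlund_rel :: "(transf \<times> transf) set" where
  "backlund_rel = {(T, T'). backlund T \<and> backlund T' \<and>
    (\<forall>\<alpha>\<in>params. \<forall>t. t \<noteq> 0 \<longrightarrow> generically (\<lambda>v. T (v, t, \<alpha>) = T' (v, t, \<alpha>)))}"

definition backlund_class :: "transf \<Rightarrow> transf set" where
  "backlund_class T = backlund_rel `` {T}"

definition backlund_monoid :: "transf set monoid" where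
  "backlund_monoid =
    \<lparr>carrier = Collect backlund // backlund_rel,
     mult = (\<lambda>A B. \<Union>T\<in>A. \<Union>T'\<in>B. backlund_class (T \<circ>\<^sub>m T')),
     one = backlund_class Some\<rparr>"

(* The Baecklund transformations whose inverse is a Baecklund transformation too. *)
definition backlund_group :: "transf set monoid" where
  "backlund_group = units_of backlund_monoid"

fun S0 :: transf where
  "S0 ((x, y, z, w), t, (a0, a1, a2, a3)) =
    (if y = 0 then None
     else Some ((- (x + a0 / y + 1 / y^2), - y, \<i> * z, w / \<i>), - t, (- a0, a1 + a0, a2, a3)))"

fun S1 :: transf where
  "S1 ((x, y, z, w), t, (a0, a1, a2, a3)) =
    (if x = 0 then None
     else Some ((x, y - a1 / x, z, w), t, (a0 + 2 * a1, - a1, a2 + a1, a3)))"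

fun S2 :: transf where
  "S2 ((x, y, z, w), t, (a0, a1, a2, a3)) =
    (if y + w^2 - t = 0 then None
     else Some ((x + a2 / (y + w^2 - t), y, z + 2 * a2 * w / (y + w^2 - t), w), t,
                (a0, a1 + a2, - a2, a3 + 2 * a2)))"

fun S3 :: transf where
  "S3 ((x, y, z, w), t, (a0, a1, a2, a3)) =
    (if z = 0 then None
     else Some ((x, y, z, w - a3 / z), t, (a0, a1, a2 + a3, - a3)))"

definition S :: "nat \<Rightarrow> transf" where
  "S i = [S0, S1, S2, S3] ! i"

(* S0 composed with itself is not the identity but this symmetry of the system: S0 multiplies z by
   the chosen square root of -1 and divides w by it, and its inverse uses the other square root. *)
fun sign_flip :: transf where
  "sign_flip ((x, y, z, w), t, \<alpha>) = Some ((x, y, - z, - w), t, \<alpha>)"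

definition sign_subgroup :: "transf set set" where
  "sign_subgroup = {backlund_class Some, backlund_class sign_flip}"

definition S_group :: "transf set monoid" where
  "S_group = subgroup_generated backlund_group ((\<lambda>i. backlund_class (S i)) ` {..<4})"

definition S_word :: "nat list \<Rightarrow> transf set" where
  "S_word u = foldr (\<lambda>i g. backlund_class (S i) \<otimes>\<^bsub>backlund_group\<^esub> g) u \<one>\<^bsub>backlund_group\<^esub>"

(* Defining relations of the affine Weyl group of type C_3^(1), as pairs of words. *)
definition C31_relations :: "(nat list \<times> nat list) set" where
  "C31_relations =
    {([0, 0], []), ([1, 1], []), ([2, 2], []), ([3, 3], []),
     (concat (replicate 4 [0, 1]), []),
     (concat (replicate 4 [2, 3]), []),
     (concat (replicate 3 [1, 2]), []),
     ([0, 2], [2, 0]), ([0, 3], [3, 0]), ([1, 3], [3, 1])}"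

inductive_set C31_cong :: "(nat list \<times> nat list) set" where
  rel: "(a, b) \<in> C31_relations \<Longrightarrow> u \<in> lists {..<4} \<Longrightarrow> v \<in> lists {..<4}
          \<Longrightarrow> (u @ a @ v, u @ b @ v) \<in> C31_cong"
| refl: "u \<in> lists {..<4} \<Longrightarrow> (u, u) \<in> C31_cong"
| sym: "(u, v) \<in> C31_cong \<Longrightarrow> (v, u) \<in> C31_cong"
| trans: "(u, v) \<in> C31_cong \<Longrightarrow> (v, w) \<in> C31_cong \<Longrightarrow> (u, w) \<in> C31_cong"

(* The presented group.  Its generators are involutions, so words without inverse letters suffice. *)
definition C31_group :: "nat list set monoid" where
  "C31_group =
    \<lparr>carrier = lists {..<4} // C31_cong,
     mult = (\<lambda>A B. \<Union>u\<in>A. \<Union>v\<in>B. C31_cong `` {u @ v}),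
     one = C31_cong `` {[]}\<rparr>"

end

theory Submission
  imports Defs "HOL-Computational_Algebra.Polynomial"
begin

text \<open>
  Three things have to be shown: that the classes of Baecklund transformations with a Baecklund
  inverse form a group, that the four transformations lie in it and satisfy the Coxeter relations up to the sign
  flip, and that they satisfy no further relation.

  \<^item> \<^emph>\<open>The group.\<close>  Polynomial functions have no zero divisors, so that finitely many
    generic conditions hold simultaneously (\<open>generically_conj\<close>), and a nonzero polynomial stays
    nonzero when it is pulled back along a birational map (\<open>generically_pullback\<close>).  Therefore
    composites of Baecklund transformations are again birational and generic equality is a congruence.
    The units of the resulting monoid are the group.

  \<^item> \<^emph>\<open>The generators.\<close>  Each of them maps solutions to solutions because substituting it
    into Hamilton's equations gives identities between rational functions, valid on the hyperplane of
    admissible parameters.  On parameters the generators act by the simple reflections, and each of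
    them becomes its own inverse after the parameters have been reflected, except for the zeroth one, whose
    square is the sign flip.

  \<^item> \<^emph>\<open>The relations.\<close>  A composite of Baecklund transformations is generically defined, so
    two words in the generators agree in the group as soon as they agree wherever both are defined
    (\<open>backlund_class_eqI\<close>).  The two sides of each braid relation are evaluated in closed form;
    the factorisation of the intermediate denominators keeps these forms small.  The sign flip is
    central of order two, hence the braid relations give the relations of the presentation.

  \<^item> \<^emph>\<open>Faithfulness.\<close>  A class of Baecklund transformations determines its action on the
    parameters, so it is enough that the reflection representation of the Coxeter group is faithful.
    This is the argument of Tits.  Let \<open>p\<close> be a parameter whose four coordinates are positive.  If the
    word \<open>i # u\<close> is reduced, then coordinate \<open>i\<close> of \<open>act u p\<close> is positive
    (\<open>reduced_positive\<close>); after one more reflection it is negative, so \<open>i # u\<close> moves \<open>p\<close>.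
    Thus a word that fixes \<open>p\<close> is congruent to the empty word (\<open>act_faithful\<close>).

  The isomorphism sends a coset of the sign subgroup to the set of all words that represent an
  element of that coset (\<open>coset_words\<close>), which by the last two points is a congruence class.
\<close>

section \<open>The presented Coxeter group\<close>

lemma C31_relations_lists: "(a, b) \<in> C31_relations \<Longrightarrow> a \<in> lists {..<4} \<and> b \<in> lists {..<4}"
  by (auto simp: C31_relations_def numeral_eq_Suc)

lemma C31_cong_lists: "(u, v) \<in> C31_cong \<Longrightarrow> u \<in> lists {..<4} \<and> v \<in> lists {..<4}"
  by (induction rule: C31_cong.induct) (use C31_relations_lists in \<open>auto simp: in_lists_conv_set\<close>)

lemma C31_cong_context:
  "(u, v) \<in> C31_cong \<Longrightarrow> p \<in> lists {..<4} \<Longrightarrow> q \<in> lists {..<4} \<Longrightarrow> (p @ u @ q, p @ v @ q) \<in> C31_cong"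
proof (induction rule: C31_cong.induct)
  case (rel a b u v)
  then have "((p @ u) @ a @ (v @ q), (p @ u) @ b @ (v @ q)) \<in> C31_cong"
    by (intro C31_cong.rel) auto
  then show ?case by simp
next
  case (refl u)
  then show ?case by (intro C31_cong.refl) auto
next
  case (sym u v)
  then show ?case by (blast intro: C31_cong.sym)
next
  case (trans u v w)
  then show ?case by (blast intro: C31_cong.trans)
qed

lemma C31_cong_append:
  assumes "(u, u') \<in> C31_cong" and "(v, v') \<in> C31_cong"
  shows "(u @ v, u' @ v') \<in> C31_cong"
proof (rule C31_cong.trans)
  show "(u @ v, u' @ v) \<in> C31_cong"
    using C31_cong_context[OF assms(1), of "[]" v] C31_cong_lists[OF assms(2)] by simp
  show "(u' @ v, u' @ v') \<in> C31_cong"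
    using C31_cong_context[OF assms(2), of u' "[]"] C31_cong_lists[OF assms(1)] by simp
qed

lemma equiv_C31_cong: "equiv (lists {..<4}) C31_cong"
  by (rule equivI)
    (auto intro!: refl_onI symI transI dest: C31_cong_lists intro: C31_cong.intros)

lemma C31_class_eq_iff:
  "u \<in> lists {..<4} \<Longrightarrow> v \<in> lists {..<4} \<Longrightarrow> C31_cong `` {u} = C31_cong `` {v} \<longleftrightarrow> (u, v) \<in> C31_cong"
  by (rule eq_equiv_class_iff[OF equiv_C31_cong])

lemma C31_mult:
  assumes "u \<in> lists {..<4}" "v \<in> lists {..<4}"
  shows "(C31_cong `` {u}) \<otimes>\<^bsub>C31_group\<^esub> (C31_cong `` {v}) = C31_cong `` {u @ v}"
proof -
  have "congruent2 C31_cong C31_cong (\<lambda>u v. C31_cong `` {u @ v})"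
    by (intro congruent2I' equiv_class_eq[OF equiv_C31_cong] C31_cong_append)
  from UN_equiv_class2[OF equiv_C31_cong equiv_C31_cong this assms]
  show ?thesis by (simp add: C31_group_def)
qed

lemma C31_carrier: "carrier C31_group = (\<lambda>u. C31_cong `` {u}) ` lists {..<4}"
  by (auto simp: C31_group_def quotient_def)

lemma C31_one: "\<one>\<^bsub>C31_group\<^esub> = C31_cong `` {[]}"
  by (simp add: C31_group_def)

lemma C31_cong_double: "i < 4 \<Longrightarrow> ([i, i], []) \<in> C31_cong"
proof -
  assume "i < 4"
  then have "([i, i], []) \<in> C31_relations"
    by (auto simp: C31_relations_def numeral_eq_Suc less_Suc_eq)
  from C31_cong.rel[OF this, of "[]" "[]"] show ?thesis by simp
qed

lemma C31_cong_rev: "u \<in> lists {..<4} \<Longrightarrow> (rev u @ u, []) \<in> C31_cong"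
proof (induction u)
  case Nil
  then show ?case by (auto intro: C31_cong.refl)
next
  case (Cons i u)
  then have "(rev u @ [i, i] @ u, rev u @ [] @ u) \<in> C31_cong"
    by (intro C31_cong_context C31_cong_double) auto
  with Cons show ?case by (auto intro: C31_cong.trans)
qed

lemma group_C31_group: "group C31_group"
proof (rule groupI)
  fix A assume "A \<in> carrier C31_group"
  then obtain u where u: "u \<in> lists {..<4}" "A = C31_cong `` {u}" by (auto simp: C31_carrier)
  show "\<exists>B\<in>carrier C31_group. B \<otimes>\<^bsub>C31_group\<^esub> A = \<one>\<^bsub>C31_group\<^esub>"
  proof
    have r: "rev u \<in> lists {..<4}" using u(1) by auto
    then show "C31_cong `` {rev u} \<in> carrier C31_group" by (auto simp: C31_carrier)
    show "(C31_cong `` {rev u}) \<otimes>\<^bsub>C31_group\<^esub> A = \<one>\<^bsub>C31_group\<^esub>"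
      using C31_cong_rev[OF u(1)] u r by (simp add: C31_mult C31_one C31_class_eq_iff)
  qed
next
  fix A B assume "A \<in> carrier C31_group" "B \<in> carrier C31_group"
  then obtain u v where "u \<in> lists {..<4}" "A = C31_cong `` {u}" "v \<in> lists {..<4}" "B = C31_cong `` {v}"
    unfolding C31_carrier by blast
  then show "A \<otimes>\<^bsub>C31_group\<^esub> B \<in> carrier C31_group"
    unfolding C31_carrier by (simp only: C31_mult) (rule imageI, simp)
next
  fix A B C assume "A \<in> carrier C31_group" "B \<in> carrier C31_group" "C \<in> carrier C31_group"
  then obtain u v w where "u \<in> lists {..<4}" "A = C31_cong `` {u}" "v \<in> lists {..<4}" "B = C31_cong `` {v}"
    "w \<in> lists {..<4}" "C = C31_cong `` {w}"
    unfolding C31_carrier by blast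
  then show "A \<otimes>\<^bsub>C31_group\<^esub> B \<otimes>\<^bsub>C31_group\<^esub> C = A \<otimes>\<^bsub>C31_group\<^esub> (B \<otimes>\<^bsub>C31_group\<^esub> C)"
    by (simp only: C31_mult append_in_lists_conv append_assoc simp_thms)
next
  show "\<one>\<^bsub>C31_group\<^esub> \<in> carrier C31_group"
    unfolding C31_carrier C31_one by blast
next
  fix A assume "A \<in> carrier C31_group"
  then obtain u where "u \<in> lists {..<4}" "A = C31_cong `` {u}" unfolding C31_carrier by blast
  then show "\<one>\<^bsub>C31_group\<^esub> \<otimes>\<^bsub>C31_group\<^esub> A = A"
    by (simp only: C31_one C31_mult lists.Nil append_Nil)
qed

lemma C31_cong_inverse:
  assumes "(u @ v, []) \<in> C31_cong"
  shows "(u, rev v) \<in> C31_cong"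
proof -
  have uv: "u \<in> lists {..<4}" "v \<in> lists {..<4}" using C31_cong_lists[OF assms] by auto
  then have r: "rev v \<in> lists {..<4}" by auto
  have "(u @ (v @ rev v), u @ []) \<in> C31_cong"
    by (rule C31_cong_append) (use C31_cong_rev[OF r] uv in \<open>auto intro: C31_cong.refl\<close>)
  moreover have "((u @ v) @ rev v, [] @ rev v) \<in> C31_cong"
    by (rule C31_cong_append[OF assms]) (use r in \<open>auto intro: C31_cong.refl\<close>)
  ultimately show ?thesis by (auto intro: C31_cong.intros)
qed

text \<open>Each relation holds between words whose lengths have the same parity.  Hence a word that is not
  reduced is congruent to one that is shorter by at least two letters.\<close>

lemma C31_cong_parity: "(u, v) \<in> C31_cong \<Longrightarrow> even (length u) = even (length v)"
proof (induction rule: C31_cong.induct)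
  case (rel a b u v)
  have "even (length a) = even (length b)"
    using rel(1) by (auto simp: C31_relations_def length_concat sum_list_replicate)
  then show ?case by simp
qed auto

section \<open>Reduced words and the reflection representation\<close>

definition reduced :: "nat list \<Rightarrow> bool" where
  "reduced u \<longleftrightarrow> u \<in> lists {..<4} \<and> (\<forall>v. (u, v) \<in> C31_cong \<longrightarrow> length u \<le> length v)"

lemma reduced_infix:
  assumes "reduced (p @ u @ q)" shows "reduced u"
proof -
  have l: "p \<in> lists {..<4}" "u \<in> lists {..<4}" "q \<in> lists {..<4}" using assms by (auto simp: reduced_def)
  moreover have "length u \<le> length v" if "(u, v) \<in> C31_cong" for v
    using assms C31_cong_context[OF that l(1,3)] by (force simp: reduced_def)
  ultimately show ?thesis by (auto simp: reduced_def)
qed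

lemma reduced_exists:
  assumes "u \<in> lists {..<4}" obtains v where "(u, v) \<in> C31_cong" "reduced v"
proof -
  have "(u, u) \<in> C31_cong" using assms by (rule C31_cong.refl)
  then obtain v where v: "(u, v) \<in> C31_cong" "\<And>w. (u, w) \<in> C31_cong \<Longrightarrow> length v \<le> length w"
    using ex_has_least_nat[of "\<lambda>v. (u, v) \<in> C31_cong" u length] by blast
  then have "reduced v"
    using C31_cong_lists[OF v(1)] C31_cong.trans[OF v(1)] by (auto simp: reduced_def)
  with v(1) that show thesis by blast
qed

text \<open>The action of the generators on parameters.  It is linear on the whole parameter space, and
  words act through \<open>act\<close> in the order in which the transformations are composed.\<close>

fun reflect :: "nat \<Rightarrow> param \<Rightarrow> param" where
  "reflect i (a0, a1, a2, a3) =
    (if i = 0 then (- a0, a1 + a0, a2, a3)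
     else if i = 1 then (a0 + 2 * a1, - a1, a2 + a1, a3)
     else if i = 2 then (a0, a1 + a2, - a2, a3 + 2 * a2)
     else (a0, a1, a2 + a3, - a3))"

definition act :: "nat list \<Rightarrow> param \<Rightarrow> param" where
  "act u = foldr reflect u"

lemma act_simps [simp]: "act [] p = p" "act (i # u) p = reflect i (act u p)" "act (u @ v) p = act u (act v p)"
  by (auto simp: act_def)

lemma act_relations: "(a, b) \<in> C31_relations \<Longrightarrow> act a p = act b p"
  by (cases p) (auto simp: C31_relations_def numeral_eq_Suc)

lemma act_cong: "(u, v) \<in> C31_cong \<Longrightarrow> act u p = act v p"
  by (induction arbitrary: p rule: C31_cong.induct) (use act_relations in auto)

fun root :: "nat \<Rightarrow> param \<Rightarrow> real" where
  "root i (a0, a1, a2, a3) = Re ([a0, a1, a2, a3] ! i)"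

lemma root_reflect: "i < 4 \<Longrightarrow> root i (reflect i p) = - root i p"
  by (cases p) (auto simp: less_Suc_eq numeral_eq_Suc)

fun alt :: "nat \<Rightarrow> nat \<Rightarrow> nat \<Rightarrow> nat list" where
  "alt i j 0 = []"
| "alt i j (Suc n) = i # alt j i n"

definition coxeter_order :: "nat \<Rightarrow> nat \<Rightarrow> nat" where
  "coxeter_order i j = 
    (if (i, j) \<in> {(0, 1), (1, 0), (2, 3), (3, 2)} then 4
     else if (i, j) \<in> {(1, 2), (2, 1)} then 3 else 2)"

lemma less_4_cases: "(i::nat) < 4 \<Longrightarrow> (i = 0 \<Longrightarrow> P) \<Longrightarrow> (i = 1 \<Longrightarrow> P) \<Longrightarrow> (i = 2 \<Longrightarrow> P) \<Longrightarrow> (i = 3 \<Longrightarrow> P) \<Longrightarrow> P"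
  by linarith

text \<open>In the dihedral group generated by two simple reflections, an alternating word shorter than the
  Coxeter order pulls a coordinate back to a nonnegative combination of the two coordinates
  concerned, with a positive coefficient.  There are finitely many cases.\<close>

lemma alt_positive:
  assumes "i < 4" "j < 4" "i \<noteq> j" "n < coxeter_order i j" "root i p > 0" "root j p > 0"
  shows "root i (act (alt j i n) p) > 0"
proof -
  obtain a0 a1 a2 a3 where p: "p = (a0, a1, a2, a3)" by (cases p)
  consider "n = 0" | "n = 1" | "n = 2" "coxeter_order i j > 2" | "n = 3" "coxeter_order i j > 3"
    using assms(4) by (fastforce simp: coxeter_order_def split: if_splits)
  then show ?thesis
  proof cases
    case 1
    then show ?thesis using assms(5) by simp
  next
    case 2
    show ?thesis unfolding p 2 One_nat_def alt.simps act_simps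
      by (insert assms(3,5,6) p, rule less_4_cases[OF assms(1)]; rule less_4_cases[OF assms(2)]; simp)
  next
    case 3
    show ?thesis unfolding p 3(1) numeral_2_eq_2 alt.simps act_simps
      by (insert assms(3,5,6) 3(2) p, rule less_4_cases[OF assms(1)]; rule less_4_cases[OF assms(2)];
          simp add: coxeter_order_def)
  next
    case 4
    show ?thesis unfolding p 4(1) numeral_3_eq_3 alt.simps act_simps
      by (insert assms(3,5,6) 4(2) p, rule less_4_cases[OF assms(1)]; rule less_4_cases[OF assms(2)];
          simp add: coxeter_order_def)
  qed
qed

lemma length_alt [simp]: "length (alt i j n) = n"
  by (induction n arbitrary: i j) auto

lemma alt_in_lists: "i < 4 \<Longrightarrow> j < 4 \<Longrightarrow> alt i j n \<in> lists {..<4}"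
  by (induction n arbitrary: i j) auto

lemma alt_add: "alt i j (m + n) = alt i j m @ (if even m then alt i j n else alt j i n)"
  by (induction m arbitrary: i j) auto

lemma alt_double: "alt i j (2 * n) = concat (replicate n [i, j])"
  by (induction n) auto

lemma rev_alt: "rev (alt i j n) = (if even n then alt j i n else alt i j n)"
proof (induction n arbitrary: i j)
  case (Suc n)
  have "alt i j (Suc n) = alt i j n @ [if even n then i else j]" for i j
    using alt_add[of i j n 1] by auto
  with Suc show ?case by auto
qed auto

lemma alt_relation_swap:
  assumes "i < 4" "j < 4" "(alt i j (2 * m), []) \<in> C31_cong"
  shows "(alt j i (2 * m), []) \<in> C31_cong"
proof -
  let ?u = "alt i j (2 * m)"
  have "rev ?u \<in> lists {..<4}" using alt_in_lists[OF assms(1,2), of "2 * m"] by (simp add: in_lists_conv_set)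
  from C31_cong_rev[OF this] have "([], ?u @ rev ?u) \<in> C31_cong" by (auto intro: C31_cong.sym)
  moreover have "(alt i j (2 * m) @ rev (alt i j (2 * m)), [] @ alt j i (2 * m)) \<in> C31_cong"
    using alt_in_lists[OF assms(2,1), of "2 * m"] assms(3)
    by (intro C31_cong_append) (auto simp: rev_alt intro: C31_cong.refl)
  ultimately show ?thesis by (auto dest: C31_cong.trans intro: C31_cong.sym)
qed

lemma C31_relation_in_cong: "(a, b) \<in> C31_relations \<Longrightarrow> (a, b) \<in> C31_cong"
  using C31_cong.rel[of a b "[]" "[]"] by simp

lemma alt_relation:
  assumes "i < 4" "j < 4" "i \<noteq> j"
  shows "(alt i j (2 * coxeter_order i j), []) \<in> C31_cong"
proof -
  have sorted: "(alt i j (2 * coxeter_order i j), []) \<in> C31_cong" if "i < j" "j < 4" for i j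
  proof -
    consider "coxeter_order i j > 2" "(concat (replicate (coxeter_order i j) [i, j]), []) \<in> C31_relations"
      | "coxeter_order i j = 2" "([i, j], [j, i]) \<in> C31_relations"
    proof -
      have "(i, j) \<in> {(0, 1), (0, 2), (0, 3), (1, 2), (1, 3), (2, 3)}" 
        using \<open>i < j\<close> \<open>j < 4\<close> by (simp, linarith)
      then show thesis using that by (auto simp: coxeter_order_def C31_relations_def)
    qed
    then show ?thesis
    proof cases
      case 1
      then show ?thesis by (simp add: alt_double C31_relation_in_cong)
    next
      case 2
      have "([i, j] @ [i, j], [j, i] @ [i, j]) \<in> C31_cong"
        using that by (intro C31_cong_append C31_relation_in_cong 2 C31_cong.refl) auto
      moreover have "(rev [i, j] @ [i, j], []) \<in> C31_cong"
        using that by (intro C31_cong_rev) auto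
      ultimately show ?thesis
        using 2 by (auto simp: alt_double numeral_2_eq_2 intro: C31_cong.trans)
    qed
  qed
  have "coxeter_order j i = coxeter_order i j" by (simp add: coxeter_order_def insert_commute)
  then show ?thesis
    using sorted[of i j] sorted[of j i] alt_relation_swap[of j i "coxeter_order i j"] assms
    by (cases "i < j") auto
qed

text \<open>An alternating word with one letter more than the Coxeter order is more than half of a
  relator; the rest of the relator, reversed, is a shorter word for the same element.\<close>

lemma alt_not_reduced:
  assumes "i < 4" "j < 4" "i \<noteq> j"
  shows "\<not> reduced (alt i j (Suc (coxeter_order i j)))"
proof -
  define m where "m = coxeter_order i j"
  have "m > 0" by (simp add: m_def coxeter_order_def)
  \<comment> \<open>Cut the relator after its first \<open>Suc m\<close> letters.\<close>
  then have "2 * m = Suc m + (m - 1)" by simp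
  then have "(alt i j (Suc m) @ (if even (Suc m) then alt i j (m - 1) else alt j i (m - 1)), []) \<in> C31_cong"
    using alt_relation[OF assms] alt_add[of i j "Suc m" "m - 1"] by (simp only: m_def[symmetric])
  from C31_cong_inverse[OF this] \<open>m > 0\<close> show ?thesis
    unfolding reduced_def m_def[symmetric] by (fastforce split: if_splits)
qed

lemma reduced_no_repeat: "\<not> reduced (i # i # u)"
proof
  assume r: "reduced (i # i # u)"
  then have "reduced [i, i]" using reduced_infix[of "[]" "[i, i]" u] by simp
  with r C31_cong_double[of i] show False by (auto simp: reduced_def)
qed

lemma reduced_dihedral:
  assumes "reduced (i # d)" "d \<in> lists {i, j}"
  shows "d = alt j i (length d)"
  using assms
proof (induction d arbitrary: i j)
  case (Cons k d)
  have "k = j" using Cons.prems reduced_no_repeat by auto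
  moreover have "reduced (k # d)" using reduced_infix[of "[i]" "k # d" "[]"] Cons.prems by simp
  ultimately show ?case using Cons.IH[of j i] Cons.prems by (simp add: insert_commute)
qed auto

lemma reduced_dihedral_positive:
  assumes "i < 4" "j < 4" "i \<noteq> j" "reduced (i # d)" "d \<in> lists {i, j}" "root i p > 0" "root j p > 0"
  shows "root i (act d p) > 0"
proof -
  have d: "d = alt j i (length d)" using reduced_dihedral assms by blast
  have "length d < coxeter_order i j"
  proof (rule ccontr)
    assume "\<not> ?thesis"
    then have "length d = coxeter_order i j + (length d - coxeter_order i j)" by simp
    with d have "i # d = [] @ alt i j (Suc (coxeter_order i j)) @ drop (coxeter_order i j) d"
      by (metis alt.simps(2) alt_add append_Cons append_Nil append_eq_conv_conj length_alt)
    with assms(4) reduced_infix alt_not_reduced[OF assms(1-3)] show False by metis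
  qed
  then show ?thesis using alt_positive[OF assms(1-3) _ assms(6,7)] d by metis
qed

text \<open>Tits' argument, by induction on the length.  Among all factorisations of \<open>u\<close> as \<open>d @ v\<close>, up
  to congruence and without change of length, where \<open>d\<close> uses only the letter \<open>i\<close> and the first
  letter \<open>j\<close> of \<open>u\<close>, take one with \<open>v\<close> as short as possible.  Then \<open>i # v\<close> and \<open>j # v\<close> are
  reduced, so that both coordinates are positive at \<open>act v p\<close> by induction, and the dihedral case
  applies to \<open>d\<close>.\<close>

lemma reduced_positive:
  assumes "reduced (i # u)" "\<And>k. k < 4 \<Longrightarrow> root k p > 0"
  shows "root i (act u p) > 0"
  using assms(1)
proof (induction "length u" arbitrary: i u rule: less_induct)
  case less
  have iu: "i < 4" "u \<in> lists {..<4}" using less.prems by (auto simp: reduced_def)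
  show ?case
  proof (cases u)
    case Nil
    then show ?thesis using assms(2) iu by simp
  next
    case (Cons j u')
    have j: "j < 4" "u' \<in> lists {..<4}" "i \<noteq> j"
      using Cons iu less.prems reduced_no_repeat by auto
    have ru: "reduced u" using reduced_infix[of "[i]" u "[]"] less.prems by simp
    define P where "P v \<longleftrightarrow> (\<exists>d \<in> lists {i, j}. (u, d @ v) \<in> C31_cong \<and> length d + length v = length u)" for v
    have "P u'" unfolding P_def using Cons C31_cong.refl[OF iu(2)] by (intro bexI[of _ "[j]"]) auto
    then obtain v where v: "P v" and vmin: "\<And>v'. P v' \<Longrightarrow> length v \<le> length v'"
      using ex_has_least_nat[of P u' length] by blast
    have len: "length v < length u" using vmin[OF \<open>P u'\<close>] Cons by simp
    obtain d where d: "d \<in> lists {i, j}" "(u, d @ v) \<in> C31_cong" "length d + length v = length u"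
      using v by (auto simp: P_def)
    have dl: "d \<in> lists {..<4}" "v \<in> lists {..<4}" using C31_cong_lists[OF d(2)] by auto
    have red: "reduced (k # v)" if k: "k = i \<or> k = j" for k
    proof (rule ccontr)
      assume n: "\<not> reduced (k # v)"
      have k4: "k < 4" using k iu j by auto
      then obtain w where w: "(k # v, w) \<in> C31_cong" "length w < Suc (length v)"
        using n dl by (auto simp: reduced_def not_le)
      \<comment> \<open>The parity turns \<open>\<le>\<close> into a strict inequality, and \<open>k\<close> can be moved from \<open>v\<close> to \<open>d\<close>.\<close>
      with C31_cong_parity[OF w(1)] have wl: "length w < length v"
        by (metis dvd_refl even_Suc length_Cons less_SucE)
      have "([k] @ [k] @ v, [k] @ w) \<in> C31_cong"
        using w(1) k4 by (intro C31_cong_append) (auto intro: C31_cong.refl)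
      moreover have "([] @ v, [k, k] @ v) \<in> C31_cong"
        using dl C31_cong_double[OF k4] by (intro C31_cong_append) (auto intro: C31_cong.intros)
      ultimately have vw: "(v, k # w) \<in> C31_cong" by (auto intro: C31_cong.trans)
      have "(d @ v, d @ k # w) \<in> C31_cong"
        using dl vw by (intro C31_cong_append) (auto intro: C31_cong.refl)
      with d(2) have uw: "(u, (d @ [k]) @ w) \<in> C31_cong" by (auto intro: C31_cong.trans)
      then have "length u \<le> length ((d @ [k]) @ w)" using ru unfolding reduced_def by blast
      then have "length (d @ [k]) + length w = length u" using wl d(3) by simp
      moreover have "d @ [k] \<in> lists {i, j}" using d(1) k by auto
      ultimately have "P w" unfolding P_def using uw by blast
      with vmin wl show False by fastforce
    qed
    have pos: "root i (act v p) > 0" "root j (act v p) > 0"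
      using less.hyps[OF len] red by auto
    have "reduced (i # d)"
    proof -
      have c: "([i] @ u, [i] @ d @ v) \<in> C31_cong"
        using d(2) iu by (intro C31_cong_append) (auto intro: C31_cong.refl)
      have "reduced (i # d @ v)"
        unfolding reduced_def
      proof (intro conjI allI impI)
        show "i # d @ v \<in> lists {..<4}" using C31_cong_lists[OF c] by simp
        fix w assume "(i # d @ v, w) \<in> C31_cong"
        with c have "(i # u, w) \<in> C31_cong" by (auto intro: C31_cong.trans)
        with less.prems d(3) show "length (i # d @ v) \<le> length w" by (auto simp: reduced_def)
      qed
      then show ?thesis using reduced_infix[of "[]" "i # d" v] by simp
    qed
    then have "root i (act d (act v p)) > 0"
      using reduced_dihedral_positive[OF iu(1) j(1,3) _ d(1) pos] by blast
    then show ?thesis using act_cong[OF d(2)] by simp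
  qed
qed

text \<open>A reduced nonempty word makes one coordinate of a positive parameter negative.\<close>

lemma act_faithful:
  assumes "u \<in> lists {..<4}" "\<And>k. k < 4 \<Longrightarrow> root k p > 0" "act u p = p"
  shows "(u, []) \<in> C31_cong"
proof -
  obtain v where v: "(u, v) \<in> C31_cong" "reduced v" using reduced_exists[OF assms(1)] .
  have "v = []"
  proof (cases v)
    case (Cons i w)
    then have "i < 4" using v by (auto simp: reduced_def)
    then have "root i (act v p) < 0"
      using reduced_positive[of i w p] v assms(2) Cons by (simp add: root_reflect)
    moreover have "act v p = p" using act_cong[OF v(1)] assms(3) by simp
    ultimately show ?thesis using assms(2)[OF \<open>i < 4\<close>] by simp
  qed
  with v show ?thesis by simp
qed

section \<open>Polynomial functions and generic properties\<close>

lemma polyfun_coordinates [intro]: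
  "(\<lambda>v. fst v) \<in> polyfun" "(\<lambda>v. fst (snd v)) \<in> polyfun"
  "(\<lambda>v. fst (snd (snd v))) \<in> polyfun" "(\<lambda>v. snd (snd (snd v))) \<in> polyfun"
  using polyfun.x polyfun.y polyfun.z polyfun.w unfolding case_prod_unfold .

lemma polyfun_uminus [intro]: "f \<in> polyfun \<Longrightarrow> (\<lambda>v. - f v) \<in> polyfun"
  using polyfun.mult[OF polyfun.const[of "- 1"]] by simp

lemma polyfun_diff [intro]: "f \<in> polyfun \<Longrightarrow> g \<in> polyfun \<Longrightarrow> (\<lambda>v. f v - g v) \<in> polyfun"
  using polyfun.add[OF _ polyfun_uminus] by simp

lemma polyfun_power [intro]: "f \<in> polyfun \<Longrightarrow> (\<lambda>v. f v ^ n) \<in> polyfun"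
  by (induction n) (auto intro: polyfun.const polyfun.mult)

lemmas polyfun_intros = polyfun.const polyfun.add polyfun.mult polyfun_coordinates
  polyfun_uminus polyfun_diff polyfun_power

lemma nonzero_funI: "f v \<noteq> 0 \<Longrightarrow> f \<noteq> (\<lambda>_. 0)"
  by auto

text \<open>Restriction to a real line reduces questions about polynomial functions of four variables to
  polynomials in one variable.\<close>

lemma polyfun_on_line:
  assumes "f \<in> polyfun"
  shows "\<exists>P :: complex poly. \<forall>s :: real. f (u + s *\<^sub>R d) = poly P (of_real s)"
  using assms
proof induction
  case (const c)
  show ?case by (intro exI[of _ "[:c:]"]) simp
next
  case x
  show ?case by (intro exI[of _ "[:fst u, fst d:]"]) (simp add: case_prod_unfold scaleR_conv_of_real)
next
  case y
  show ?case by (intro exI[of _ "[:fst (snd u), fst (snd d):]"]) (simp add: case_prod_unfold scaleR_conv_of_real)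
next
  case z
  show ?case by (intro exI[of _ "[:fst (snd (snd u)), fst (snd (snd d)):]"]) (simp add: case_prod_unfold scaleR_conv_of_real)
next
  case w
  show ?case by (intro exI[of _ "[:snd (snd (snd u)), snd (snd (snd d)):]"]) (simp add: case_prod_unfold scaleR_conv_of_real)
next
  case (add f g)
  then show ?case by (metis poly_add)
next
  case (mult f g)
  then show ?case by (metis poly_mult)
qed

text \<open>Two points at which the factors do not vanish lie on a line, and on that line both factors have
  finitely many zeros.\<close>

lemma polyfun_no_zero_divisors:
  assumes "f \<in> polyfun" "g \<in> polyfun" "f \<noteq> (\<lambda>_. 0)" "g \<noteq> (\<lambda>_. 0)"
  shows "(\<lambda>v. f v * g v) \<noteq> (\<lambda>_. 0)"
proof -
  obtain u v where uv: "f u \<noteq> 0" "g v \<noteq> 0" using assms(3,4) by (auto simp: fun_eq_iff)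
  obtain P Q :: "complex poly" where
    P: "\<And>s :: real. f (u + s *\<^sub>R (v - u)) = poly P (of_real s)" and
    Q: "\<And>s :: real. g (u + s *\<^sub>R (v - u)) = poly Q (of_real s)"
    using polyfun_on_line assms(1,2) by meson
  have "P \<noteq> 0" using P[of 0] uv by auto
  moreover have "Q \<noteq> 0" using Q[of 1] uv by auto
  ultimately have "finite {c. poly (P * Q) c = 0}" by (intro poly_roots_finite) simp
  moreover have "infinite (range (of_real :: real \<Rightarrow> complex))"
    by (simp add: finite_image_iff inj_of_real infinite_UNIV_char_0)
  ultimately obtain s :: real where "poly (P * Q) (of_real s) \<noteq> 0"
    by (metis (mono_tags, lifting) finite_subset mem_Collect_eq rangeE subsetI)
  then have "f (u + s *\<^sub>R (v - u)) * g (u + s *\<^sub>R (v - u)) \<noteq> 0" by (simp add: P Q)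
  then show ?thesis by (rule nonzero_funI)
qed

lemma generically_nonzero: "q \<in> polyfun \<Longrightarrow> q \<noteq> (\<lambda>_. 0) \<Longrightarrow> generically (\<lambda>v. q v \<noteq> 0)"
  by (auto simp: generically_def)

lemma generically_mono: "generically P \<Longrightarrow> (\<And>v. P v \<Longrightarrow> Q v) \<Longrightarrow> generically Q"
  by (auto simp: generically_def)

lemma generically_conj:
  assumes "generically P" "generically Q" shows "generically (\<lambda>v. P v \<and> Q v)"
proof -
  obtain p q where "p \<in> polyfun" "p \<noteq> (\<lambda>_. 0)" "\<And>v. p v \<noteq> 0 \<Longrightarrow> P v"
    and "q \<in> polyfun" "q \<noteq> (\<lambda>_. 0)" "\<And>v. q v \<noteq> 0 \<Longrightarrow> Q v"
    using assms unfolding generically_def by blast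
  then show ?thesis unfolding generically_def
    by (intro bexI[of _ "\<lambda>v. p v * q v"] conjI polyfun_no_zero_divisors polyfun.mult) auto
qed

lemma generically_True: "(\<And>v. P v) \<Longrightarrow> generically P"
  unfolding generically_def by (intro bexI[of _ "\<lambda>_. 1"]) (auto simp: fun_eq_iff intro: polyfun.const)

lemma generically_ex: "generically P \<Longrightarrow> \<exists>v. P v"
  by (force simp: generically_def fun_eq_iff)

section \<open>Rational maps\<close>

text \<open>Substituting fractions with denominator \<open>q\<close> into a polynomial gives a fraction with a power of
  \<open>q\<close> as denominator.  All sufficiently large exponents are allowed, so that the same exponent can
  serve for several polynomials.\<close>

lemma polyfun_substitute:
  assumes "f \<in> polyfun" "p1 \<in> polyfun" "p2 \<in> polyfun" "p3 \<in> polyfun" "p4 \<in> polyfun" "q \<in> polyfun"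
  shows "\<exists>N. \<forall>M\<ge>N. \<exists>R\<in>polyfun. \<forall>v. q v \<noteq> 0 \<longrightarrow>
    f (p1 v / q v, p2 v / q v, p3 v / q v, p4 v / q v) * q v ^ M = R v"
proof -
  define G where "G v = (p1 v / q v, p2 v / q v, p3 v / q v, p4 v / q v)" for v
  define cleared where
    "cleared h M \<longleftrightarrow> (\<exists>R\<in>polyfun. \<forall>v. q v \<noteq> 0 \<longrightarrow> h (G v) * q v ^ M = R v)" for h :: "point \<Rightarrow> complex" and M
  have coordinate: "\<exists>N. \<forall>M\<ge>N. cleared h M" if p: "p \<in> polyfun" "\<And>v. h (G v) = p v / q v" for h p
  proof (intro exI[of _ 1] allI impI)
    fix M :: nat assume "M \<ge> 1"
    then obtain k where "M = Suc k" by (cases M) auto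
    then show "cleared h M" unfolding cleared_def p(2)
      by (intro bexI[of _ "\<lambda>v. p v * q v ^ k"]) (auto intro!: polyfun.mult p polyfun_power assms(6))
  qed
  from assms(1) have "\<exists>N. \<forall>M\<ge>N. cleared f M"
  proof induction
    case (const c)
    have "cleared (\<lambda>_. c) M" for M unfolding cleared_def
      by (intro bexI[of _ "\<lambda>v. c * q v ^ M"]) (auto intro!: polyfun.mult polyfun.const polyfun_power assms(6))
    then show ?case by blast
  next
    case x then show ?case by (rule coordinate[OF assms(2)]) (simp add: G_def)
  next
    case y then show ?case by (rule coordinate[OF assms(3)]) (simp add: G_def)
  next
    case z then show ?case by (rule coordinate[OF assms(4)]) (simp add: G_def)
  next
    case w then show ?case by (rule coordinate[OF assms(5)]) (simp add: G_def)
  next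
    case (add f g)
    from add.IH(1) obtain N1 where N1: "\<forall>M\<ge>N1. cleared f M" ..
    from add.IH(2) obtain N2 where N2: "\<forall>M\<ge>N2. cleared g M" ..
    have "cleared (\<lambda>v. f v + g v) M" if M: "M \<ge> max N1 N2" for M
    proof -
      have "cleared f M" "cleared g M" using N1 N2 M by auto
      then obtain R1 R2 where R: "R1 \<in> polyfun" "\<forall>v. q v \<noteq> 0 \<longrightarrow> f (G v) * q v ^ M = R1 v"
        "R2 \<in> polyfun" "\<forall>v. q v \<noteq> 0 \<longrightarrow> g (G v) * q v ^ M = R2 v" unfolding cleared_def by blast
      then show ?thesis unfolding cleared_def
        by (intro bexI[of _ "\<lambda>v. R1 v + R2 v"]) (auto simp: distrib_right intro: polyfun.add)
    qed
    then show ?case by blast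
  next
    case (mult f g)
    from mult.IH(1) obtain N1 where N1: "\<forall>M\<ge>N1. cleared f M" ..
    from mult.IH(2) obtain N2 where N2: "\<forall>M\<ge>N2. cleared g M" ..
    have "cleared (\<lambda>v. f v * g v) M" if M: "M \<ge> N1 + N2" for M
    proof -
      have "cleared f N1" "cleared g (M - N1)" using N1 N2 M by auto
      then obtain R1 R2 where R: "R1 \<in> polyfun" "\<forall>v. q v \<noteq> 0 \<longrightarrow> f (G v) * q v ^ N1 = R1 v"
        "R2 \<in> polyfun" "\<forall>v. q v \<noteq> 0 \<longrightarrow> g (G v) * q v ^ (M - N1) = R2 v" unfolding cleared_def by blast
      have "f (G v) * g (G v) * q v ^ M = (f (G v) * q v ^ N1) * (g (G v) * q v ^ (M - N1))" for v
        using M by (simp add: mult_ac flip: power_add)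
      then have "\<forall>v. q v \<noteq> 0 \<longrightarrow> f (G v) * g (G v) * q v ^ M = R1 v * R2 v"
        using R by metis
      then show ?thesis unfolding cleared_def by (rule bexI[OF _ polyfun.mult[OF R(1,3)]])
    qed
    then show ?case by blast
  qed
  then show ?thesis unfolding cleared_def G_def .
qed

text \<open>The part of birationality that pulling back generic properties uses: a generic right inverse.  It
  ensures that the image meets every nonempty Zariski-open set.\<close>

definition dominant :: "(point \<rightharpoonup> point) \<Rightarrow> bool" where
  "dominant F \<longleftrightarrow> rational_map F \<and> (\<exists>G. generically (\<lambda>v. (F \<circ>\<^sub>m G) v = Some v))"

lemma birational_dominant: "birational F \<Longrightarrow> dominant F"
  by (auto simp: birational_def dominant_def)

text \<open>If \<open>P\<close> holds where \<open>r\<close> does not vanish, clear denominators in \<open>r \<circ> F\<close>.  The resulting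
  polynomial is not zero, because the right inverse provides a point that \<open>F\<close> sends to a point at
  which \<open>r\<close> does not vanish.\<close>

lemma generically_pullback:
  assumes "dominant F" "generically P"
  shows "generically (\<lambda>v. \<exists>u. F v = Some u \<and> P u)"
proof -
  obtain p1 p2 p3 p4 q where p: "p1 \<in> polyfun" "p2 \<in> polyfun" "p3 \<in> polyfun" "p4 \<in> polyfun" "q \<in> polyfun"
    and F: "F = (\<lambda>v. if q v = 0 then None else Some (p1 v / q v, p2 v / q v, p3 v / q v, p4 v / q v))"
    using assms(1) unfolding dominant_def rational_map_def by blast
  obtain r where r: "r \<in> polyfun" "r \<noteq> (\<lambda>_. 0)" "\<And>v. r v \<noteq> 0 \<Longrightarrow> P v"
    using assms(2) unfolding generically_def by blast
  obtain N R where R: "R \<in> polyfun"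
    "\<And>v. q v \<noteq> 0 \<Longrightarrow> r (p1 v / q v, p2 v / q v, p3 v / q v, p4 v / q v) * q v ^ N = R v"
    using polyfun_substitute[OF r(1) p] by blast
  obtain G where "generically (\<lambda>v. (F \<circ>\<^sub>m G) v = Some v)" using assms(1) unfolding dominant_def by blast
  with generically_conj[OF _ generically_nonzero[OF r(1,2)]] generically_ex
  obtain u where u: "(F \<circ>\<^sub>m G) u = Some u" "r u \<noteq> 0" by fast
  then obtain v where "F v = Some u" by (auto simp: map_comp_def split: option.splits)
  then have "q v * R v \<noteq> 0" using u(2) R(2)[of v] by (auto simp: F split: if_splits)
  then have "(\<lambda>v. q v * R v) \<noteq> (\<lambda>_. 0)" by (rule nonzero_funI)
  from generically_nonzero[OF polyfun.mult[OF p(5) R(1)] this] show ?thesis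
  proof (rule generically_mono)
    fix v assume "q v * R v \<noteq> 0"
    then show "\<exists>u. F v = Some u \<and> P u"
      using R(2)[of v] by (auto simp: F intro!: r(3))
  qed
qed

lemma rational_map_generically_defined: "rational_map F \<Longrightarrow> generically (\<lambda>v. F v \<noteq> None)"
proof -
  assume "rational_map F"
  then obtain p1 p2 p3 p4 q where q: "q \<in> polyfun" "q \<noteq> (\<lambda>_. 0)"
    and F: "F = (\<lambda>v. if q v = 0 then None else Some (p1 v / q v, p2 v / q v, p3 v / q v, p4 v / q v))"
    unfolding rational_map_def by blast
  show ?thesis by (rule generically_mono[OF generically_nonzero[OF q]]) (simp add: F)
qed

text \<open>A rational map is required to be undefined exactly on the zeros of one denominator.  With a
  common exponent for the numerators and the denominator of \<open>F\<close>, the product of the denominator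
  of \<open>G\<close> and the cleared denominator of \<open>F \<circ> G\<close> is a denominator with this property.\<close>

lemma rational_map_comp:
  assumes "rational_map F" "dominant G"
  shows "rational_map (F \<circ>\<^sub>m G)"
proof -
  obtain p1 p2 p3 p4 q where p: "p1 \<in> polyfun" "p2 \<in> polyfun" "p3 \<in> polyfun" "p4 \<in> polyfun" "q \<in> polyfun"
    and G: "G = (\<lambda>v. if q v = 0 then None else Some (p1 v / q v, p2 v / q v, p3 v / q v, p4 v / q v))"
    using assms(2) unfolding dominant_def rational_map_def by blast
  obtain f1 f2 f3 f4 r where f: "f1 \<in> polyfun" "f2 \<in> polyfun" "f3 \<in> polyfun" "f4 \<in> polyfun" "r \<in> polyfun"
    and F: "F = (\<lambda>v. if r v = 0 then None else Some (f1 v / r v, f2 v / r v, f3 v / r v, f4 v / r v))"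
    using assms(1) unfolding rational_map_def by blast
  let ?G = "\<lambda>v. (p1 v / q v, p2 v / q v, p3 v / q v, p4 v / q v)"
  obtain N where N: "\<And>M g. M \<ge> N \<Longrightarrow> g \<in> {f1, f2, f3, f4, r} \<Longrightarrow>
      \<exists>R\<in>polyfun. \<forall>v. q v \<noteq> 0 \<longrightarrow> g (?G v) * q v ^ M = R v"
  proof -
    have "\<forall>g\<in>{f1, f2, f3, f4, r}. \<exists>N. \<forall>M\<ge>N. \<exists>R\<in>polyfun. \<forall>v. q v \<noteq> 0 \<longrightarrow> g (?G v) * q v ^ M = R v"
      using polyfun_substitute[OF _ p] f by blast
    then obtain N where N: "\<forall>g\<in>{f1, f2, f3, f4, r}. \<forall>M\<ge>N g. \<exists>R\<in>polyfun. \<forall>v. q v \<noteq> 0 \<longrightarrow> g (?G v) * q v ^ M = R v"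
      by metis
    show thesis by (rule that[of "Max (N ` {f1, f2, f3, f4, r})"]) (use N in auto)
  qed
  obtain h where h: "\<And>g. g \<in> {f1, f2, f3, f4, r} \<Longrightarrow> h g \<in> polyfun"
     "\<And>g v. g \<in> {f1, f2, f3, f4, r} \<Longrightarrow> q v \<noteq> 0 \<Longrightarrow> g (?G v) * q v ^ N = h g v"
    using N[OF order_refl] by metis
  have frac: "f (?G v) / r (?G v) = (q v * h f v) / (q v * h r v)" if "f \<in> {f1, f2, f3, f4}" "q v \<noteq> 0" for f v
    using h(2)[of f v] h(2)[of r v] that by (auto simp flip: h(2))
  have zero: "h r v = 0 \<longleftrightarrow> r (?G v) = 0" if "q v \<noteq> 0" for v
    using h(2)[of r v] that by auto
  have eq: "(F \<circ>\<^sub>m G) = (\<lambda>v. if q v * h r v = 0 then None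
      else Some (q v * h f1 v / (q v * h r v), q v * h f2 v / (q v * h r v),
                 q v * h f3 v / (q v * h r v), q v * h f4 v / (q v * h r v)))"
  proof
    fix v
    show "(F \<circ>\<^sub>m G) v = (if q v * h r v = 0 then None
      else Some (q v * h f1 v / (q v * h r v), q v * h f2 v / (q v * h r v),
                 q v * h f3 v / (q v * h r v), q v * h f4 v / (q v * h r v)))"
    proof (cases "q v = 0")
      case True
      then show ?thesis by (simp add: G)
    next
      case False
      then show ?thesis using frac[of _ v] zero[of v] by (simp add: F G)
    qed
  qed
  have nz: "(\<lambda>v. q v * h r v) \<noteq> (\<lambda>_. 0)"
  proof -
    have "generically (\<lambda>v. \<exists>u. G v = Some u \<and> F u \<noteq> None)"
      using generically_pullback[OF assms(2) rational_map_generically_defined[OF assms(1)]] .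
    from generically_ex[OF this] obtain v u where "G v = Some u" "F u \<noteq> None" by blast
    then have q: "q v \<noteq> 0" and u: "u = ?G v" by (simp_all add: G split: if_splits)
    have "r u \<noteq> 0" using \<open>F u \<noteq> None\<close> by (simp add: F split: if_splits)
    then have "q v * h r v \<noteq> 0" using q zero[OF q] u by simp
    then show ?thesis by (rule nonzero_funI)
  qed
  have poly: "(\<lambda>v. q v * h g v) \<in> polyfun" if "g \<in> {f1, f2, f3, f4, r}" for g
    using p(5) h(1)[OF that] by (rule polyfun.mult)
  show ?thesis unfolding rational_map_def
    by (rule bexI[OF _ poly[of f1]], rule bexI[OF _ poly[of f2]], rule bexI[OF _ poly[of f3]],
        rule bexI[OF _ poly[of f4]], rule bexI[OF _ poly[of r]], rule conjI[OF nz eq]) simp_all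
qed

lemma map_comp_assoc: "(f \<circ>\<^sub>m g) \<circ>\<^sub>m h = f \<circ>\<^sub>m (g \<circ>\<^sub>m h)"
  by (auto simp: map_comp_def fun_eq_iff split: option.splits)

lemma map_comp_Some [simp]: "f \<circ>\<^sub>m Some = f" "Some \<circ>\<^sub>m f = f"
  by (auto simp: map_comp_def fun_eq_iff split: option.splits)

lemma birational_comp:
  assumes "birational F" "birational G"
  shows "birational (F \<circ>\<^sub>m G)"
proof -
  obtain F' where F': "rational_map F'" "generically (\<lambda>v. (F' \<circ>\<^sub>m F) v = Some v)" "generically (\<lambda>v. (F \<circ>\<^sub>m F') v = Some v)"
    using assms(1) unfolding birational_def by (elim conjE exE) (rule that; assumption)
  obtain G' where G': "rational_map G'" "generically (\<lambda>v. (G' \<circ>\<^sub>m G) v = Some v)" "generically (\<lambda>v. (G \<circ>\<^sub>m G') v = Some v)"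
    using assms(2) unfolding birational_def by (elim conjE exE) (rule that; assumption)
  have dF': "dominant F'" unfolding dominant_def using F'(1,2) by (intro conjI exI)
  have dG: "dominant G" using assms(2) by (rule birational_dominant)
  have cancel: "generically (\<lambda>v. ((A \<circ>\<^sub>m B) \<circ>\<^sub>m (B' \<circ>\<^sub>m A')) v = Some v)"
    if A: "generically (\<lambda>v. (A \<circ>\<^sub>m A') v = Some v)" and B: "generically (\<lambda>v. (B \<circ>\<^sub>m B') v = Some v)"
      and d: "dominant A'" for A B A' B' :: "point \<rightharpoonup> point"
  proof (rule generically_mono[OF generically_conj[OF A generically_pullback[OF d B]]])
    fix v assume "(A \<circ>\<^sub>m A') v = Some v \<and> (\<exists>u. A' v = Some u \<and> (B \<circ>\<^sub>m B') u = Some u)"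
    then obtain u where u: "A' v = Some u" "(A \<circ>\<^sub>m A') v = Some v" "(B \<circ>\<^sub>m B') u = Some u" by blast
    from u(3) obtain s where "B' u = Some s" "B s = Some u" unfolding map_comp_Some_iff by blast
    with u(1,2) show "((A \<circ>\<^sub>m B) \<circ>\<^sub>m (B' \<circ>\<^sub>m A')) v = Some v" by simp
  qed
  show ?thesis unfolding birational_def
  proof (intro conjI exI[of _ "G' \<circ>\<^sub>m F'"])
    show "rational_map (F \<circ>\<^sub>m G)"
      using assms(1) by (intro rational_map_comp dG) (simp add: birational_def)
    show "rational_map (G' \<circ>\<^sub>m F')" by (rule rational_map_comp[OF G'(1) dF'])
    show "generically (\<lambda>v. ((G' \<circ>\<^sub>m F') \<circ>\<^sub>m (F \<circ>\<^sub>m G)) v = Some v)"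
      by (rule cancel[OF G'(2) F'(2) dG])
    show "generically (\<lambda>v. ((F \<circ>\<^sub>m G) \<circ>\<^sub>m (G' \<circ>\<^sub>m F')) v = Some v)"
      by (rule cancel[OF F'(3) G'(3) dF'])
  qed
qed

lemma birational_Some: "birational Some"
proof -
  have one: "(\<lambda>_. 1) \<in> polyfun" "(\<lambda>_. 1) \<noteq> (\<lambda>_::point. 0 :: complex)"
    by (rule polyfun.const, rule nonzero_funI) simp
  have "Some = (\<lambda>v::point. if (1::complex) = 0 then None
      else Some (fst v / 1, fst (snd v) / 1, fst (snd (snd v)) / 1, snd (snd (snd v)) / 1))"
    by (rule ext) (simp add: prod_eq_iff)
  with one have eq: "(\<lambda>_. 1) \<noteq> (\<lambda>_::point. 0 :: complex) \<and> Some = (\<lambda>v::point. if (1::complex) = 0 then None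
      else Some (fst v / 1, fst (snd v) / 1, fst (snd (snd v)) / 1, snd (snd (snd v)) / 1))" by blast
  have "rational_map Some" unfolding rational_map_def
    by (rule bexI[OF _ polyfun_coordinates(1)], rule bexI[OF _ polyfun_coordinates(2)],
        rule bexI[OF _ polyfun_coordinates(3)], rule bexI[OF _ polyfun_coordinates(4)],
        rule bexI[OF _ one(1)], rule eq)
  then show ?thesis unfolding birational_def by (intro conjI exI[of _ Some]) (simp_all add: generically_True)
qed


section \<open>Solutions as integral curves\<close>

text \<open>The right-hand sides of Hamilton's equations, expanded.\<close>

fun ham_field :: "param \<Rightarrow> complex \<Rightarrow> point \<Rightarrow> point" where
  "ham_field (a0, a1, a2, a3) t (x, y, z, w) =
    ((3 * x^2 * y^2 - 2 * (t * x + 2 * a1 + a2 + a3) * x * y - (a0 * t - 1) * x + a1 * (a1 + a2 + a3)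
        + (2 * x * y - a1) * z * w) / t^2,
     - (2 * x * y^3 - 2 * t * x * y^2 - (2 * a1 + a2 + a3) * y^2 - (a0 * t - 1) * y - t + y^2 * z * w) / t^2,
     (- (z^2 * w^3) + 3 / 2 * a3 * z * w^2 + 1 / 2 * (2 * t * z^2 - a3^2) * w
        - 1 / 2 * ((a3 + 1) * t - 1) * z + (x * y - a1) * y * z) / t^2,
     - (- z * w^4 / 2 + a3 / 2 * w^3 + t * z * w^2 - 1 / 2 * ((a3 + 1) * t - 1) * w - t^2 * z / 2
        + (x * y - a1) * y * w) / t^2)"

lemma deriv_ham:
  fixes x y z w t :: complex
  shows "deriv (\<lambda>\<eta>. ham \<alpha> t (x, \<eta>, z, w)) y = fst (ham_field \<alpha> t (x, y, z, w))"
    and "- deriv (\<lambda>\<xi>. ham \<alpha> t (\<xi>, y, z, w)) x = fst (snd (ham_field \<alpha> t (x, y, z, w)))"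
    and "deriv (\<lambda>\<omega>. ham \<alpha> t (x, y, z, \<omega>)) w = fst (snd (snd (ham_field \<alpha> t (x, y, z, w))))"
    and "- deriv (\<lambda>\<zeta>. ham \<alpha> t (x, y, \<zeta>, w)) z = snd (snd (snd (ham_field \<alpha> t (x, y, z, w))))"
proof -
  obtain a0 a1 a2 a3 where \<alpha>: "\<alpha> = (a0, a1, a2, a3)" by (cases \<alpha>)
  have scale: "deriv (\<lambda>\<eta>. f \<eta> / t^2) s = D / t^2" if "(f has_field_derivative D) (at s)" for f D s
    using that by (intro DERIV_imp_deriv DERIV_cdivide)
  show "deriv (\<lambda>\<eta>. ham \<alpha> t (x, \<eta>, z, w)) y = fst (ham_field \<alpha> t (x, y, z, w))"
    unfolding \<alpha> ham.simps ham_field.simps fst_conv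
    by (rule scale, rule DERIV_cong, (rule derivative_intros numeral_neq_zero)+) (simp add: algebra_simps power2_eq_square power3_eq_cube)
  have "deriv (\<lambda>\<xi>. ham \<alpha> t (\<xi>, y, z, w)) x =
    (2 * x * y^3 - 2 * t * x * y^2 - (2 * a1 + a2 + a3) * y^2 - (a0 * t - 1) * y - t + y^2 * z * w) / t^2"
    unfolding \<alpha> ham.simps
    by (rule scale, rule DERIV_cong, (rule derivative_intros numeral_neq_zero)+) (simp add: algebra_simps power2_eq_square power3_eq_cube)
  then show "- deriv (\<lambda>\<xi>. ham \<alpha> t (\<xi>, y, z, w)) x = fst (snd (ham_field \<alpha> t (x, y, z, w)))"
    unfolding \<alpha> ham_field.simps fst_conv snd_conv by (simp only: minus_divide_left)
  show "deriv (\<lambda>\<omega>. ham \<alpha> t (x, y, z, \<omega>)) w = fst (snd (snd (ham_field \<alpha> t (x, y, z, w))))"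
    unfolding \<alpha> ham.simps ham_field.simps fst_conv snd_conv
    by (rule scale, rule DERIV_cong, (rule derivative_intros numeral_neq_zero)+) (simp add: algebra_simps power2_eq_square power3_eq_cube)
  have "deriv (\<lambda>\<zeta>. ham \<alpha> t (x, y, \<zeta>, w)) z =
    (- z * w^4 / 2 + a3 / 2 * w^3 + t * z * w^2 - 1 / 2 * ((a3 + 1) * t - 1) * w - t^2 * z / 2
        + (x * y - a1) * y * w) / t^2"
    unfolding \<alpha> ham.simps
    by (rule scale, rule DERIV_cong, (rule derivative_intros numeral_neq_zero)+) (simp add: algebra_simps power2_eq_square power3_eq_cube)
  then show "- deriv (\<lambda>\<zeta>. ham \<alpha> t (x, y, \<zeta>, w)) z = snd (snd (snd (ham_field \<alpha> t (x, y, z, w))))"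
    unfolding \<alpha> ham_field.simps fst_conv snd_conv by (simp only: minus_divide_left)
qed

definition coordinates_deriv :: "(complex \<Rightarrow> point) \<Rightarrow> point \<Rightarrow> complex \<Rightarrow> bool" where
  "coordinates_deriv \<phi> d t \<longleftrightarrow>
    ((\<lambda>s. fst (\<phi> s)) has_field_derivative fst d) (at t) \<and>
    ((\<lambda>s. fst (snd (\<phi> s))) has_field_derivative fst (snd d)) (at t) \<and>
    ((\<lambda>s. fst (snd (snd (\<phi> s)))) has_field_derivative fst (snd (snd d))) (at t) \<and>
    ((\<lambda>s. snd (snd (snd (\<phi> s)))) has_field_derivative snd (snd (snd d))) (at t)"

lemma ex_coordinate_functions:
  "(\<exists>x y z w. \<phi> = (\<lambda>t. (x t, y t, z t, w t)) \<and> P x y z w) \<longleftrightarrow>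
    P (\<lambda>t. fst (\<phi> t)) (\<lambda>t. fst (snd (\<phi> t))) (\<lambda>t. fst (snd (snd (\<phi> t)))) (\<lambda>t. snd (snd (snd (\<phi> t))))"
proof
  assume "\<exists>x y z w. \<phi> = (\<lambda>t. (x t, y t, z t, w t)) \<and> P x y z w"
  then show "P (\<lambda>t. fst (\<phi> t)) (\<lambda>t. fst (snd (\<phi> t))) (\<lambda>t. fst (snd (snd (\<phi> t)))) (\<lambda>t. snd (snd (snd (\<phi> t))))"
    by (elim exE conjE) simp
next
  assume P: "P (\<lambda>t. fst (\<phi> t)) (\<lambda>t. fst (snd (\<phi> t))) (\<lambda>t. fst (snd (snd (\<phi> t)))) (\<lambda>t. snd (snd (snd (\<phi> t))))"
  show "\<exists>x y z w. \<phi> = (\<lambda>t. (x t, y t, z t, w t)) \<and> P x y z w"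
    by (rule exI, rule exI, rule exI, rule exI, rule conjI[OF _ P]) simp
qed

lemma solution_iff:
  "solution \<alpha> U \<phi> \<longleftrightarrow> open U \<and> U \<subseteq> - {0} \<and> (\<forall>t\<in>U. coordinates_deriv \<phi> (ham_field \<alpha> t (\<phi> t)) t)"
  unfolding solution_def ex_coordinate_functions deriv_ham coordinates_deriv_def by simp

lemma coordinates_deriv_cong:
  assumes "coordinates_deriv \<phi> d t" "open U" "t \<in> U" "\<And>s. s \<in> U \<Longrightarrow> \<psi> s = \<phi> s"
  shows "coordinates_deriv \<psi> d t"
proof -
  have *: "((\<lambda>s. h (\<psi> s)) has_field_derivative e) (at t)"
    if "((\<lambda>s. h (\<phi> s)) has_field_derivative e) (at t)" for h :: "point \<Rightarrow> complex" and e
    by (rule has_field_derivative_transform_within_open[OF that assms(2,3)]) (simp add: assms(4))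
  show ?thesis using assms(1) unfolding coordinates_deriv_def
    by (elim conjE) (intro conjI *[of fst] *[of "\<lambda>v. fst (snd v)"]
        *[of "\<lambda>v. fst (snd (snd v))"] *[of "\<lambda>v. snd (snd (snd v))"])
qed

text \<open>The chain rule for the change of the independent variable from \<open>t\<close> to \<open>c * t\<close>.\<close>

lemma coordinates_deriv_rescale:
  assumes "coordinates_deriv (\<lambda>s. \<psi> (c * s)) (c * d1, c * d2, c * d3, c * d4) t" "c \<noteq> 0"
  shows "coordinates_deriv \<psi> (d1, d2, d3, d4) (c * t)"
proof -
  have *: "(g has_field_derivative d) (at (c * t))" if "((\<lambda>s. g (c * s)) has_field_derivative c * d) (at t)"
    for g :: "complex \<Rightarrow> complex" and d
  proof -
    have "((\<lambda>s. (\<lambda>s. g (c * s)) (s / c)) has_field_derivative c * d * (1 / c)) (at (c * t))"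
      by (rule DERIV_chain2[where f = "\<lambda>s. g (c * s)"])
        (use that assms(2) in \<open>auto intro!: derivative_eq_intros\<close>)
    then show ?thesis using assms(2) by simp
  qed
  show ?thesis using assms(1) unfolding coordinates_deriv_def fst_conv snd_conv
    by (elim conjE) (intro conjI *[of "\<lambda>s. fst (\<psi> s)"] *[of "\<lambda>s. fst (snd (\<psi> s))"]
        *[of "\<lambda>s. fst (snd (snd (\<psi> s)))"] *[of "\<lambda>s. snd (snd (snd (\<psi> s)))"])
qed

text \<open>The form in which each generator is verified: it suffices to differentiate the transformed
  coordinates as functions of the old independent variable.\<close>

lemma solution_transform:
  assumes "solution \<alpha> U \<phi>" "c \<noteq> 0"
    and "\<And>t. t \<in> U \<Longrightarrow> \<psi> (c * t) = f t (\<phi> t)"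
    and "\<And>t. t \<in> U \<Longrightarrow> coordinates_deriv (\<lambda>s. f s (\<phi> s))
      (case ham_field \<beta> (c * t) (f t (\<phi> t)) of (d1, d2, d3, d4) \<Rightarrow> (c * d1, c * d2, c * d3, c * d4)) t"
  shows "solution \<beta> ((\<lambda>t. c * t) ` U) \<psi>"
  unfolding solution_iff
proof (intro conjI ballI)
  have U: "open U" "U \<subseteq> - {0}" using assms(1) by (simp_all add: solution_iff)
  have "(\<lambda>t. c * t) ` U = (\<lambda>s. s / c) -` U" using assms(2) by (auto intro: rev_image_eqI)
  moreover have "continuous_on UNIV (\<lambda>s. s / c)" using assms(2) by (intro continuous_intros) simp
  ultimately show "open ((\<lambda>t. c * t) ` U)" using open_vimage[OF U(1)] by simp
  show "(\<lambda>t. c * t) ` U \<subseteq> - {0}" using U(2) assms(2) by auto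
  fix s assume "s \<in> (\<lambda>t. c * t) ` U"
  then obtain t where t: "t \<in> U" "s = c * t" by blast
  obtain d1 d2 d3 d4 where d: "ham_field \<beta> (c * t) (f t (\<phi> t)) = (d1, d2, d3, d4)"
    by (cases "ham_field \<beta> (c * t) (f t (\<phi> t))")
  have "coordinates_deriv (\<lambda>s. \<psi> (c * s)) (c * d1, c * d2, c * d3, c * d4) t"
    using coordinates_deriv_cong[OF assms(4)[OF t(1)] U(1) t(1)] assms(3) d by simp
  from coordinates_deriv_rescale[OF this assms(2)]
  show "coordinates_deriv \<psi> (ham_field \<beta> s (\<psi> s)) s" using t d assms(3) by simp
qed

section \<open>Composition of Baecklund transformations\<close>

text \<open>A Baecklund transformation together with its action on the independent variable and on the
  parameters, which are needed explicitly to compose transformations and to detect nontrivial ones.\<close>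

definition backlund_with :: "transf \<Rightarrow> (complex \<Rightarrow> complex) \<Rightarrow> (param \<Rightarrow> param) \<Rightarrow> bool" where
  "backlund_with T \<tau> a \<longleftrightarrow> bij_betw \<tau> (- {0}) (- {0}) \<and> bij_betw a params params \<and>
    (\<forall>\<alpha>\<in>params. \<forall>t. t \<noteq> 0 \<longrightarrow>
      (\<exists>F. birational F \<and> (\<forall>v. T (v, t, \<alpha>) = map_option (\<lambda>u. (u, \<tau> t, a \<alpha>)) (F v)))) \<and>
    (\<forall>\<alpha>\<in>params. open {(v, t). t \<noteq> 0 \<and> T (v, t, \<alpha>) \<noteq> None} \<and>
      continuous_on {(v, t). t \<noteq> 0 \<and> T (v, t, \<alpha>) \<noteq> None} (\<lambda>(v, t). the (T (v, t, \<alpha>)))) \<and>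
    (\<forall>\<alpha>\<in>params. \<forall>U \<phi> \<psi>.
      solution \<alpha> U \<phi> \<and> (\<forall>t\<in>U. T (\<phi> t, t, \<alpha>) = Some (\<psi> (\<tau> t), \<tau> t, a \<alpha>)) \<longrightarrow>
      solution (a \<alpha>) (\<tau> ` U) \<psi>)"

lemma backlund_iff_with: "backlund T \<longleftrightarrow> (\<exists>\<tau> a. backlund_with T \<tau> a)"
  unfolding backlund_def backlund_with_def ..

lemma backlund_with_birational:
  assumes "backlund_with T \<tau> a" "\<alpha> \<in> params" "t \<noteq> 0"
  obtains F where "birational F" "\<And>v. T (v, t, \<alpha>) = map_option (\<lambda>u. (u, \<tau> t, a \<alpha>)) (F v)"
proof -
  have "\<exists>F. birational F \<and> (\<forall>v. T (v, t, \<alpha>) = map_option (\<lambda>u. (u, \<tau> t, a \<alpha>)) (F v))"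
    using assms unfolding backlund_with_def by simp
  then show thesis by (elim exE conjE) (rule that, assumption, erule spec)
qed

lemma backlund_with_target:
  assumes "backlund_with T \<tau> a" "\<alpha> \<in> params" "t \<noteq> 0" "T (v, t, \<alpha>) = Some r"
  shows "snd r = (\<tau> t, a \<alpha>)" "\<tau> t \<noteq> 0" "a \<alpha> \<in> params"
proof -
  obtain F where "\<And>v. T (v, t, \<alpha>) = map_option (\<lambda>u. (u, \<tau> t, a \<alpha>)) (F v)"
    using backlund_with_birational[OF assms(1-3)] by blast
  then show "snd r = (\<tau> t, a \<alpha>)" using assms(4) by auto
  have "bij_betw \<tau> (- {0}) (- {0})" "bij_betw a params params"
    using assms(1) unfolding backlund_with_def by simp_all
  then show "\<tau> t \<noteq> 0" "a \<alpha> \<in> params" using assms(2,3) by (auto dest: bij_betwE)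
qed

definition everywhere :: "(point \<times> complex \<times> param \<Rightarrow> bool) \<Rightarrow> bool" where
  "everywhere P \<longleftrightarrow> (\<forall>\<alpha>\<in>params. \<forall>t. t \<noteq> 0 \<longrightarrow> generically (\<lambda>v. P (v, t, \<alpha>)))"

lemma everywhere_True: "(\<And>p. P p) \<Longrightarrow> everywhere P"
  by (simp add: everywhere_def generically_True)

lemma everywhere_mono: "everywhere P \<Longrightarrow> (\<And>p. P p \<Longrightarrow> Q p) \<Longrightarrow> everywhere Q"
  unfolding everywhere_def by (blast intro: generically_mono)

lemma everywhere_conj: "everywhere P \<Longrightarrow> everywhere Q \<Longrightarrow> everywhere (\<lambda>p. P p \<and> Q p)"
  unfolding everywhere_def by (simp add: generically_conj)

lemma everywhere_pullback:
  assumes "backlund T" "everywhere P"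
  shows "everywhere (\<lambda>p. \<exists>r. T p = Some r \<and> P r)"
  unfolding everywhere_def
proof (intro ballI allI impI)
  fix \<alpha> t assume at: "\<alpha> \<in> params" "t \<noteq> (0 :: complex)"
  obtain \<tau> a where T: "backlund_with T \<tau> a" using assms(1) unfolding backlund_iff_with by blast
  obtain F where F: "birational F" "\<And>v. T (v, t, \<alpha>) = map_option (\<lambda>u. (u, \<tau> t, a \<alpha>)) (F v)"
    using backlund_with_birational[OF T at] by blast
  have "bij_betw \<tau> (- {0}) (- {0})" "bij_betw a params params"
    using T unfolding backlund_with_def by simp_all
  then have "\<tau> t \<noteq> 0" "a \<alpha> \<in> params" using at by (auto dest: bij_betwE)
  then have "generically (\<lambda>u. P (u, \<tau> t, a \<alpha>))" using assms(2) unfolding everywhere_def by blast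
  from generically_pullback[OF birational_dominant[OF F(1)] this]
  show "generically (\<lambda>v. \<exists>r. T (v, t, \<alpha>) = Some r \<and> P r)"
  proof (rule generically_mono)
    fix v assume "\<exists>u. F v = Some u \<and> P (u, \<tau> t, a \<alpha>)"
    then obtain u where "F v = Some u" "P (u, \<tau> t, a \<alpha>)" by blast
    then show "\<exists>r. T (v, t, \<alpha>) = Some r \<and> P r" by (intro exI[of _ "(u, \<tau> t, a \<alpha>)"]) (simp add: F(2))
  qed
qed

lemma backlund_everywhere_defined: "backlund T \<Longrightarrow> everywhere (\<lambda>p. T p \<noteq> None)"
  by (rule everywhere_mono[OF everywhere_pullback[OF _ everywhere_True[of "\<lambda>_. True"]]]) auto

text \<open>For solutions, an intermediate curve \<open>\<theta>\<close> has to be constructed as a function of the intermediate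
  time; this is possible because \<open>\<tau>'\<close> is injective.\<close>

lemma backlund_with_comp:
  assumes T: "backlund_with T \<tau> a" and T': "backlund_with T' \<tau>' a'"
  shows "backlund_with (T \<circ>\<^sub>m T') (\<tau> \<circ> \<tau>') (a \<circ> a')"
proof -
  have bij: "bij_betw \<tau> (- {0}) (- {0})" "bij_betw \<tau>' (- {0}) (- {0})"
    "bij_betw a params params" "bij_betw a' params params"
    using T T' unfolding backlund_with_def by simp_all
  have birat: "\<exists>F. birational F \<and> (\<forall>v. (T \<circ>\<^sub>m T') (v, t, \<alpha>) = map_option (\<lambda>u. (u, (\<tau> \<circ> \<tau>') t, (a \<circ> a') \<alpha>)) (F v))"
    if at: "\<alpha> \<in> params" "t \<noteq> 0" for \<alpha> t
  proof -
    have at': "a' \<alpha> \<in> params" "\<tau>' t \<noteq> 0" using at bij by (auto dest: bij_betwE)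
    obtain F' where F': "birational F'" "\<And>v. T' (v, t, \<alpha>) = map_option (\<lambda>u. (u, \<tau>' t, a' \<alpha>)) (F' v)"
      using backlund_with_birational[OF T' at] by blast
    obtain F where F: "birational F" "\<And>v. T (v, \<tau>' t, a' \<alpha>) = map_option (\<lambda>u. (u, \<tau> (\<tau>' t), a (a' \<alpha>))) (F v)"
      using backlund_with_birational[OF T at'] by blast
    have "(T \<circ>\<^sub>m T') (v, t, \<alpha>) = map_option (\<lambda>u. (u, (\<tau> \<circ> \<tau>') t, (a \<circ> a') \<alpha>)) ((F \<circ>\<^sub>m F') v)" for v
      by (cases "F' v") (simp_all add: F(2) F'(2) map_comp_def)
    then show ?thesis using birational_comp[OF F(1) F'(1)] by blast
  qed
  have cont: "open {(v, t). t \<noteq> 0 \<and> (T \<circ>\<^sub>m T') (v, t, \<alpha>) \<noteq> None} \<and>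
      continuous_on {(v, t). t \<noteq> 0 \<and> (T \<circ>\<^sub>m T') (v, t, \<alpha>) \<noteq> None} (\<lambda>(v, t). the ((T \<circ>\<^sub>m T') (v, t, \<alpha>)))"
    (is "open ?D \<and> continuous_on ?D ?f")
    if \<alpha>: "\<alpha> \<in> params" for \<alpha>
  proof -
    have a': "a' \<alpha> \<in> params" using \<alpha> bij by (auto dest: bij_betwE)
    let ?D' = "{(v, t). t \<noteq> 0 \<and> T' (v, t, \<alpha>) \<noteq> None}"
    let ?E = "{(v, t). t \<noteq> 0 \<and> T (v, t, a' \<alpha>) \<noteq> None}"
    let ?g = "\<lambda>p. case the (T' (fst p, snd p, \<alpha>)) of (u, s, b) \<Rightarrow> (u, s)"
    have D': "open ?D'" "continuous_on ?D' (\<lambda>(v, t). the (T' (v, t, \<alpha>)))"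
      using T' \<alpha> unfolding backlund_with_def by simp_all
    have E: "open ?E" "continuous_on ?E (\<lambda>(v, t). the (T (v, t, a' \<alpha>)))"
      using T a' unfolding backlund_with_def by simp_all
    have g: "continuous_on ?D' ?g"
      using continuous_on_compose2[OF continuous_on_Pair[OF continuous_on_fst[OF continuous_on_id]
            continuous_on_fst[OF continuous_on_snd[OF continuous_on_id]]] D'(2), of UNIV]
      by (simp add: case_prod_unfold)
    have step: "\<exists>u s. T' (v, t, \<alpha>) = Some (u, s, a' \<alpha>) \<and> ?g (v, t) = (u, s) \<and> s \<noteq> 0"
      if t: "t \<noteq> 0" and def: "T' (v, t, \<alpha>) \<noteq> None" for v t
    proof -
      obtain u s b where r: "T' (v, t, \<alpha>) = Some (u, s, b)" using def by (cases "T' (v, t, \<alpha>)") auto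
      have "s \<noteq> 0" "b = a' \<alpha>" using backlund_with_target[OF T' \<alpha> t r] by simp_all
      with r show ?thesis by (intro exI[of _ u] exI[of _ s]) simp
    qed
    have D: "?D = ?D' \<inter> ?g -` ?E"
    proof (rule Set.set_eqI)
      fix p :: "point \<times> complex"
      obtain v t where p: "p = (v, t)" by (cases p)
      show "p \<in> ?D \<longleftrightarrow> p \<in> ?D' \<inter> ?g -` ?E"
      proof (cases "t \<noteq> 0 \<and> T' (v, t, \<alpha>) \<noteq> None")
        case True
        then obtain u s where us: "T' (v, t, \<alpha>) = Some (u, s, a' \<alpha>)" "?g (v, t) = (u, s)" "s \<noteq> 0"
          using step[of t v] by blast
        show ?thesis using True us(1,3)
          unfolding p vimage_def Int_iff mem_Collect_eq us(2) case_prod_conv by (simp add: map_comp_def)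
      next
        case False
        then show ?thesis unfolding p by (cases "T' (v, t, \<alpha>) = None") (simp_all add: map_comp_def)
      qed
    qed
    have f: "?f p = (\<lambda>(v, t). the (T (v, t, a' \<alpha>))) (?g p)" if p: "p \<in> ?D" for p
    proof -
      obtain v t where vt: "p = (v, t)" by (cases p)
      with p have "p \<in> ?D'" unfolding D by blast
      then have "t \<noteq> 0" "T' (v, t, \<alpha>) \<noteq> None" unfolding vt by simp_all
      then obtain u s where us: "T' (v, t, \<alpha>) = Some (u, s, a' \<alpha>)" "?g (v, t) = (u, s)"
        using step[of t v] by blast
      show ?thesis unfolding vt us(2) by (simp add: map_comp_def us(1))
    qed
    have op: "open ?D" unfolding D using continuous_open_preimage[OF g D'(1) E(1)] .
    have sub: "?D \<subseteq> ?D'" unfolding D by (rule Int_lower1)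
    have sub': "?g ` ?D \<subseteq> ?E" unfolding D by (rule image_subsetI) (erule IntD2[THEN vimageD])
    have "continuous_on ?D (\<lambda>p. (\<lambda>(v, t). the (T (v, t, a' \<alpha>))) (?g p))"
      using continuous_on_compose2[OF E(2) continuous_on_subset[OF g sub] sub'] .
    from continuous_on_eq[OF this f[symmetric]] have "continuous_on ?D ?f" .
    with op show ?thesis by (rule conjI)
  qed
  have sol: "solution ((a \<circ> a') \<alpha>) ((\<tau> \<circ> \<tau>') ` U) \<psi>"
    if \<alpha>: "\<alpha> \<in> params" and U: "solution \<alpha> U \<phi>"
      and eq: "\<forall>t\<in>U. (T \<circ>\<^sub>m T') (\<phi> t, t, \<alpha>) = Some (\<psi> ((\<tau> \<circ> \<tau>') t), (\<tau> \<circ> \<tau>') t, (a \<circ> a') \<alpha>)"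
    for \<alpha> U \<phi> \<psi>
  proof -
    have a': "a' \<alpha> \<in> params" using \<alpha> bij by (auto dest: bij_betwE)
    have U0: "U \<subseteq> - {0}" using U by (simp add: solution_def)
    define \<theta> where "\<theta> s = (let t = inv_into (- {0}) \<tau>' s in fst (the (T' (\<phi> t, t, \<alpha>))))" for s
    have T'\<theta>: "T' (\<phi> t, t, \<alpha>) = Some (\<theta> (\<tau>' t), \<tau>' t, a' \<alpha>)" if t: "t \<in> U" for t
    proof -
      have "inv_into (- {0}) \<tau>' (\<tau>' t) = t"
        using bij(2) t U0 by (intro inv_into_f_f) (auto simp: bij_betw_def)
      moreover obtain r where r: "T' (\<phi> t, t, \<alpha>) = Some r"
        using eq t by (fastforce simp: map_comp_Some_iff)
      moreover have "snd r = (\<tau>' t, a' \<alpha>)" using backlund_with_target(1)[OF T' \<alpha> _ r] t U0 by auto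
      ultimately show ?thesis by (simp add: \<theta>_def prod_eq_iff)
    qed
    have "\<forall>t\<in>U. T' (\<phi> t, t, \<alpha>) = Some (\<theta> (\<tau>' t), \<tau>' t, a' \<alpha>)" using T'\<theta> by blast
    then have s1: "solution (a' \<alpha>) (\<tau>' ` U) \<theta>"
      using T' \<alpha> U unfolding backlund_with_def by blast
    have "\<forall>s\<in>\<tau>' ` U. T (\<theta> s, s, a' \<alpha>) = Some (\<psi> (\<tau> s), \<tau> s, a (a' \<alpha>))"
      using eq T'\<theta> by (simp add: map_comp_def)
    then have "solution (a (a' \<alpha>)) (\<tau> ` \<tau>' ` U) \<psi>"
      using T a' s1 unfolding backlund_with_def by blast
    then show ?thesis by (simp add: image_image comp_def)
  qed
  show ?thesis unfolding backlund_with_def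
    using bij_betw_trans[OF bij(2,1)] bij_betw_trans[OF bij(4,3)] birat cont sol
    by (intro conjI ballI allI impI) auto
qed

lemma backlund_comp: "backlund T \<Longrightarrow> backlund T' \<Longrightarrow> backlund (T \<circ>\<^sub>m T')"
  unfolding backlund_iff_with using backlund_with_comp by blast

lemma continuous_on_Pair_const: "continuous_on A (\<lambda>(v :: point, t :: complex). (v, t, \<alpha> :: param))"
  by (simp add: case_prod_unfold continuous_intros)

lemma backlund_with_Some: "backlund_with Some id id"
  unfolding backlund_with_def
proof (intro conjI ballI allI impI)
  fix \<alpha> :: param and t :: complex
  show "\<exists>F. birational F \<and> (\<forall>v. Some (v, t, \<alpha>) = map_option (\<lambda>u. (u, id t, id \<alpha>)) (F v))"
    using birational_Some by (intro exI[of _ Some]) simp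
next
  fix \<alpha> :: param
  show "open {(v :: point, t :: complex). t \<noteq> 0 \<and> Some (v, t, \<alpha>) \<noteq> None}"
    using open_Collect_neq[OF continuous_on_snd[OF continuous_on_id] continuous_on_const]
    by (simp add: case_prod_unfold)
  show "continuous_on {(v :: point, t :: complex). t \<noteq> 0 \<and> Some (v, t, \<alpha>) \<noteq> None} (\<lambda>(v, t). the (Some (v, t, \<alpha>)))"
    by (simp add: continuous_on_Pair_const)
next
  fix \<alpha> U \<phi> \<psi>
  assume *: "solution \<alpha> U \<phi> \<and> (\<forall>t\<in>U. Some (\<phi> t, t, \<alpha>) = Some (\<psi> (id t), id t, id \<alpha>))"
  then have eq: "\<psi> s = \<phi> s" if "s \<in> U" for s using that by auto
  have U: "open U" "U \<subseteq> - {0}" "\<And>t. t \<in> U \<Longrightarrow> coordinates_deriv \<phi> (ham_field \<alpha> t (\<phi> t)) t"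
    using * unfolding solution_iff by blast+
  have "solution \<alpha> U \<psi>" unfolding solution_iff
  proof (intro conjI ballI U(1,2))
    fix t assume t: "t \<in> U"
    show "coordinates_deriv \<psi> (ham_field \<alpha> t (\<psi> t)) t"
      unfolding eq[OF t] by (rule coordinates_deriv_cong[OF U(3)[OF t] U(1) t eq])
  qed
  then show "solution (id \<alpha>) (id ` U) \<psi>" by simp
qed (auto simp: bij_betw_def)

section \<open>The group of classes of Baecklund transformations\<close>

lemma backlund_rel_iff:
  "(T, T') \<in> backlund_rel \<longleftrightarrow> backlund T \<and> backlund T' \<and> everywhere (\<lambda>p. T p = T' p)"
  by (simp add: backlund_rel_def everywhere_def)

lemma equiv_backlund_rel: "equiv (Collect backlund) backlund_rel"
proof (rule equivI)
  show "backlund_rel \<subseteq> Collect backlund \<times> Collect backlund" by (auto simp: backlund_rel_iff)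
  show "refl_on (Collect backlund) backlund_rel"
    by (auto simp: refl_on_def backlund_rel_iff intro: everywhere_True)
  show "sym backlund_rel"
    by (auto simp: sym_def backlund_rel_iff elim!: everywhere_mono)
  show "trans backlund_rel"
  proof (rule transI)
    fix T1 T2 T3 assume "(T1, T2) \<in> backlund_rel" "(T2, T3) \<in> backlund_rel"
    then have "backlund T1" "backlund T3" and
      eq: "everywhere (\<lambda>p. T1 p = T2 p \<and> T2 p = T3 p)"
      by (simp_all add: backlund_rel_iff everywhere_conj)
    moreover have "everywhere (\<lambda>p. T1 p = T3 p)" by (rule everywhere_mono[OF eq]) simp
    ultimately show "(T1, T3) \<in> backlund_rel" by (simp add: backlund_rel_iff)
  qed
qed

lemma backlund_class_eq_iff:
  "backlund T \<Longrightarrow> backlund T' \<Longrightarrow> backlund_class T = backlund_class T' \<longleftrightarrow> everywhere (\<lambda>p. T p = T' p)"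
  unfolding backlund_class_def using eq_equiv_class_iff[OF equiv_backlund_rel, of T T']
  by (simp add: backlund_rel_iff)

text \<open>Both transformations are generically defined, hence it suffices to compare them where both are.\<close>

lemma backlund_class_eqI:
  assumes "backlund T" "backlund T'" "\<And>p r s. T p = Some r \<Longrightarrow> T' p = Some s \<Longrightarrow> r = s"
  shows "backlund_class T = backlund_class T'"
  unfolding backlund_class_eq_iff[OF assms(1,2)]
  using everywhere_conj[OF backlund_everywhere_defined[OF assms(1)] backlund_everywhere_defined[OF assms(2)]]
  by (rule everywhere_mono) (use assms(3) in auto)

lemma backlund_rel_comp:
  assumes "(T, T') \<in> backlund_rel" "(R, R') \<in> backlund_rel"
  shows "(T \<circ>\<^sub>m R, T' \<circ>\<^sub>m R') \<in> backlund_rel"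
proof -
  have b: "backlund T" "backlund T'" "backlund R" "backlund R'"
    and T: "everywhere (\<lambda>p. T p = T' p)" and R: "everywhere (\<lambda>p. R p = R' p)"
    using assms by (auto simp: backlund_rel_iff)
  have "everywhere (\<lambda>p. (T \<circ>\<^sub>m R) p = (T' \<circ>\<^sub>m R') p)"
    using everywhere_conj[OF R everywhere_pullback[OF b(3) T]]
    by (rule everywhere_mono) (auto simp: map_comp_def split: option.splits)
  then show ?thesis using b by (simp add: backlund_rel_iff backlund_comp)
qed

lemma backlund_class_mult:
  assumes "backlund T" "backlund T'"
  shows "backlund_class T \<otimes>\<^bsub>backlund_monoid\<^esub> backlund_class T' = backlund_class (T \<circ>\<^sub>m T')"
proof -
  have "congruent2 backlund_rel backlund_rel (\<lambda>T T'. backlund_class (T \<circ>\<^sub>m T'))"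
    unfolding backlund_class_def
    by (intro congruent2I' equiv_class_eq[OF equiv_backlund_rel] backlund_rel_comp)
  from UN_equiv_class2[OF equiv_backlund_rel equiv_backlund_rel this, of T T'] assms
  show ?thesis by (simp add: backlund_monoid_def backlund_class_def)
qed

lemma backlund_monoid_carrier: "carrier backlund_monoid = backlund_class ` Collect backlund"
  by (auto simp: backlund_monoid_def backlund_class_def quotient_def)

lemma backlund_Some: "backlund Some"
  using backlund_with_Some backlund_iff_with by blast

lemma monoid_backlund_monoid: "Group.monoid backlund_monoid"
proof (rule monoidI)
  have one: "\<one>\<^bsub>backlund_monoid\<^esub> = backlund_class Some" by (simp add: backlund_monoid_def)
  show "\<one>\<^bsub>backlund_monoid\<^esub> \<in> carrier backlund_monoid"
    unfolding one backlund_monoid_carrier using backlund_Some by blast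
  fix A assume "A \<in> carrier backlund_monoid"
  then obtain T where T: "backlund T" "A = backlund_class T" by (auto simp: backlund_monoid_carrier)
  show "\<one>\<^bsub>backlund_monoid\<^esub> \<otimes>\<^bsub>backlund_monoid\<^esub> A = A" "A \<otimes>\<^bsub>backlund_monoid\<^esub> \<one>\<^bsub>backlund_monoid\<^esub> = A"
    unfolding one T(2) by (simp_all add: backlund_class_mult backlund_Some T(1))
  fix B assume "B \<in> carrier backlund_monoid"
  then obtain R where R: "backlund R" "B = backlund_class R" by (auto simp: backlund_monoid_carrier)
  show "A \<otimes>\<^bsub>backlund_monoid\<^esub> B \<in> carrier backlund_monoid"
    using T R by (simp add: backlund_class_mult backlund_monoid_carrier backlund_comp)
  fix C assume "C \<in> carrier backlund_monoid"
  then obtain Q where Q: "backlund Q" "C = backlund_class Q" by (auto simp: backlund_monoid_carrier)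
  show "A \<otimes>\<^bsub>backlund_monoid\<^esub> B \<otimes>\<^bsub>backlund_monoid\<^esub> C = A \<otimes>\<^bsub>backlund_monoid\<^esub> (B \<otimes>\<^bsub>backlund_monoid\<^esub> C)"
    using T R Q by (simp add: backlund_class_mult backlund_comp map_comp_assoc)
qed

lemma group_backlund_group: "group backlund_group"
  unfolding backlund_group_def by (rule monoid.units_group[OF monoid_backlund_monoid])

lemma backlund_group_mult: "A \<otimes>\<^bsub>backlund_group\<^esub> B = A \<otimes>\<^bsub>backlund_monoid\<^esub> B"
  by (simp add: backlund_group_def units_of_def)

lemma backlund_group_one: "\<one>\<^bsub>backlund_group\<^esub> = backlund_class Some"
  by (simp add: backlund_group_def units_of_def backlund_monoid_def)

lemma backlund_class_in_group:
  assumes "backlund T" "backlund R"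
    and "backlund_class (T \<circ>\<^sub>m R) = backlund_class Some" "backlund_class (R \<circ>\<^sub>m T) = backlund_class Some"
  shows "backlund_class T \<in> carrier backlund_group"
proof -
  have one: "\<one>\<^bsub>backlund_monoid\<^esub> = backlund_class Some" by (simp add: backlund_monoid_def)
  have "backlund_class T \<in> Units backlund_monoid"
    unfolding Units_def backlund_monoid_carrier
    using assms one by (auto simp: backlund_class_mult intro!: exI[of _ R])
  then show ?thesis by (simp add: backlund_group_def units_of_def)
qed

section \<open>The generators are Baecklund transformations\<close>

lemma coordinates_deriv_tuple:
  "coordinates_deriv (\<lambda>s. (x s, y s, z s, w s)) (d1, d2, d3, d4) t \<longleftrightarrow>
    (x has_field_derivative d1) (at t) \<and> (y has_field_derivative d2) (at t) \<and>
    (z has_field_derivative d3) (at t) \<and> (w has_field_derivative d4) (at t)"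
  by (simp add: coordinates_deriv_def)

text \<open>Criterion for transformations of the shape of the generators: the domain is the complement of
  the zeros of one function \<open>q\<close>, time is multiplied by a constant, and the action on parameters is
  an involution.\<close>

lemma backlund_withI:
  fixes q :: "param \<Rightarrow> complex \<Rightarrow> point \<Rightarrow> complex" and f :: "param \<Rightarrow> complex \<Rightarrow> point \<Rightarrow> point"
  assumes c: "c \<noteq> 0" and a: "\<And>\<alpha>. \<alpha> \<in> params \<Longrightarrow> a \<alpha> \<in> params \<and> a (a \<alpha>) = \<alpha>"
    and T: "\<And>v t \<alpha>. T (v, t, \<alpha>) = (if q \<alpha> t v = 0 then None else Some (f \<alpha> t v, c * t, a \<alpha>))"
    and birat: "\<And>\<alpha> t. birational (\<lambda>v. if q \<alpha> t v = 0 then None else Some (f \<alpha> t v))"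
    and q: "\<And>\<alpha>. continuous_on UNIV (\<lambda>p. q \<alpha> (snd p) (fst p))"
    and f: "\<And>\<alpha>. continuous_on {p. q \<alpha> (snd p) (fst p) \<noteq> 0} (\<lambda>p. f \<alpha> (snd p) (fst p))"
    and deriv: "\<And>\<alpha> \<phi> t. \<alpha> \<in> params \<Longrightarrow> t \<noteq> 0 \<Longrightarrow> q \<alpha> t (\<phi> t) \<noteq> 0 \<Longrightarrow>
      coordinates_deriv \<phi> (ham_field \<alpha> t (\<phi> t)) t \<Longrightarrow>
      coordinates_deriv (\<lambda>s. f \<alpha> s (\<phi> s))
       (case ham_field (a \<alpha>) (c * t) (f \<alpha> t (\<phi> t)) of (d1, d2, d3, d4) \<Rightarrow> (c * d1, c * d2, c * d3, c * d4)) t"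
  shows "backlund_with T (\<lambda>t. c * t) a"
  unfolding backlund_with_def
proof (intro conjI ballI allI impI)
  show "bij_betw (\<lambda>t. c * t) (- {0}) (- {0})"
    using c by (intro bij_betw_byWitness[of _ "\<lambda>t. t / c"]) auto
  show "bij_betw a params params"
    using a by (intro bij_betw_byWitness[of _ a]) auto
next
  fix \<alpha> :: param and t :: complex
  show "\<exists>F. birational F \<and> (\<forall>v. T (v, t, \<alpha>) = map_option (\<lambda>u. (u, c * t, a \<alpha>)) (F v))"
    by (rule exI[of _ "\<lambda>v. if q \<alpha> t v = 0 then None else Some (f \<alpha> t v)"], rule conjI[OF birat]) (simp add: T)
next
  fix \<alpha> :: param
  have D: "{(v, t). t \<noteq> 0 \<and> T (v, t, \<alpha>) \<noteq> None} = {p. snd p \<noteq> 0} \<inter> {p. q \<alpha> (snd p) (fst p) \<noteq> 0}"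
    by (rule Set.set_eqI) (simp add: T case_prod_unfold del: not_None_eq)
  have "open {p :: point \<times> complex. snd p \<noteq> 0}" "open {p. q \<alpha> (snd p) (fst p) \<noteq> 0}"
    using open_Collect_neq[OF continuous_on_snd[OF continuous_on_id] continuous_on_const]
      open_Collect_neq[OF q continuous_on_const] by simp_all
  then show "open {(v, t). t \<noteq> 0 \<and> T (v, t, \<alpha>) \<noteq> None}" unfolding D by (rule open_Int)
  have "continuous_on {(v, t). t \<noteq> 0 \<and> T (v, t, \<alpha>) \<noteq> None} (\<lambda>p. (f \<alpha> (snd p) (fst p), c * snd p, a \<alpha>))"
    unfolding D by (intro continuous_intros continuous_on_subset[OF f]) auto
  then show "continuous_on {(v, t). t \<noteq> 0 \<and> T (v, t, \<alpha>) \<noteq> None} (\<lambda>(v, t). the (T (v, t, \<alpha>)))"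
    by (rule continuous_on_eq) (unfold D, simp add: T case_prod_unfold)
next
  fix \<alpha> U \<phi> \<psi>
  assume \<alpha>: "\<alpha> \<in> params"
    and *: "solution \<alpha> U \<phi> \<and> (\<forall>t\<in>U. T (\<phi> t, t, \<alpha>) = Some (\<psi> (c * t), c * t, a \<alpha>))"
  then have s: "solution \<alpha> U \<phi>" by blast
  have T\<phi>: "q \<alpha> t (\<phi> t) \<noteq> 0 \<and> \<psi> (c * t) = f \<alpha> t (\<phi> t)" if "t \<in> U" for t
  proof -
    have "T (\<phi> t, t, \<alpha>) = Some (\<psi> (c * t), c * t, a \<alpha>)" using * that by blast
    then show ?thesis unfolding T by (auto split: if_splits)
  qed
  show "solution (a \<alpha>) ((\<lambda>t. c * t) ` U) \<psi>"
  proof (rule solution_transform[OF s c, where f = "f \<alpha>"])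
    fix t assume t: "t \<in> U"
    show "\<psi> (c * t) = f \<alpha> t (\<phi> t)" using T\<phi>[OF t] by blast
    show "coordinates_deriv (\<lambda>s. f \<alpha> s (\<phi> s))
       (case ham_field (a \<alpha>) (c * t) (f \<alpha> t (\<phi> t)) of (d1, d2, d3, d4) \<Rightarrow> (c * d1, c * d2, c * d3, c * d4)) t"
      using s t T\<phi>[OF t] unfolding solution_iff by (intro deriv \<alpha>) auto
  qed
qed

lemma rational_mapI:
  assumes "p1 \<in> polyfun" "p2 \<in> polyfun" "p3 \<in> polyfun" "p4 \<in> polyfun" "q \<in> polyfun" "q u \<noteq> 0"
    and "\<And>v. F v = (if q v = 0 then None else Some (p1 v / q v, p2 v / q v, p3 v / q v, p4 v / q v))"
  shows "rational_map F"
  unfolding rational_map_def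
  by (rule bexI[OF _ assms(1)], rule bexI[OF _ assms(2)], rule bexI[OF _ assms(3)],
      rule bexI[OF _ assms(4)], rule bexI[OF _ assms(5)], rule conjI[OF nonzero_funI[of q, OF assms(6)]])
    (rule ext, rule assms(7))

text \<open>The generators satisfy more than birationality requires: the inverse formula applies at every
  point of the domain.\<close>

lemma birationalI:
  assumes "rational_map F" "rational_map G"
    and "\<And>v u. F v = Some u \<Longrightarrow> G u = Some v" "\<And>v u. G v = Some u \<Longrightarrow> F u = Some v"
  shows "birational F"
  unfolding birational_def
proof (intro conjI exI[of _ G] assms(1,2))
  show "generically (\<lambda>v. (G \<circ>\<^sub>m F) v = Some v)"
    by (rule generically_mono[OF rational_map_generically_defined[OF assms(1)]]) (auto simp: assms(3))
  show "generically (\<lambda>v. (F \<circ>\<^sub>m G) v = Some v)"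
    by (rule generically_mono[OF rational_map_generically_defined[OF assms(2)]]) (auto simp: assms(4))
qed

text \<open>The generators at a fixed time and parameter, as maps of the phase space.  The constant \<open>c\<close> is
  the parameter that occurs in the formula; replacing \<open>c\<close> by \<open>- c\<close>, and \<open>k\<close> by \<open>1 / k\<close> in the
  zeroth one, inverts the map.\<close>

definition S0_phase :: "complex \<Rightarrow> complex \<Rightarrow> point \<rightharpoonup> point" where
  "S0_phase k c = (\<lambda>(x, y, z, w). if y = 0 then None else Some (- (x + c / y + 1 / y^2), - y, k * z, w / k))"

definition S1_phase :: "complex \<Rightarrow> point \<rightharpoonup> point" where
  "S1_phase c = (\<lambda>(x, y, z, w). if x = 0 then None else Some (x, y - c / x, z, w))"

definition S2_phase :: "complex \<Rightarrow> complex \<Rightarrow> point \<rightharpoonup> point" where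
  "S2_phase t c = (\<lambda>(x, y, z, w). if y + w^2 - t = 0 then None
    else Some (x + c / (y + w^2 - t), y, z + 2 * c * w / (y + w^2 - t), w))"

definition S3_phase :: "complex \<Rightarrow> point \<rightharpoonup> point" where
  "S3_phase c = (\<lambda>(x, y, z, w). if z = 0 then None else Some (x, y, z, w - c / z))"

lemma birational_S0_phase: assumes "k \<noteq> 0" shows "birational (S0_phase k c)"
proof (rule birationalI)
  have rat: "rational_map (S0_phase k c)" if "k \<noteq> 0" for k c :: complex
    by ((rule rational_mapI[of "\<lambda>v. - (fst v * fst (snd v)^2 + c * fst (snd v) + 1)" "\<lambda>v. - (fst (snd v)^3)"
          "\<lambda>v. k * fst (snd (snd v)) * fst (snd v)^2" "\<lambda>v. (1 / k) * snd (snd (snd v)) * fst (snd v)^2"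
          "\<lambda>v. fst (snd v)^2" "(0, 1, 0, 0)"]; (intro polyfun_intros)?))
      (auto simp: S0_phase_def case_prod_unfold field_simps power2_eq_square power3_eq_cube power4_eq_xxxx that)
  show "rational_map (S0_phase k c)" "rational_map (S0_phase (1 / k) (- c))"
    using assms by (simp_all add: rat)
  show "S0_phase (1 / k) (- c) u = Some v" if "S0_phase k c v = Some u" for u v
    using that assms by (auto simp: S0_phase_def split: if_splits prod.splits)
  show "S0_phase k c u = Some v" if "S0_phase (1 / k) (- c) v = Some u" for u v
    using that assms by (auto simp: S0_phase_def split: if_splits prod.splits)
qed

lemma birational_S1_phase: "birational (S1_phase c)"
proof (rule birationalI)
  show "rational_map (S1_phase c)" for c :: complex
    by ((rule rational_mapI[of "\<lambda>v. fst v * fst v" "\<lambda>v. fst (snd v) * fst v - c"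
          "\<lambda>v. fst (snd (snd v)) * fst v" "\<lambda>v. snd (snd (snd v)) * fst v" "\<lambda>v. fst v" "(1, 0, 0, 0)"]; (intro polyfun_intros)?))
      (auto simp: S1_phase_def case_prod_unfold field_simps)
  then show "rational_map (S1_phase (- c))" .
  show "S1_phase (- c) u = Some v" if "S1_phase c v = Some u" for u v
    using that by (auto simp: S1_phase_def split: if_splits prod.splits)
  show "S1_phase c u = Some v" if "S1_phase (- c) v = Some u" for u v
    using that by (auto simp: S1_phase_def split: if_splits prod.splits)
qed

lemma birational_S2_phase: "birational (S2_phase t c)"
proof (rule birationalI)
  show "rational_map (S2_phase t c)" for c :: complex
    by ((rule rational_mapI[of "\<lambda>v. fst v * (fst (snd v) + snd (snd (snd v))^2 - t) + c"
          "\<lambda>v. fst (snd v) * (fst (snd v) + snd (snd (snd v))^2 - t)"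
          "\<lambda>v. fst (snd (snd v)) * (fst (snd v) + snd (snd (snd v))^2 - t) + 2 * c * snd (snd (snd v))"
          "\<lambda>v. snd (snd (snd v)) * (fst (snd v) + snd (snd (snd v))^2 - t)"
          "\<lambda>v. fst (snd v) + snd (snd (snd v))^2 - t" "(0, t + 1, 0, 0)"]; (intro polyfun_intros)?))
      (auto simp: S2_phase_def case_prod_unfold divide_simps)
  then show "rational_map (S2_phase t (- c))" .
  show "S2_phase t (- c) u = Some v" if "S2_phase t c v = Some u" for u v
    using that by (auto simp: S2_phase_def split: if_splits prod.splits)
  show "S2_phase t c u = Some v" if "S2_phase t (- c) v = Some u" for u v
    using that by (auto simp: S2_phase_def split: if_splits prod.splits)
qed

lemma birational_S3_phase: "birational (S3_phase c)"
proof (rule birationalI)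
  show "rational_map (S3_phase c)" for c :: complex
    by ((rule rational_mapI[of "\<lambda>v. fst v * fst (snd (snd v))" "\<lambda>v. fst (snd v) * fst (snd (snd v))"
          "\<lambda>v. fst (snd (snd v)) * fst (snd (snd v))" "\<lambda>v. snd (snd (snd v)) * fst (snd (snd v)) - c"
          "\<lambda>v. fst (snd (snd v))" "(0, 0, 1, 0)"]; (intro polyfun_intros)?))
      (auto simp: S3_phase_def case_prod_unfold field_simps)
  then show "rational_map (S3_phase (- c))" .
  show "S3_phase (- c) u = Some v" if "S3_phase c v = Some u" for u v
    using that by (auto simp: S3_phase_def split: if_splits prod.splits)
  show "S3_phase c u = Some v" if "S3_phase (- c) v = Some u" for u v
    using that by (auto simp: S3_phase_def split: if_splits prod.splits)
qed


lemma params_alpha0: "(a0, a1, a2, a3) \<in> params \<Longrightarrow> a0 = 1 - 2 * a1 - 2 * a2 - a3"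
  by (simp add: params_def algebra_simps)

lemma S3_deriv:
  assumes "t \<noteq> 0" "z t \<noteq> 0"
    and "coordinates_deriv (\<lambda>s. (x s, y s, z s, w s)) (ham_field (a0, a1, a2, a3) t (x t, y t, z t, w t)) t"
  shows "coordinates_deriv (\<lambda>s. (x s, y s, z s, w s - a3 / z s))
    (ham_field (a0, a1, a2 + a3, - a3) t (x t, y t, z t, w t - a3 / z t)) t"
  using assms(3) unfolding ham_field.simps coordinates_deriv_tuple
proof (elim conjE, intro conjI, goal_cases)
  case 1
  show ?case by (rule DERIV_cong[OF 1(1)]) (use assms(1,2) in \<open>simp add: field_simps power2_eq_square\<close>)
next
  case 2
  show ?case by (rule DERIV_cong[OF 2(2)]) (use assms(1,2) in \<open>simp add: field_simps power2_eq_square\<close>)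
next
  case 3
  show ?case by (rule DERIV_cong[OF 3(3)]) (use assms(1,2) in \<open>simp add: field_simps power2_eq_square power3_eq_cube power4_eq_xxxx\<close>)
next
  case 4
  show ?case
    by (rule DERIV_cong, (rule derivative_intros 4 assms(2))+)
      (use assms(1,2) in \<open>simp add: field_simps power2_eq_square power3_eq_cube power4_eq_xxxx\<close>)
qed

lemma S1_deriv:
  assumes "(a0, a1, a2, a3) \<in> params" "t \<noteq> 0" "x t \<noteq> 0"
    and "coordinates_deriv (\<lambda>s. (x s, y s, z s, w s)) (ham_field (a0, a1, a2, a3) t (x t, y t, z t, w t)) t"
  shows "coordinates_deriv (\<lambda>s. (x s, y s - a1 / x s, z s, w s))
    (ham_field (a0 + 2 * a1, - a1, a2 + a1, a3) t (x t, y t - a1 / x t, z t, w t)) t"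
  using assms(4) unfolding ham_field.simps coordinates_deriv_tuple
proof (elim conjE, intro conjI, goal_cases)
  case 1
  show ?case by (rule DERIV_cong[OF 1(1)]) (use assms(2,3) in \<open>simp add: field_simps power2_eq_square\<close>)
next
  case 2
  show ?case
    by (rule DERIV_cong, (rule derivative_intros 2 assms(3))+)
      (use assms(2,3) in \<open>simp add: params_alpha0[OF assms(1)] field_simps power2_eq_square power3_eq_cube power4_eq_xxxx\<close>)
next
  case 3
  show ?case by (rule DERIV_cong[OF 3(3)]) (use assms(2,3) in \<open>simp add: field_simps power2_eq_square power3_eq_cube power4_eq_xxxx\<close>)
next
  case 4
  show ?case by (rule DERIV_cong[OF 4(4)]) (use assms(2,3) in \<open>simp add: field_simps power2_eq_square power3_eq_cube power4_eq_xxxx\<close>)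
qed

lemma S0_deriv:
  assumes "(a0, a1, a2, a3) \<in> params" "t \<noteq> 0" "y t \<noteq> 0"
    and "coordinates_deriv (\<lambda>s. (x s, y s, z s, w s)) (ham_field (a0, a1, a2, a3) t (x t, y t, z t, w t)) t"
  shows "coordinates_deriv (\<lambda>s. (- (x s + a0 / y s + 1 / y s ^ 2), - y s, \<i> * z s, w s / \<i>))
    (case ham_field (- a0, a1 + a0, a2, a3) (- 1 * t) (- (x t + a0 / y t + 1 / y t ^ 2), - y t, \<i> * z t, w t / \<i>)
     of (d1, d2, d3, d4) \<Rightarrow> (- 1 * d1, - 1 * d2, - 1 * d3, - 1 * d4)) t"
  using assms(4) unfolding ham_field.simps coordinates_deriv_tuple case_prod_conv
proof (elim conjE, intro conjI, goal_cases)
  case 1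
  have "y t ^ 2 \<noteq> 0" using assms(3) by simp
  show ?case
    by (rule DERIV_cong, (rule derivative_intros 1 assms(3) \<open>y t ^ 2 \<noteq> 0\<close>)+)
      (use assms(2,3) in \<open>simp add: params_alpha0[OF assms(1)] field_simps power2_eq_square power3_eq_cube power4_eq_xxxx\<close>)
next
  case 2
  show ?case
    by (rule DERIV_cong, (rule derivative_intros 2)+)
      (use assms(2,3) in \<open>simp add: params_alpha0[OF assms(1)] field_simps power2_eq_square power3_eq_cube power4_eq_xxxx\<close>)
next
  case 3
  show ?case
    by (rule DERIV_cong, (rule derivative_intros 3)+)
      (use assms(2,3) in \<open>simp add: params_alpha0[OF assms(1)] field_simps power2_eq_square power3_eq_cube power4_eq_xxxx\<close>)
next
  case 4
  have "\<i> \<noteq> 0" by simp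
  show ?case
    by (rule DERIV_cong, (rule derivative_intros 4 \<open>\<i> \<noteq> 0\<close>)+)
      (use assms(2,3) in \<open>simp add: params_alpha0[OF assms(1)] field_simps power2_eq_square power3_eq_cube power4_eq_xxxx\<close>)
qed

text \<open>The components of the new vector field, multiplied by \<open>t^2\<close>, for the transformation whose
  denominator is \<open>y + w^2 - t\<close>.  With \<open>g\<close> for its inverse each identity is polynomial modulo
  \<open>g * (y + w^2 - t) - 1\<close>.  Here \<open>p2\<close> and \<open>p4\<close> are the numerators of the derivatives of \<open>y\<close> and
  \<open>w\<close>, and \<open>p2 + 2 * w * p4 - t^2\<close> is that of the derivative of the denominator.\<close>

lemma S2_identities:
  fixes x y z w t g a0 a1 a2 a3 :: complex
  assumes g: "g * (y + w^2 - t) = 1" and a0: "a0 = 1 - 2 * a1 - 2 * a2 - a3"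
  defines "p2 \<equiv> - (2 * x * y^3 - 2 * t * x * y^2 - (2 * a1 + a2 + a3) * y^2 - (a0 * t - 1) * y - t + y^2 * z * w)"
    and "p4 \<equiv> - (- z * w^4 / 2 + a3 / 2 * w^3 + t * z * w^2 - 1 / 2 * ((a3 + 1) * t - 1) * w - t^2 * z / 2
        + (x * y - a1) * y * w)"
  shows "(3 * x^2 * y^2 - 2 * (t * x + 2 * a1 + a2 + a3) * x * y - (a0 * t - 1) * x + a1 * (a1 + a2 + a3)
        + (2 * x * y - a1) * z * w) - a2 * g^2 * (p2 + 2 * w * p4 - t^2)
    = 3 * (x + a2 * g)^2 * y^2 - 2 * (t * (x + a2 * g) + 2 * (a1 + a2) + - a2 + (a3 + 2 * a2)) * (x + a2 * g) * y
        - (a0 * t - 1) * (x + a2 * g) + (a1 + a2) * (a1 + a2 + - a2 + (a3 + 2 * a2))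
        + (2 * (x + a2 * g) * y - (a1 + a2)) * (z + 2 * a2 * w * g) * w" (is "?L1 = ?R1")
    and "p2 = - (2 * (x + a2 * g) * y^3 - 2 * t * (x + a2 * g) * y^2
        - (2 * (a1 + a2) + - a2 + (a3 + 2 * a2)) * y^2 - (a0 * t - 1) * y - t + y^2 * (z + 2 * a2 * w * g) * w)"
      (is "_ = ?R2")
    and "(- (z^2 * w^3) + 3 / 2 * a3 * z * w^2 + 1 / 2 * (2 * t * z^2 - a3^2) * w
        - 1 / 2 * ((a3 + 1) * t - 1) * z + (x * y - a1) * y * z) + 2 * a2 * (p4 * g - w * g^2 * (p2 + 2 * w * p4 - t^2))
    = - ((z + 2 * a2 * w * g)^2 * w^3) + 3 / 2 * (a3 + 2 * a2) * (z + 2 * a2 * w * g) * w^2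
        + 1 / 2 * (2 * t * (z + 2 * a2 * w * g)^2 - (a3 + 2 * a2)^2) * w
        - 1 / 2 * (((a3 + 2 * a2) + 1) * t - 1) * (z + 2 * a2 * w * g)
        + ((x + a2 * g) * y - (a1 + a2)) * y * (z + 2 * a2 * w * g)" (is "?L3 = ?R3")
    and "p4 = - (- (z + 2 * a2 * w * g) * w^4 / 2 + (a3 + 2 * a2) / 2 * w^3 + t * (z + 2 * a2 * w * g) * w^2
        - 1 / 2 * (((a3 + 2 * a2) + 1) * t - 1) * w - t^2 * (z + 2 * a2 * w * g) / 2
        + ((x + a2 * g) * y - (a1 + a2)) * y * w)" (is "_ = ?R4")
proof -
  have *: "a = b" if "a - b = (g * (y + w^2 - t) - 1) * q" for a b q :: complex
    using that g by simp
  \<comment> \<open>The cofactors below come from dividing the difference of both sides, as a polynomial in \<open>g\<close>,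
    by \<open>g * (y + w^2 - t) - 1\<close>.\<close>
  note expand = p2_def p4_def a0 algebra_simps power2_eq_square power3_eq_cube power4_eq_xxxx
  show "?L1 = ?R1"
    by (rule *[of _ _ "2 * x * y^2 * g * a2 - 4 * x * y * a2 + y * z * w * g * a2 - 2 * y * g * a1 * a2
        - 4 * y * g * a2^2 - y * g * a2 * a3 - z * w^3 * g * a2 + z * w * t * g * a2 - z * w * a2
        + w^2 * g * a2 * a3 - t * g * a2 + g * a2 + 2 * a1 * a2 + 2 * a2^2 + a2 * a3"])
      (simp add: expand)
  show "p2 = ?R2" by (rule *[of _ _ "2 * y^2 * a2"]) (simp add: expand)
  show "?L3 = ?R3"
    by (rule *[of _ _ "4 * x * y^2 * w * g * a2 + 2 * y * z * w^2 * g * a2 - y * z * a2 - 4 * y * w * g * a1 * a2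
        - 4 * y * w * g * a2^2 - 2 * y * w * g * a2 * a3 - 2 * z * w^4 * g * a2 + 2 * z * w^2 * t * g * a2
        + 3 * z * w^2 * a2 - z * t * a2 + 4 * w^3 * g * a2^2 + 2 * w^3 * g * a2 * a3 - 2 * w * t * g * a2
        + 2 * w * g * a2 - 2 * w * a2^2 - 2 * w * a2 * a3"])
      (simp add: expand field_simps)
  show "p4 = ?R4" by (rule *[of _ _ "y * w * a2 - w^3 * a2 + w * t * a2"]) (simp add: expand field_simps)
qed

lemma S2_deriv:
  assumes "(a0, a1, a2, a3) \<in> params" "t \<noteq> 0" "y t + w t ^ 2 - t \<noteq> 0"
    and "coordinates_deriv (\<lambda>s. (x s, y s, z s, w s)) (ham_field (a0, a1, a2, a3) t (x t, y t, z t, w t)) t"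
  shows "coordinates_deriv (\<lambda>s. (x s + a2 / (y s + w s ^ 2 - s), y s, z s + 2 * a2 * w s / (y s + w s ^ 2 - s), w s))
    (ham_field (a0, a1 + a2, - a2, a3 + 2 * a2) t
      (x t + a2 / (y t + w t ^ 2 - t), y t, z t + 2 * a2 * w t / (y t + w t ^ 2 - t), w t)) t"
proof -
  define g where "g = 1 / (y t + w t ^ 2 - t)"
  have g: "g * (y t + w t ^ 2 - t) = 1" using assms(3) by (simp add: g_def)
  have new: "x t + a2 / (y t + w t ^ 2 - t) = x t + a2 * g"
    "z t + 2 * a2 * w t / (y t + w t ^ 2 - t) = z t + 2 * a2 * w t * g"
    by (simp_all add: g_def)
  have frac: "(a / e * f - b * (c / e)) / (f * f) = (a * (1 / f) - b * (1 / f) ^ 2 * c) / e"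
    if "e \<noteq> 0" "f \<noteq> 0" for a b c e f :: complex
    using that by (simp add: field_simps power2_eq_square)
  have quotient: "((\<lambda>s. u s / (y s + w s ^ 2 - s)) has_field_derivative
      (u' * g - u t * g ^ 2 * (y' + 2 * w t * w' - t ^ 2)) / t ^ 2) (at t)"
    if "(u has_field_derivative u' / t ^ 2) (at t)" "(y has_field_derivative y' / t ^ 2) (at t)"
      "(w has_field_derivative w' / t ^ 2) (at t)" for u u' y' w'
  proof -
    have "((\<lambda>s. y s + w s ^ 2 - s) has_field_derivative (y' + 2 * w t * w' - t ^ 2) / t ^ 2) (at t)"
      by (rule DERIV_cong, (rule derivative_intros that)+) (use assms(2) in \<open>simp add: field_simps\<close>)
    from DERIV_divide[OF that(1) this assms(3)] show ?thesis
      unfolding g_def by (rule DERIV_cong) (rule frac, use assms(2,3) in simp_all)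
  qed
  note id = S2_identities[OF g params_alpha0[OF assms(1)]]
  show ?thesis unfolding new
    using assms(4) unfolding ham_field.simps coordinates_deriv_tuple
  proof (elim conjE, intro conjI, goal_cases)
    case 1
    show ?case unfolding id(1)[symmetric]
      by (rule DERIV_cong[OF DERIV_add[OF 1(1) quotient[of "\<lambda>_. a2" 0, OF _ 1(2) 1(4)]]])
        (simp_all add: diff_divide_distrib add_divide_distrib)
  next
    case 2
    show ?case using 2(2) unfolding id(2) .
  next
    case 3
    have num: "((\<lambda>s. 2 * a2 * w s) has_field_derivative 2 * a2 * p / t ^ 2) (at t)"
      if "(w has_field_derivative p / t ^ 2) (at t)" for p
      using DERIV_cmult[OF that, of "2 * a2"] by simp
    show ?case unfolding id(3)[symmetric]
      by (rule DERIV_cong[OF DERIV_add[OF 3(3) quotient[OF num[OF 3(4)] 3(2) 3(4)]]])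
        (simp add: add_divide_distrib[symmetric] algebra_simps)
  next
    case 4
    show ?case using 4(4) unfolding id(4) .
  qed
qed

lemma sign_flip_deriv:
  assumes "coordinates_deriv (\<lambda>s. (x s, y s, z s, w s)) (ham_field (a0, a1, a2, a3) t (x t, y t, z t, w t)) t"
  shows "coordinates_deriv (\<lambda>s. (x s, y s, - z s, - w s)) (ham_field (a0, a1, a2, a3) t (x t, y t, - z t, - w t)) t"
  using assms unfolding ham_field.simps coordinates_deriv_tuple
proof (elim conjE, intro conjI, goal_cases)
  case 3
  show ?case
    by (rule DERIV_cong[OF DERIV_minus[OF 3(3)]], simp only: minus_divide_left,
        rule arg_cong[of _ _ "\<lambda>u. u / t^2"]) (simp add: field_simps power3_eq_cube)
next
  case 4
  show ?case
    by (rule DERIV_cong[OF DERIV_minus[OF 4(4)]], simp only: minus_divide_left,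
        rule arg_cong[of _ _ "\<lambda>u. u / t^2"]) (simp add: field_simps power3_eq_cube)
qed simp_all

lemma backlund_with_generatorI:
  fixes q :: "param \<Rightarrow> complex \<Rightarrow> point \<Rightarrow> complex" and f :: "param \<Rightarrow> complex \<Rightarrow> point \<Rightarrow> point"
  assumes "c \<noteq> 0" "\<And>\<alpha>. \<alpha> \<in> params \<Longrightarrow> a \<alpha> \<in> params \<and> a (a \<alpha>) = \<alpha>"
    and "\<And>x y z w t a0 a1 a2 a3. T ((x, y, z, w), t, (a0, a1, a2, a3)) =
      (if q (a0, a1, a2, a3) t (x, y, z, w) = 0 then None
       else Some (f (a0, a1, a2, a3) t (x, y, z, w), c * t, a (a0, a1, a2, a3)))"
    and "\<And>\<alpha> t. birational (\<lambda>v. if q \<alpha> t v = 0 then None else Some (f \<alpha> t v))"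
    and "\<And>\<alpha>. continuous_on UNIV (\<lambda>p. q \<alpha> (snd p) (fst p))"
    and "\<And>\<alpha>. continuous_on {p. q \<alpha> (snd p) (fst p) \<noteq> 0} (\<lambda>p. f \<alpha> (snd p) (fst p))"
    and deriv: "\<And>a0 a1 a2 a3 x y z w t. (a0, a1, a2, a3) \<in> params \<Longrightarrow> t \<noteq> 0 \<Longrightarrow>
      q (a0, a1, a2, a3) t (x t, y t, z t, w t) \<noteq> 0 \<Longrightarrow>
      coordinates_deriv (\<lambda>s. (x s, y s, z s, w s)) (ham_field (a0, a1, a2, a3) t (x t, y t, z t, w t)) t \<Longrightarrow>
      coordinates_deriv (\<lambda>s. f (a0, a1, a2, a3) s (x s, y s, z s, w s))
       (case ham_field (a (a0, a1, a2, a3)) (c * t) (f (a0, a1, a2, a3) t (x t, y t, z t, w t)) of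
        (d1, d2, d3, d4) \<Rightarrow> (c * d1, c * d2, c * d3, c * d4)) t"
  shows "backlund_with T (\<lambda>t. c * t) a"
proof (rule backlund_withI[where q = q and f = f, OF assms(1,2) _ assms(4-6)])
  show "T (v, t, \<alpha>) = (if q \<alpha> t v = 0 then None else Some (f \<alpha> t v, c * t, a \<alpha>))" for v t \<alpha>
    using assms(3) by (cases v, cases \<alpha>) simp
  fix \<alpha> \<phi> t
  assume *: "\<alpha> \<in> params" "t \<noteq> 0" "q \<alpha> t (\<phi> t) \<noteq> 0" "coordinates_deriv \<phi> (ham_field \<alpha> t (\<phi> t)) t"
  obtain a0 a1 a2 a3 where \<alpha>: "\<alpha> = (a0, a1, a2, a3)" by (cases \<alpha>)
  obtain x y z w where \<phi>: "\<phi> = (\<lambda>s. (x s, y s, z s, w s))"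
    by (rule that[of "\<lambda>s. fst (\<phi> s)" "\<lambda>s. fst (snd (\<phi> s))" "\<lambda>s. fst (snd (snd (\<phi> s)))"
          "\<lambda>s. snd (snd (snd (\<phi> s)))"]) simp
  show "coordinates_deriv (\<lambda>s. f \<alpha> s (\<phi> s))
       (case ham_field (a \<alpha>) (c * t) (f \<alpha> t (\<phi> t)) of (d1, d2, d3, d4) \<Rightarrow> (c * d1, c * d2, c * d3, c * d4)) t"
    using deriv * unfolding \<alpha> \<phi> by blast
qed

lemma reflect_params: "\<alpha> \<in> params \<Longrightarrow> reflect i \<alpha> \<in> params \<and> reflect i (reflect i \<alpha>) = \<alpha>"
  by (cases \<alpha>) (simp add: params_def algebra_simps)

lemma backlund_with_S0: "backlund_with S0 (\<lambda>t. - 1 * t) (reflect 0)"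
proof (rule backlund_with_generatorI[where q = "\<lambda>\<alpha> t v. fst (snd v)" and
      f = "\<lambda>\<alpha> t v. (- (fst v + fst \<alpha> / fst (snd v) + 1 / fst (snd v)^2), - fst (snd v),
        \<i> * fst (snd (snd v)), snd (snd (snd v)) / \<i>)"], goal_cases)
  case (4 \<alpha> t)
  show ?case using birational_S0_phase[of \<i> "fst \<alpha>"] by (simp add: S0_phase_def case_prod_unfold)
next
  case (7 a0 a1 a2 a3 x y z w t)
  then show ?case using S0_deriv[of a0 a1 a2 a3 t y x z w] by simp
qed (auto intro!: continuous_intros simp: reflect_params)

lemma backlund_with_S1: "backlund_with S1 (\<lambda>t. 1 * t) (reflect 1)"
proof (rule backlund_with_generatorI[where q = "\<lambda>\<alpha> t v. fst v" and
      f = "\<lambda>\<alpha> t v. (fst v, fst (snd v) - fst (snd \<alpha>) / fst v, fst (snd (snd v)), snd (snd (snd v)))"], goal_cases)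
  case (4 \<alpha> t)
  show ?case using birational_S1_phase[of "fst (snd \<alpha>)"] by (simp add: S1_phase_def case_prod_unfold)
next
  case (7 a0 a1 a2 a3 x y z w t)
  then show ?case using S1_deriv[of a0 a1 a2 a3 t x y z w] by simp
qed (auto intro!: continuous_intros simp: reflect_params)

lemma backlund_with_S2: "backlund_with S2 (\<lambda>t. 1 * t) (reflect 2)"
proof (rule backlund_with_generatorI[where q = "\<lambda>\<alpha> t v. fst (snd v) + snd (snd (snd v))^2 - t" and
      f = "\<lambda>\<alpha> t v. (fst v + fst (snd (snd \<alpha>)) / (fst (snd v) + snd (snd (snd v))^2 - t), fst (snd v),
        fst (snd (snd v)) + 2 * fst (snd (snd \<alpha>)) * snd (snd (snd v)) / (fst (snd v) + snd (snd (snd v))^2 - t),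
        snd (snd (snd v)))"], goal_cases)
  case (4 \<alpha> t)
  show ?case using birational_S2_phase[of t "fst (snd (snd \<alpha>))"] by (simp add: S2_phase_def case_prod_unfold)
next
  case (7 a0 a1 a2 a3 x y z w t)
  then show ?case using S2_deriv[of a0 a1 a2 a3 t y w x z] by simp
qed (auto intro!: continuous_intros simp: reflect_params)

lemma backlund_with_S3: "backlund_with S3 (\<lambda>t. 1 * t) (reflect 3)"
proof (rule backlund_with_generatorI[where q = "\<lambda>\<alpha> t v. fst (snd (snd v))" and
      f = "\<lambda>\<alpha> t v. (fst v, fst (snd v), fst (snd (snd v)), snd (snd (snd v)) - snd (snd (snd \<alpha>)) / fst (snd (snd v)))"],
      goal_cases)
  case (4 \<alpha> t)
  show ?case using birational_S3_phase[of "snd (snd (snd \<alpha>))"] by (simp add: S3_phase_def case_prod_unfold)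
next
  case (7 a0 a1 a2 a3 x y z w t)
  then show ?case using S3_deriv[of t z x y w a0 a1 a2 a3] by simp
qed (auto intro!: continuous_intros simp: reflect_params)

lemma birational_sign_flip: "birational (\<lambda>(x, y, z, w). Some (x, y, - z, - w))"
proof -
  have rat: "rational_map (\<lambda>(x, y, z, w). Some (x, y, - z, - w))"
    by ((rule rational_mapI[of "\<lambda>v. fst v" "\<lambda>v. fst (snd v)" "\<lambda>v. - fst (snd (snd v))"
          "\<lambda>v. - snd (snd (snd v))" "\<lambda>v. 1" "(0, 0, 0, 0)"]; (intro polyfun_intros)?))
      (auto simp: case_prod_unfold)
  show ?thesis by (rule birationalI[OF rat rat]) auto
qed

lemma backlund_with_sign_flip: "backlund_with sign_flip (\<lambda>t. 1 * t) (\<lambda>\<alpha>. \<alpha>)"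
proof (rule backlund_with_generatorI[where q = "\<lambda>\<alpha> t v. 1" and
      f = "\<lambda>\<alpha> t v. (fst v, fst (snd v), - fst (snd (snd v)), - snd (snd (snd v)))"], goal_cases)
  case (4 \<alpha> t)
  show ?case using birational_sign_flip by (simp add: case_prod_unfold)
next
  case (7 a0 a1 a2 a3 x y z w t)
  then show ?case using sign_flip_deriv[of x y z w a0 a1 a2 a3 t] by simp
qed (auto intro!: continuous_intros)

lemma backlund_with_S: "i < 4 \<Longrightarrow> \<exists>\<tau>. backlund_with (S i) \<tau> (reflect i)"
  by (rule less_4_cases[of i]) (auto simp: S_def numeral_3_eq_3 numeral_2_eq_2
      intro: backlund_with_S0 backlund_with_S1[unfolded One_nat_def] backlund_with_S2[unfolded numeral_2_eq_2]
        backlund_with_S3[unfolded numeral_3_eq_3])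

section \<open>Relations between the generators\<close>

text \<open>A word as a partial map; its value on a point is computed by applying the letters from right to
  left.  No simplification of denominators takes place, so its domain depends on the word.\<close>

definition word_map :: "nat list \<Rightarrow> transf" where
  "word_map u = foldr (\<lambda>i T. S i \<circ>\<^sub>m T) u Some"

lemma word_map_simps [simp]: "word_map [] = Some" "word_map (i # u) = S i \<circ>\<^sub>m word_map u"
  by (simp_all add: word_map_def)

lemma S_numerals [simp]: "S 0 = S0" "S 1 = S1" "S (Suc 0) = S1" "S 2 = S2" "S 3 = S3"
  by (simp_all add: S_def)

lemma involutions:
  "word_map [1, 1] p = Some r \<Longrightarrow> r = p"
  "word_map [2, 2] p = Some r \<Longrightarrow> r = p"
  "word_map [3, 3] p = Some r \<Longrightarrow> r = p"
  "word_map [0, 0] p = Some r \<Longrightarrow> sign_flip p = Some s \<Longrightarrow> r = s"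
  by (cases p, auto simp: map_comp_Some_iff split: if_splits)+

lemma sign_flip_commutes:
  assumes "i < 4" "(sign_flip \<circ>\<^sub>m S i) p = Some r" "(S i \<circ>\<^sub>m sign_flip) p = Some s" shows "r = s"
  using assms(2,3)
  by (rule_tac less_4_cases[OF assms(1)]; cases p) (auto simp: map_comp_Some_iff split: if_splits)

text \<open>These rules evaluate one step at a point where the composite is known to be defined, which also
  yields that the denominator of that step does not vanish.\<close>

lemma S0_SomeD:
  assumes "S0 ((x, y, z, w), t, (a0, a1, a2, a3)) = Some r"
  shows "y \<noteq> 0" "r = ((- (x + a0 / y + 1 / y^2), - y, \<i> * z, w / \<i>), - t, (- a0, a1 + a0, a2, a3))"
  using assms by (auto split: if_splits)

lemma S1_SomeD:
  assumes "S1 ((x, y, z, w), t, (a0, a1, a2, a3)) = Some r"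
  shows "x \<noteq> 0" "r = ((x, y - a1 / x, z, w), t, (a0 + 2 * a1, - a1, a2 + a1, a3))"
  using assms by (auto split: if_splits)

lemma S2_SomeD:
  assumes "S2 ((x, y, z, w), t, (a0, a1, a2, a3)) = Some r" "y + w^2 - t = f"
  shows "f \<noteq> 0" "r = ((x + a2 / f, y, z + 2 * a2 * w / f, w), t, (a0, a1 + a2, - a2, a3 + 2 * a2))"
  using assms by (auto split: if_splits)

lemma S3_SomeD:
  assumes "S3 ((x, y, z, w), t, (a0, a1, a2, a3)) = Some r"
  shows "z \<noteq> 0" "r = ((x, y, z, w - a3 / z), t, (a0, a1, a2 + a3, - a3))"
  using assms by (auto split: if_splits)

lemma commutations:
  "word_map [0, 2] p = Some r \<Longrightarrow> word_map [2, 0] p = Some q \<Longrightarrow> r = q"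
  "word_map [0, 3] p = Some r \<Longrightarrow> word_map [3, 0] p = Some q \<Longrightarrow> r = q"
  "word_map [1, 3] p = Some r \<Longrightarrow> word_map [3, 1] p = Some q \<Longrightarrow> r = q"
proof -
  obtain x y z w t a0 a1 a2 a3 where p: "p = ((x, y, z, w), t, (a0, a1, a2, a3))" by (metis surj_pair)
  show "r = q" if rq: "word_map [0, 2] p = Some r" "word_map [2, 0] p = Some q"
  proof -
    obtain r1 q1 where r: "S2 ((x, y, z, w), t, (a0, a1, a2, a3)) = Some r1" "S0 r1 = Some r"
      and q: "S0 ((x, y, z, w), t, (a0, a1, a2, a3)) = Some q1" "S2 q1 = Some q"
      using rq unfolding p word_map_simps map_comp_Some_iff S_numerals by blast
    define f where "f = y + w^2 - t"
    note r1 = S2_SomeD[OF r(1) f_def[symmetric]]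
    note q1 = S0_SomeD[OF q(1)]
    have f': "- y + (w / \<i>)^2 - (- t) = - f" by (simp add: f_def power_divide power_mult_distrib)
    show ?thesis
      using r1(1) S0_SomeD(2)[OF r(2)[unfolded r1(2)]] S2_SomeD(2)[OF q(2)[unfolded q1(2)] f']
      by (simp add: field_simps)
  qed
  show "r = q" if "word_map [0, 3] p = Some r" "word_map [3, 0] p = Some q"
    using that unfolding p by (auto simp: map_comp_Some_iff field_simps split: if_splits)
  show "r = q" if "word_map [1, 3] p = Some r" "word_map [3, 1] p = Some q"
    using that unfolding p by (auto simp: map_comp_Some_iff split: if_splits)
qed

text \<open>Both sides of the braid relation of order three have the value below.  The parameters are called
  \<open>a\<close> and \<open>b\<close>, and \<open>F\<close> is the denominator of the second generator.  The intermediate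
  denominators factor into \<open>x\<close>, \<open>F\<close>, \<open>x * F - a\<close> and \<open>x * F + b\<close>.\<close>

lemma S1_S2_S1_value:
  assumes "word_map [1, 2, 1] ((x, y, z, w), t, (a0, a, b, a3)) = Some r" and F: "F = y + w^2 - t"
  shows "r = ((x * (x * F + b) / (x * F - a), y - (a + b) * F / (x * F + b),
    z + 2 * (a + b) * w * x / (x * F - a), w), t, (a0 + 2 * (a + b), - b, - a, a3 + 2 * (a + b)))"
proof -
  obtain r1 r2 where r: "S1 ((x, y, z, w), t, (a0, a, b, a3)) = Some r1" "S2 r1 = Some r2" "S1 r2 = Some r"
    using assms(1) unfolding word_map_simps map_comp_Some_iff S_numerals by blast
  note r1 = S1_SomeD[OF r(1)]
  have f: "y - a / x + w^2 - t = (x * F - a) / x" using r1(1) by (simp add: F field_simps)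
  note r2 = S2_SomeD[OF r(2)[unfolded r1(2)] f]
  have n: "x * F - a \<noteq> 0" using r2(1) by auto
  have x2: "x + (b + a) / ((x * F - a) / x) = x * (x * F + b) / (x * F - a)"
    "z + 2 * (b + a) * w / ((x * F - a) / x) = z + 2 * (a + b) * w * x / (x * F - a)"
    using n r1(1) by (simp_all add: field_simps)
  note r3 = S1_SomeD[OF r(3)[unfolded r2(2) x2]]
  have n': "x * F + b \<noteq> 0" using r3(1) by auto
  have "y - a / x - (- a + (b + a)) / (x * (x * F + b) / (x * F - a)) = y - (a + b) * F / (x * F + b)"
    using n n' r1(1) by (simp add: divide_simps) (simp add: algebra_simps)
  then show ?thesis using r3(2) by simp
qed

lemma S2_S1_S2_value:
  assumes "word_map [2, 1, 2] ((x, y, z, w), t, (a0, a, b, a3)) = Some r" and F: "F = y + w^2 - t"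
  shows "r = ((x * (x * F + b) / (x * F - a), y - (a + b) * F / (x * F + b),
    z + 2 * (a + b) * w * x / (x * F - a), w), t, (a0 + 2 * (a + b), - b, - a, a3 + 2 * (a + b)))"
proof -
  obtain r1 r2 where r: "S2 ((x, y, z, w), t, (a0, a, b, a3)) = Some r1" "S1 r1 = Some r2" "S2 r2 = Some r"
    using assms(1) unfolding word_map_simps map_comp_Some_iff S_numerals by blast
  note r1 = S2_SomeD[OF r(1) F[symmetric]]
  have x1: "x + b / F = (x * F + b) / F" using r1(1) by (simp add: field_simps)
  note r2 = S1_SomeD[OF r(2)[unfolded r1(2) x1]]
  have n: "x * F + b \<noteq> 0" using r2(1) by auto
  have y2: "y - (a + b) / ((x * F + b) / F) = y - (a + b) * F / (x * F + b)" by simp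
  have f: "y - (a + b) * F / (x * F + b) + w^2 - t = F * (x * F - a) / (x * F + b)"
  proof -
    have "y - (a + b) * F / (x * F + b) + w^2 - t = F - (a + b) * F / (x * F + b)" by (simp add: F)
    also have "\<dots> = F * (x * F - a) / (x * F + b)" using n by (simp add: divide_simps) (simp add: algebra_simps)
    finally show ?thesis .
  qed
  note r3 = S2_SomeD[OF r(3)[unfolded r2(2) y2] f]
  have n': "x * F - a \<noteq> 0" using r3(1) by auto
  have "(x * F + b) / F + (- b + (a + b)) / (F * (x * F - a) / (x * F + b)) = x * (x * F + b) / (x * F - a)"
    "z + 2 * b * w / F + 2 * (- b + (a + b)) * w / (F * (x * F - a) / (x * F + b))
      = z + 2 * (a + b) * w * x / (x * F - a)"
    using n n' r1(1) by (simp_all add: divide_simps) (simp_all add: algebra_simps)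
  then show ?thesis using r3(2) by simp
qed

text \<open>For the zeroth and first generator the intermediate coordinates are, up to sign, quotients of monomials in
  \<open>x\<close>, \<open>y\<close> and the four polynomials \<open>P\<close>, \<open>K\<close>, \<open>M\<close>, \<open>Q\<close>.  What makes this work are the
  identities \<open>Q = x * K + (a + e) * P\<close>, \<open>M = K + (a + e) * y\<close>,
  \<open>x * K^2 + e * P * K - Q = P^2 * M\<close>, \<open>K^2 + (e + 2 * a) * y * K - M = y^2 * Q\<close> and
  \<open>y * Q - a * K = P * M\<close>.\<close>

lemma S0_S1_S0_S1_value:
  assumes "word_map [0, 1, 0, 1] ((x, y, z, w), t, (e, a, a2, a3)) = Some r"
    and P: "P = x * y - a" and K: "K = P * y + 1" and M: "M = x * y^2 + e * y + 1" and Q: "Q = P * (P + e + 2 * a) + x"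
  shows "r = ((Q * M / K^2, P * K / Q, \<i> * (\<i> * z), w / \<i> / \<i>), t, (- e, - a, a2 + 2 * a + e, a3))"
proof -
  obtain r1 r2 r3 where r: "S1 ((x, y, z, w), t, (e, a, a2, a3)) = Some r1" "S0 r1 = Some r2" "S1 r2 = Some r3"
    "S0 r3 = Some r"
    using assms(1) unfolding word_map_simps map_comp_Some_iff S_numerals by blast
  note r1 = S1_SomeD[OF r(1)]
  have y1: "y - a / x = P / x" using r1(1) by (simp add: P field_simps)
  note r2 = S0_SomeD[OF r(2)[unfolded r1(2) y1]]
  have p: "P \<noteq> 0" using r2(1) by auto
  have x2: "- (x + (e + 2 * a) / (P / x) + 1 / (P / x)^2) = - (x * Q / P^2)"
    using p r1(1) by (simp add: Q field_simps power2_eq_square)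
  note r3 = S1_SomeD[OF r(3)[unfolded r2(2) x2]]
  have q: "Q \<noteq> 0" using r3(1) by auto
  have QK: "Q = x * K + (a + e) * P" by (simp add: Q K P algebra_simps power2_eq_square)
  have y3: "- (P / x) - (- a + (e + 2 * a)) / (- (x * Q / P^2)) = - (P * K / Q)"
  proof -
    have "- (P / x) - (- a + (e + 2 * a)) / (- (x * Q / P^2)) = - (P * (Q - (a + e) * P) / (x * Q))"
      using p q r1(1) by (simp add: field_simps power2_eq_square)
    then show ?thesis using r1(1) by (simp add: QK)
  qed
  note r4 = S0_SomeD[OF r(4)[unfolded r3(2) y3]]
  have k: "K \<noteq> 0" using r4(1) by auto
  have "x * K^2 + e * P * K - Q = P^2 * M"
    unfolding QK unfolding K M P by (simp add: algebra_simps power2_eq_square)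
  then have m: "M = (x * K^2 + e * P * K - Q) / P^2" using p by (simp add: field_simps)
  have "- (- (x * Q / P^2) + (- (e + 2 * a) + 2 * (- a + (e + 2 * a))) / (- (P * K / Q)) + 1 / (- (P * K / Q))^2)
    = Q * M / K^2"
    unfolding m using p q k by (simp add: field_simps power2_eq_square)
  then show ?thesis unfolding r4(2) by simp
qed

lemma S1_S0_S1_S0_value:
  assumes "word_map [1, 0, 1, 0] ((x, y, z, w), t, (e, a, a2, a3)) = Some r"
    and P: "P = x * y - a" and K: "K = P * y + 1" and M: "M = x * y^2 + e * y + 1" and Q: "Q = P * (P + e + 2 * a) + x"
  shows "r = ((Q * M / K^2, P * K / Q, \<i> * (\<i> * z), w / \<i> / \<i>), t, (- e, - a, a2 + 2 * a + e, a3))"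
proof -
  obtain r1 r2 r3 where r: "S0 ((x, y, z, w), t, (e, a, a2, a3)) = Some r1" "S1 r1 = Some r2" "S0 r2 = Some r3"
    "S1 r3 = Some r"
    using assms(1) unfolding word_map_simps map_comp_Some_iff S_numerals by blast
  note r1 = S0_SomeD[OF r(1)]
  have x1: "- (x + e / y + 1 / y^2) = - (M / y^2)" using r1(1) by (simp add: M field_simps power2_eq_square)
  note r2 = S1_SomeD[OF r(2)[unfolded r1(2) x1]]
  have m: "M \<noteq> 0" using r2(1) by auto
  have MK: "M = K + (a + e) * y" by (simp add: M K P algebra_simps power2_eq_square)
  have y2: "- y - (a + e) / (- (M / y^2)) = - (y * K / M)"
  proof -
    have "- y - (a + e) / (- (M / y^2)) = - (y * (M - (a + e) * y) / M)"
      using m r1(1) by (simp add: field_simps power2_eq_square)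
    then show ?thesis by (simp add: MK)
  qed
  note r3 = S0_SomeD[OF r(3)[unfolded r2(2) y2]]
  have k: "K \<noteq> 0" using r3(1) by auto
  have "K^2 + (e + 2 * a) * y * K - M = y^2 * Q"
    unfolding MK unfolding K Q P by (simp add: algebra_simps power2_eq_square)
  then have q: "Q = (K^2 + (e + 2 * a) * y * K - M) / y^2" using r1(1) by (simp add: field_simps)
  have x3: "- (- (M / y^2) + (- e + 2 * (a + e)) / (- (y * K / M)) + 1 / (- (y * K / M))^2) = Q * M / K^2"
    unfolding q using m k r1(1) by (simp add: field_simps power2_eq_square)
  note r4 = S1_SomeD[OF r(4)[unfolded r3(2) x3]]
  have q0: "Q \<noteq> 0" using r4(1) by auto
  have "y * Q - a * K = P * M" unfolding K Q M P by (simp add: algebra_simps power2_eq_square)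
  then have pm: "P = (y * Q - a * K) / M" using m by (simp add: field_simps)
  have "- (- (y * K / M)) - (- (a + e) + (- e + 2 * (a + e))) / (Q * M / K^2) = P * K / Q"
    unfolding pm using m k q0 by (simp add: field_simps power2_eq_square)
  then show ?thesis unfolding r4(2) by simp
qed

text \<open>For the second and third generator \<open>y\<close> and \<open>t\<close> are constant, and the denominator of the second
  one is \<open>w^2 - s\<close>.  Along one side of the braid relation it takes the values \<open>D / z^2\<close> and
  \<open>D * L / N^2\<close>, along the other one \<open>F\<close> and \<open>F * L / G^2\<close>; the common factor \<open>L\<close> is the reason why
  both sides end at the same point.\<close>

lemma S2_S3_S2_S3_value:
  assumes "word_map [2, 3, 2, 3] ((x, y, z, w), t, (a0, a1, b, c)) = Some r" and s: "s = t - y"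
    and F: "F = w^2 - s" and P: "P = z * w - c" and D: "D = P^2 - s * z^2" and N: "N = D + 2 * (b + c) * P"
    and G: "G = z * F + 2 * b * w" and L: "L = F * D - 4 * b * s * (b + c)"
  shows "z \<noteq> 0 \<and> D \<noteq> 0 \<and> N \<noteq> 0 \<and> L \<noteq> 0 \<and>
    r = ((x + (b + c) * z^2 / D + b * N^2 / (D * L), y, G * N / L, (P * N - (2 * b + c) * D) / (z * N)), t,
      (a0, a1 + 2 * b + c, - b, - c))"
proof -
  obtain r1 r2 r3 where r: "S3 ((x, y, z, w), t, (a0, a1, b, c)) = Some r1" "S2 r1 = Some r2" "S3 r2 = Some r3"
    "S2 r3 = Some r"
    using assms(1) unfolding word_map_simps map_comp_Some_iff S_numerals by blast
  note r1 = S3_SomeD[OF r(1)]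
  have w1: "w - c / z = P / z" using r1(1) by (simp add: P field_simps)
  have f: "y + (P / z)^2 - t = D / z^2" using r1(1) by (simp add: D s field_simps power2_eq_square)
  note r2 = S2_SomeD[OF r(2)[unfolded r1(2) w1] f]
  have d: "D \<noteq> 0" using r2(1) by auto
  have x2: "x + (b + c) / (D / z^2) = x + (b + c) * z^2 / D" by simp
  have z2: "z + 2 * (b + c) * (P / z) / (D / z^2) = z * N / D"
    using r1(1) d by (simp add: N field_simps power2_eq_square)
  note r3 = S3_SomeD[OF r(3)[unfolded r2(2) x2 z2]]
  have n: "N \<noteq> 0" using r3(1) by auto
  have w3: "P / z - (- c + 2 * (b + c)) / (z * N / D) = (P * N - (2 * b + c) * D) / (z * N)"
    using r1(1) d n by (simp add: field_simps)
  have DL: "(P * N - (2 * b + c) * D)^2 - s * (z * N)^2 = D * z^2 * L"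
    unfolding L N F D P by (simp add: algebra_simps power2_eq_square)
  have sq: "y + (u / v)^2 - t = (u^2 - s * v^2) / v^2" if "v \<noteq> 0" for u v
    using that by (simp add: s power_divide diff_divide_distrib)
  have f3: "y + ((P * N - (2 * b + c) * D) / (z * N))^2 - t = D * L / N^2"
  proof -
    have "y + ((P * N - (2 * b + c) * D) / (z * N))^2 - t
      = ((P * N - (2 * b + c) * D)^2 - s * (z * N)^2) / (z * N)^2"
      using sq[of "z * N" "P * N - (2 * b + c) * D"] r1(1) n by simp
    also have "\<dots> = D * L / N^2" unfolding DL using r1(1) n by (simp add: power_mult_distrib)
    finally show ?thesis .
  qed
  note r4 = S2_SomeD[OF r(4)[unfolded r3(2) w3] f3]
  have l: "L \<noteq> 0" using r4(1) by auto
  have x4: "x + (b + c) * z^2 / D + (- (b + c) + (- c + 2 * (b + c))) / (D * L / N^2)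
      = x + (b + c) * z^2 / D + b * N^2 / (D * L)" by simp
  have "z^2 * L + 2 * b * (P * N - (2 * b + c) * D) = z * D * G"
    unfolding L N G F D P by (simp add: algebra_simps power2_eq_square)
  then have g: "G = (z^2 * L + 2 * b * (P * N - (2 * b + c) * D)) / (z * D)"
    using r1(1) d by (simp add: field_simps)
  have z4: "z * N / D + 2 * (- (b + c) + (- c + 2 * (b + c))) * ((P * N - (2 * b + c) * D) / (z * N)) / (D * L / N^2)
      = G * N / L"
    unfolding g using r1(1) d n l by (simp add: field_simps power2_eq_square)
  show ?thesis using r1(1) d n l unfolding r4(2) x4 z4 by simp
qed

lemma S3_S2_S3_S2_value:
  assumes "word_map [3, 2, 3, 2] ((x, y, z, w), t, (a0, a1, b, c)) = Some r" and s: "s = t - y"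
    and F: "F = w^2 - s" and P: "P = z * w - c" and D: "D = P^2 - s * z^2" and N: "N = D + 2 * (b + c) * P"
    and G: "G = z * F + 2 * b * w" and L: "L = F * D - 4 * b * s * (b + c)"
  shows "F \<noteq> 0 \<and> G \<noteq> 0 \<and>
    r = ((x + b / F + (b + c) * G^2 / (F * L), y, G * N / L, (F * P + 2 * b * s) / G - c / (G * N / L)), t,
      (a0, a1 + 2 * b + c, - b, - c))"
proof -
  obtain r1 r2 r3 where r: "S2 ((x, y, z, w), t, (a0, a1, b, c)) = Some r1" "S3 r1 = Some r2" "S2 r2 = Some r3"
    "S3 r3 = Some r"
    using assms(1) unfolding word_map_simps map_comp_Some_iff S_numerals by blast
  have f: "y + w^2 - t = F" by (simp add: F s)
  note r1 = S2_SomeD[OF r(1) f]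
  have z1: "z + 2 * b * w / F = G / F" using r1(1) by (simp add: G field_simps)
  note r2 = S3_SomeD[OF r(2)[unfolded r1(2) z1]]
  have g: "G \<noteq> 0" using r2(1) by auto
  have w2: "w - (c + 2 * b) / (G / F) = (F * P + 2 * b * s) / G"
    using g r1(1) by (simp add: field_simps) (simp add: G P F algebra_simps power2_eq_square)
  have FL: "(F * P + 2 * b * s)^2 - s * G^2 = F * L"
    unfolding L G D P F by (simp add: algebra_simps power2_eq_square)
  have f2: "y + ((F * P + 2 * b * s) / G)^2 - t = F * L / G^2"
  proof -
    have "y + ((F * P + 2 * b * s) / G)^2 - t = ((F * P + 2 * b * s)^2 - s * G^2) / G^2"
      using g by (simp add: s diff_divide_distrib power_divide)
    then show ?thesis unfolding FL .
  qed
  note r3 = S2_SomeD[OF r(3)[unfolded r2(2) w2] f2]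
  have l: "L \<noteq> 0" using r3(1) by auto
  have x3: "x + b / F + (- b + (c + 2 * b)) / (F * L / G^2) = x + b / F + (b + c) * G^2 / (F * L)"
    by (simp add: algebra_simps)
  have "L + 2 * (b + c) * (F * P + 2 * b * s) = F * N"
    unfolding L N by (simp add: algebra_simps)
  then have n: "N = (L + 2 * (b + c) * (F * P + 2 * b * s)) / F" using r1(1) by (simp add: field_simps)
  have z3: "G / F + 2 * (- b + (c + 2 * b)) * ((F * P + 2 * b * s) / G) / (F * L / G^2) = G * N / L"
    unfolding n using r1(1) g l by (simp add: field_simps power2_eq_square)
  note r4 = S3_SomeD[OF r(4)[unfolded r3(2) x3 z3]]
  show ?thesis using r1(1) g unfolding r4(2) by simp
qed

lemma braid_relations:
  "word_map [1, 2, 1] p = Some r \<Longrightarrow> word_map [2, 1, 2] p = Some q \<Longrightarrow> r = q"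
  "word_map [0, 1, 0, 1] p = Some r \<Longrightarrow> word_map [1, 0, 1, 0] p = Some q \<Longrightarrow> r = q"
  "word_map [2, 3, 2, 3] p = Some r \<Longrightarrow> word_map [3, 2, 3, 2] p = Some q \<Longrightarrow> r = q"
proof -
  obtain x y z w t a0 a1 a2 a3 where p: "p = ((x, y, z, w), t, (a0, a1, a2, a3))" by (metis surj_pair)
  show "r = q" if "word_map [1, 2, 1] p = Some r" "word_map [2, 1, 2] p = Some q"
    using S1_S2_S1_value[OF that(1)[unfolded p] HOL.refl] S2_S1_S2_value[OF that(2)[unfolded p] HOL.refl] by simp
  show "r = q" if "word_map [0, 1, 0, 1] p = Some r" "word_map [1, 0, 1, 0] p = Some q"
    using S0_S1_S0_S1_value[OF that(1)[unfolded p] HOL.refl HOL.refl HOL.refl HOL.refl]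
      S1_S0_S1_S0_value[OF that(2)[unfolded p] HOL.refl HOL.refl HOL.refl HOL.refl] by simp
  show "r = q" if "word_map [2, 3, 2, 3] p = Some r" "word_map [3, 2, 3, 2] p = Some q"
  proof -
    define s where s: "s = t - y"
    define F where F: "F = w^2 - s"
    define P where P: "P = z * w - a3"
    define D where D: "D = P^2 - s * z^2"
    define N where N: "N = D + 2 * (a2 + a3) * P"
    define G where G: "G = z * F + 2 * a2 * w"
    define L where L: "L = F * D - 4 * a2 * s * (a2 + a3)"
    note l = S2_S3_S2_S3_value[OF that(1)[unfolded p] s F P D N G L]
    note r = S3_S2_S3_S2_value[OF that(2)[unfolded p] s F P D N G L]
    have nz: "z \<noteq> 0" "D \<noteq> 0" "N \<noteq> 0" "L \<noteq> 0" "F \<noteq> 0" "G \<noteq> 0" using l r by blast+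
    have "F * ((a2 + a3) * z^2 * L + a2 * N^2) = D * (a2 * L + (a2 + a3) * G^2)" (is "F * ?u = D * ?v")
      unfolding L N G D P F by (simp add: algebra_simps power2_eq_square)
    then have "?u / (D * L) = ?v / (F * L)" using nz by (simp add: frac_eq_eq mult.commute mult.left_commute)
    moreover have "(a2 + a3) * z^2 / D + a2 * N^2 / (D * L) = ?u / (D * L)"
      "a2 / F + (a2 + a3) * G^2 / (F * L) = ?v / (F * L)"
      using nz by (simp_all add: add_divide_distrib)
    ultimately have "(a2 + a3) * z^2 / D + a2 * N^2 / (D * L) = a2 / F + (a2 + a3) * G^2 / (F * L)"
      by (simp only:)
    moreover have "(P * N - (2 * a2 + a3) * D) / (z * N) = (F * P + 2 * a2 * s) / G - a3 / (G * N / L)"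
    proof -
      have "G * (P * N - (2 * a2 + a3) * D) = z * (N * (F * P + 2 * a2 * s) - a3 * L)" (is "G * ?u = z * ?v")
        unfolding L N G D P F by (simp add: algebra_simps power2_eq_square)
      then have "?u / (z * N) = ?v / (G * N)" using nz by (simp add: frac_eq_eq mult.commute mult.left_commute)
      moreover have "(F * P + 2 * a2 * s) / G - a3 / (G * N / L) = ?v / (G * N)"
        using nz by (simp add: diff_divide_distrib)
      ultimately show ?thesis by (simp only:)
    qed
    ultimately show ?thesis using l r by (simp add: add.assoc)
  qed
qed

section \<open>The group generated by the transformations\<close>

lemma backlund_S: "i < 4 \<Longrightarrow> backlund (S i)"
  using backlund_with_S unfolding backlund_iff_with by blast

lemma backlund_sign_flip: "backlund sign_flip"
  using backlund_with_sign_flip unfolding backlund_iff_with by blast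

lemma backlund_with_word_map:
  "u \<in> lists {..<4} \<Longrightarrow> \<exists>\<tau>. backlund_with (word_map u) \<tau> (act u)"
proof (induction u)
  case Nil
  have id: "act [] = id" by (simp add: fun_eq_iff)
  show ?case unfolding id word_map_simps(1) by (rule exI, rule backlund_with_Some)
next
  case (Cons i u)
  then obtain \<tau> \<tau>' where "backlund_with (S i) \<tau> (reflect i)" "backlund_with (word_map u) \<tau>' (act u)"
    using backlund_with_S by fastforce
  then have "backlund_with (S i \<circ>\<^sub>m word_map u) (\<tau> \<circ> \<tau>') (reflect i \<circ> act u)"
    by (rule backlund_with_comp)
  moreover have eq: "act (i # u) = reflect i \<circ> act u" by (simp add: fun_eq_iff)
  ultimately show ?case unfolding word_map_simps(2) eq by (intro exI)
qed

lemma backlund_word_map: "u \<in> lists {..<4} \<Longrightarrow> backlund (word_map u)"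
  using backlund_with_word_map unfolding backlund_iff_with by blast

text \<open>The action on parameters can be read off at a single point of the phase space.\<close>

lemma backlund_class_eq_params:
  assumes T: "backlund_with T \<tau> a" and T': "backlund_with T' \<tau>' a'"
    and eq: "backlund_class T = backlund_class T'" and \<alpha>: "\<alpha> \<in> params"
  shows "a \<alpha> = a' \<alpha>"
proof -
  have b: "backlund T" "backlund T'" using T T' unfolding backlund_iff_with by blast+
  have "everywhere (\<lambda>p. T p = T' p \<and> T p \<noteq> None)"
    using eq unfolding backlund_class_eq_iff[OF b]
    by (rule everywhere_conj[OF _ backlund_everywhere_defined[OF b(1)]])
  then have "generically (\<lambda>v. T (v, 1, \<alpha>) = T' (v, 1, \<alpha>) \<and> T (v, 1, \<alpha>) \<noteq> None)"
    using \<alpha> unfolding everywhere_def by simp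
  from generically_ex[OF this] obtain v where v: "T (v, 1, \<alpha>) = T' (v, 1, \<alpha>)" "T (v, 1, \<alpha>) \<noteq> None" by blast
  then obtain r where r: "T (v, 1, \<alpha>) = Some r" by blast
  with v(1) have r': "T' (v, 1, \<alpha>) = Some r" by simp
  show ?thesis
    using backlund_with_target(1)[OF T \<alpha> one_neq_zero r] backlund_with_target(1)[OF T' \<alpha> one_neq_zero r']
    by simp
qed

lemma word_map_append: "word_map (u @ v) = word_map u \<circ>\<^sub>m word_map v"
  by (induction u) (simp_all add: map_comp_assoc)

lemma backlund_class_word_eqI:
  assumes "u \<in> lists {..<4}" "v \<in> lists {..<4}"
    and "\<And>p r q. word_map u p = Some r \<Longrightarrow> word_map v p = Some q \<Longrightarrow> r = q"
  shows "backlund_class (word_map u) = backlund_class (word_map v)"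
  using assms by (intro backlund_class_eqI backlund_word_map)

lemma class_involution:
  assumes "i \<in> {1, 2, 3}" shows "backlund_class (word_map [i, i]) = backlund_class (word_map [])"
proof -
  have inv: "r = p" if "word_map [i, i] p = Some r" for p r
    using assms that
    by (elim insertE emptyE; hypsubst) (erule involutions(1), erule involutions(2), erule involutions(3))
  show ?thesis
  proof (rule backlund_class_word_eqI)
    fix p r q assume "word_map [i, i] p = Some r" "word_map [] p = Some q"
    then show "r = q" using inv[of p r] by simp
  qed (use assms in auto)
qed

lemma class_S0_square: "backlund_class (word_map [0, 0]) = backlund_class sign_flip"
  by (intro backlund_class_eqI backlund_word_map backlund_sign_flip involutions(4)) auto

lemma sign_flip_sign_flip: "sign_flip \<circ>\<^sub>m sign_flip = Some"
proof
  fix p show "(sign_flip \<circ>\<^sub>m sign_flip) p = Some p" by (cases p) auto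
qed

lemma class_sign_flip_commutes:
  assumes "i < 4" shows "backlund_class (sign_flip \<circ>\<^sub>m S i) = backlund_class (S i \<circ>\<^sub>m sign_flip)"
  by (intro backlund_class_eqI backlund_comp backlund_sign_flip backlund_S assms) (rule sign_flip_commutes[OF assms])

text \<open>The generators other than the zeroth one are involutions.  The inverse of the zeroth one is its
  composite with the sign flip.\<close>

lemma backlund_class_S_in_group:
  assumes "i < 4" shows "backlund_class (S i) \<in> carrier backlund_group"
proof (cases "i = 0")
  case True
  have b: "backlund S0" "backlund (S0 \<circ>\<^sub>m sign_flip)"
    using backlund_S[of 0] backlund_comp backlund_sign_flip by simp_all
  have sq: "backlund_class (S0 \<circ>\<^sub>m S0) = backlund_class sign_flip"
    using class_S0_square by simp
  have "backlund_class (S0 \<circ>\<^sub>m (S0 \<circ>\<^sub>m sign_flip)) = backlund_class (S0 \<circ>\<^sub>m S0) \<otimes>\<^bsub>backlund_monoid\<^esub> backlund_class sign_flip"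
    by (simp add: backlund_class_mult backlund_comp b(1) backlund_sign_flip map_comp_assoc)
  also have "\<dots> = backlund_class Some"
    unfolding sq by (simp add: backlund_class_mult backlund_sign_flip sign_flip_sign_flip)
  finally have r: "backlund_class (S0 \<circ>\<^sub>m (S0 \<circ>\<^sub>m sign_flip)) = backlund_class Some" .
  have "backlund_class ((S0 \<circ>\<^sub>m sign_flip) \<circ>\<^sub>m S0) = backlund_class S0 \<otimes>\<^bsub>backlund_monoid\<^esub> backlund_class (sign_flip \<circ>\<^sub>m S0)"
    by (simp add: backlund_class_mult backlund_comp b(1) backlund_sign_flip map_comp_assoc)
  also have "\<dots> = backlund_class (S0 \<circ>\<^sub>m (S0 \<circ>\<^sub>m sign_flip))"
    using class_sign_flip_commutes[of 0] by (simp add: backlund_class_mult b)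
  finally have l: "backlund_class ((S0 \<circ>\<^sub>m sign_flip) \<circ>\<^sub>m S0) = backlund_class Some" using r by simp
  show ?thesis using backlund_class_in_group[OF b r l] True by simp
next
  case False
  then have "backlund_class (S i \<circ>\<^sub>m S i) = backlund_class Some"
    using class_involution[of i] assms by force
  then show ?thesis using backlund_class_in_group[OF backlund_S backlund_S] assms by simp
qed

lemma S_word_simps: "S_word [] = \<one>\<^bsub>backlund_group\<^esub>"
  "S_word (i # u) = backlund_class (S i) \<otimes>\<^bsub>backlund_group\<^esub> S_word u"
  by (simp_all add: S_word_def)

lemma S_word_eq_class: "u \<in> lists {..<4} \<Longrightarrow> S_word u = backlund_class (word_map u)"
proof (induction u)
  case Nil
  then show ?case by (simp add: S_word_simps backlund_group_one)
next
  case (Cons i u)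
  then show ?case
    by (simp add: S_word_simps backlund_group_mult backlund_class_mult backlund_S backlund_word_map)
qed

lemma S_word_in_group: "u \<in> lists {..<4} \<Longrightarrow> S_word u \<in> carrier backlund_group"
proof (induction u)
  case Nil
  then show ?case using group.is_monoid[OF group_backlund_group] by (simp add: S_word_simps monoid.one_closed)
next
  case (Cons i u)
  then have "i < 4" "S_word u \<in> carrier backlund_group" by simp_all
  then show ?case unfolding S_word_simps
    using monoid.m_closed[OF group.is_monoid[OF group_backlund_group]] backlund_class_S_in_group by blast
qed

lemma S_word_append:
  assumes "u \<in> lists {..<4}" "v \<in> lists {..<4}"
  shows "S_word (u @ v) = S_word u \<otimes>\<^bsub>backlund_group\<^esub> S_word v"
  using assms by (simp add: S_word_eq_class word_map_append backlund_group_mult backlund_class_mult backlund_word_map)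

lemma S_word_context:
  assumes "S_word a = S_word b" "a \<in> lists {..<4}" "b \<in> lists {..<4}" "u \<in> lists {..<4}" "v \<in> lists {..<4}"
  shows "S_word (u @ a @ v) = S_word (u @ b @ v)"
  using assms by (simp add: S_word_append)

lemma S_word_eqI:
  assumes "u \<in> lists {..<4}" "v \<in> lists {..<4}"
    and "\<And>p r q. word_map u p = Some r \<Longrightarrow> word_map v p = Some q \<Longrightarrow> r = q"
  shows "S_word u = S_word v"
  using backlund_class_word_eqI[OF assms] assms by (simp add: S_word_eq_class)

lemma S_word_S0_square: "S_word [0, 0] = backlund_class sign_flip"
  using class_S0_square by (simp add: S_word_eq_class)

text \<open>The square of the zeroth generator is the sign flip, which commutes with every generator.\<close>

lemma S_word_S0_square_central:
  assumes "u \<in> lists {..<4}" shows "S_word (u @ [0, 0]) = S_word ([0, 0] @ u)"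
  using assms
proof (induction u)
  case (Cons i u)
  have i: "i < 4" and u: "u \<in> lists {..<4}" using Cons by simp_all
  have "S_word [i, 0, 0] = S_word [0, 0, i]"
  proof -
    have "S_word ([i] @ [0, 0]) = backlund_class (S i \<circ>\<^sub>m sign_flip)"
      using i by (subst S_word_append) (simp_all add: S_word_S0_square S_word_eq_class[of "[i]"] backlund_group_mult
          backlund_class_mult backlund_S backlund_sign_flip)
    moreover have "S_word ([0, 0] @ [i]) = backlund_class (sign_flip \<circ>\<^sub>m S i)"
      using i by (subst S_word_append) (simp_all add: S_word_S0_square S_word_eq_class[of "[i]"] backlund_group_mult
          backlund_class_mult backlund_S backlund_sign_flip)
    ultimately show ?thesis using class_sign_flip_commutes[OF i] by simp
  qed
  then have "S_word ([] @ [i, 0, 0] @ u) = S_word ([] @ [0, 0, i] @ u)"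
    using i u by (intro S_word_context) auto
  moreover have "S_word ([i] @ (u @ [0, 0]) @ []) = S_word ([i] @ ([0, 0] @ u) @ [])"
    using i u Cons.IH by (intro S_word_context) auto
  ultimately show ?case by simp
qed simp

lemma S_word_S0_fourth: "S_word [0, 0, 0, 0] = S_word []"
proof -
  have "S_word ([0, 0] @ [0, 0]) = backlund_class (sign_flip \<circ>\<^sub>m sign_flip)"
    by (subst S_word_append) (simp_all add: S_word_S0_square backlund_group_mult backlund_class_mult backlund_sign_flip)
  then show ?thesis by (simp add: sign_flip_sign_flip S_word_simps backlund_group_one)
qed

lemma S_word_involution: "i \<in> {1, 2, 3} \<Longrightarrow> S_word [i, i] = S_word []"
  using class_involution[of i] by (subst (1 2) S_word_eq_class) auto

text \<open>A relator that involves two generators splits into two halves, each of them one side of a braid relation.  When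
  one half is replaced by the other side of that relation, the word collapses from the middle.  For the zeroth and first
  generator the collapse leaves the fourth power of the zeroth one, that is, the square of the sign flip.\<close>

lemma S_word_relations:
  assumes "(u, v) \<in> C31_relations - {([0, 0], [])}" shows "S_word u = S_word v"
proof -
  have inv: "S_word (u @ [i, i] @ v) = S_word (u @ v)"
    if "i \<in> {1, 2, 3}" "u \<in> lists {..<4}" "v \<in> lists {..<4}" for i u v
    using S_word_context[OF S_word_involution[OF that(1)] _ _ that(2,3)] that(1) by auto
  have comm: "S_word [0, 2] = S_word [2, 0]" "S_word [0, 3] = S_word [3, 0]" "S_word [1, 3] = S_word [3, 1]"
    by (rule S_word_eqI; (rule commutations; assumption)?; simp)+
  have braid: "S_word [1, 2, 1] = S_word [2, 1, 2]" "S_word [0, 1, 0, 1] = S_word [1, 0, 1, 0]"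
    "S_word [2, 3, 2, 3] = S_word [3, 2, 3, 2]"
    by (rule S_word_eqI; (rule braid_relations; assumption)?; simp)+
  have b12: "S_word [1, 2, 1, 2, 1, 2] = S_word []"
  proof -
    have "S_word ([1, 2, 1] @ [2, 1, 2]) = S_word ([2, 1, 2] @ [2, 1, 2])"
      using S_word_context[OF braid(1), of "[]" "[2, 1, 2]"] by simp
    also have "\<dots> = S_word [2, 1, 1, 2]" using inv[of 2 "[2, 1]" "[1, 2]"] by simp
    also have "\<dots> = S_word [2, 2]" using inv[of 1 "[2]" "[2]"] by simp
    also have "\<dots> = S_word []" using inv[of 2 "[]" "[]"] by simp
    finally show ?thesis by simp
  qed
  have b23: "S_word [2, 3, 2, 3, 2, 3, 2, 3] = S_word []"
  proof -
    have "S_word ([2, 3, 2, 3] @ [2, 3, 2, 3]) = S_word ([2, 3, 2, 3] @ [3, 2, 3, 2])"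
      using S_word_context[OF braid(3), of "[2, 3, 2, 3]" "[]"] by simp
    also have "\<dots> = S_word [2, 3, 2, 2, 3, 2]" using inv[of 3 "[2, 3, 2]" "[2, 3, 2]"] by simp
    also have "\<dots> = S_word [2, 3, 3, 2]" using inv[of 2 "[2, 3]" "[3, 2]"] by simp
    also have "\<dots> = S_word [2, 2]" using inv[of 3 "[2]" "[2]"] by simp
    also have "\<dots> = S_word []" using inv[of 2 "[]" "[]"] by simp
    finally show ?thesis by simp
  qed
  have b01: "S_word [0, 1, 0, 1, 0, 1, 0, 1] = S_word []"
  proof -
    have "S_word ([0, 1, 0, 1] @ [0, 1, 0, 1]) = S_word ([0, 1, 0, 1] @ [1, 0, 1, 0])"
      using S_word_context[OF braid(2), of "[0, 1, 0, 1]" "[]"] by simp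
    also have "\<dots> = S_word ([0, 1] @ [0, 0] @ [1, 0])" using inv[of 1 "[0, 1, 0]" "[0, 1, 0]"] by simp
    also have "\<dots> = S_word ([] @ [0, 0, 0, 1] @ [1, 0])"
      using S_word_context[OF S_word_S0_square_central[of "[0, 1]"], of "[]" "[1, 0]"] by simp
    also have "\<dots> = S_word [0, 0, 0, 0]" using inv[of 1 "[0, 0, 0]" "[0]"] by simp
    finally show ?thesis using S_word_S0_fourth by simp
  qed
  have words: "concat (replicate 4 [0, 1]) = [0, 1, 0, 1, 0, 1, 0, 1 :: nat]"
    "concat (replicate 4 [2, 3]) = [2, 3, 2, 3, 2, 3, 2, 3 :: nat]"
    "concat (replicate 3 [1, 2]) = [1, 2, 1, 2, 1, 2 :: nat]"
    by (simp_all add: numeral_eq_Suc)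
  have squares: "S_word [1, 1] = S_word []" "S_word [2, 2] = S_word []" "S_word [3, 3] = S_word []"
    by (rule S_word_involution, simp)+
  have "(u, v) \<in> {([1, 1], []), ([2, 2], []), ([3, 3], []),
      ([0, 1, 0, 1, 0, 1, 0, 1], []), ([2, 3, 2, 3, 2, 3, 2, 3], []), ([1, 2, 1, 2, 1, 2], []),
      ([0, 2], [2, 0]), ([0, 3], [3, 0]), ([1, 3], [3, 1])}"
    using assms unfolding C31_relations_def words
    by (elim DiffE insertE emptyE) (simp_all only: insert_iff empty_iff simp_thms)
  then show ?thesis
    by (elim insertE emptyE Pair_inject; simp only: squares b01 b23 b12 comm)
qed

lemma S_word_eq_act:
  assumes "u \<in> lists {..<4}" "v \<in> lists {..<4}" "S_word u = S_word v" "\<alpha> \<in> params"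
  shows "act u \<alpha> = act v \<alpha>"
proof -
  obtain \<tau> where u: "backlund_with (word_map u) \<tau> (act u)" using backlund_with_word_map[OF assms(1)] ..
  obtain \<tau>' where v: "backlund_with (word_map v) \<tau>' (act v)" using backlund_with_word_map[OF assms(2)] ..
  have "backlund_class (word_map u) = backlund_class (word_map v)"
    using assms(3) unfolding S_word_eq_class[OF assms(1)] S_word_eq_class[OF assms(2)] .
  then show ?thesis using assms(4) by (rule backlund_class_eq_params[OF u v])
qed

section \<open>The isomorphism with the Coxeter group\<close>

text \<open>Congruent words represent the same element up to the sign flip; only the relator that is the
  square of the zeroth generator produces a flip.\<close>

lemma C31_cong_imp_S_word:
  assumes "(u, v) \<in> C31_cong"
  shows "S_word v = S_word u \<or> S_word v = S_word ([0, 0] @ u)"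
  using assms
proof (induction rule: C31_cong.induct)
  case (rel a b u v)
  have ab: "a \<in> lists {..<4}" "b \<in> lists {..<4}" using C31_relations_lists[OF rel(1)] by auto
  show ?case
  proof (cases "(a, b) = ([0, 0], [])")
    case True
    have "S_word ([] @ (u @ [0, 0]) @ v) = S_word ([] @ ([0, 0] @ u) @ v)"
      using rel S_word_S0_square_central by (intro S_word_context) auto
    then have "S_word ([0, 0] @ u @ a @ v) = S_word ([0, 0] @ ([0, 0] @ u @ v))"
      using True S_word_context[of "u @ [0, 0]" "[0, 0] @ u" "[0, 0]" v] rel S_word_S0_square_central[of u] by auto
    also have "\<dots> = S_word (u @ b @ v)"
      using S_word_context[OF S_word_S0_fourth, of "[]" "u @ v"] rel True by auto
    finally show ?thesis by simp
  next
    case False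
    then have "S_word a = S_word b" using rel(1) S_word_relations by blast
    then show ?thesis using S_word_context[OF _ ab rel(2,3)] by simp
  qed
next
  case (sym u v)
  have uv: "u \<in> lists {..<4}" "v \<in> lists {..<4}" using C31_cong_lists[OF sym.hyps] by auto
  have four: "S_word ([0, 0] @ [0, 0] @ u) = S_word u"
    using S_word_context[OF S_word_S0_fourth, of "[]" u] uv by simp
  have "S_word ([0, 0] @ v) = S_word u" if "S_word v = S_word ([0, 0] @ u)"
    using S_word_context[OF that, of "[0, 0]" "[]"] uv four by auto
  with sym.IH show ?case by auto
next
  case (trans u v w)
  have uvw: "u \<in> lists {..<4}" "v \<in> lists {..<4}" "w \<in> lists {..<4}"
    using C31_cong_lists[OF trans.hyps(1)] C31_cong_lists[OF trans.hyps(2)] by auto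
  have four: "S_word ([0, 0] @ [0, 0] @ u) = S_word u"
    using S_word_context[OF S_word_S0_fourth, of "[]" u] uvw by simp
  have "S_word ([0, 0] @ v) = S_word ([0, 0] @ u)" if "S_word v = S_word u"
    using S_word_context[OF that, of "[0, 0]" "[]"] uvw by auto
  moreover have "S_word ([0, 0] @ v) = S_word u" if "S_word v = S_word ([0, 0] @ u)"
    using S_word_context[OF that, of "[0, 0]" "[]"] uvw four by auto
  ultimately show ?case using trans.IH by auto
qed simp

lemma act_params: "\<alpha> \<in> params \<Longrightarrow> act u \<alpha> \<in> params"
  by (induction u) (simp_all add: reflect_params)

text \<open>The sign flip does not move parameters, so words that represent the same element up to the flip
  act alike on parameters.  The admissible parameter with all coordinates \<open>1 / 6\<close> is positive, and
  \<open>act_faithful\<close> applies to it.\<close>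

lemma S_word_imp_C31_cong:
  assumes u: "u \<in> lists {..<4}" and v: "v \<in> lists {..<4}"
    and eq: "S_word v = S_word u \<or> S_word v = S_word ([0, 0] @ u)"
  shows "(u, v) \<in> C31_cong"
proof -
  define \<beta> :: param where "\<beta> = (1 / 6, 1 / 6, 1 / 6, 1 / 6)"
  have \<beta>: "\<beta> \<in> params" "\<And>k. k < 4 \<Longrightarrow> root k \<beta> > 0"
    by (simp add: \<beta>_def params_def) (erule less_4_cases; simp add: \<beta>_def)
  have rv: "rev v \<in> lists {..<4}" using v by auto
  have "act ([0, 0] @ u) \<alpha> = act u \<alpha>" for \<alpha> by (cases "act u \<alpha>") simp
  then have "act v \<alpha> = act u \<alpha>" if "\<alpha> \<in> params" for \<alpha>
    using eq S_word_eq_act[OF v u _ that] S_word_eq_act[OF v _ _ that, of "[0, 0] @ u"] u by auto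
  then have "act (u @ rev v) \<beta> = act (rev (rev v) @ rev v) \<beta>"
    using act_params[OF \<beta>(1)] by simp
  also have "\<dots> = \<beta>" using act_cong[OF C31_cong_rev[OF rv]] by simp
  finally have "(u @ rev v, []) \<in> C31_cong" using u rv \<beta>(2) by (intro act_faithful) auto
  from C31_cong_inverse[OF this] show ?thesis by simp
qed

text \<open>Inverses of the generators are themselves words: the third power of the zeroth generator and the
  other generators themselves.\<close>

lemma S_group_carrier: "carrier S_group = S_word ` lists {..<4}"
proof
  interpret G: group backlund_group by (rule group_backlund_group)
  let ?gens = "(\<lambda>i. backlund_class (S i)) ` {..<4}"
  have gens: "carrier backlund_group \<inter> ?gens = ?gens" using backlund_class_S_in_group by auto
  have letter: "S_word [i] = backlund_class (S i)" if "i < 4" for i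
    using that by (simp add: S_word_eq_class)
  have inverse: "\<exists>v\<in>lists {..<4}. inv\<^bsub>backlund_group\<^esub> S_word [i] = S_word v" if i: "i < 4" for i
  proof -
    have "\<exists>v\<in>lists {..<4}. S_word (v @ [i]) = S_word []"
    proof (cases "i = 0")
      case True
      then show ?thesis using S_word_S0_fourth by (intro bexI[of _ "[0, 0, 0]"]) auto
    next
      case False
      with i have "i \<in> {1, 2, 3}" by auto
      from S_word_involution[OF this] i show ?thesis by (intro bexI[of _ "[i]"]) simp_all
    qed
    then obtain v where v: "v \<in> lists {..<4}" "S_word (v @ [i]) = S_word []" by blast
    then have "S_word v \<otimes>\<^bsub>backlund_group\<^esub> S_word [i] = \<one>\<^bsub>backlund_group\<^esub>"
      using S_word_append[of v "[i]"] i by (simp add: S_word_simps(1))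
    then have "inv\<^bsub>backlund_group\<^esub> S_word [i] = S_word v"
      using v i by (intro G.inv_equality S_word_in_group) auto
    with v show ?thesis by blast
  qed
  show "carrier S_group \<subseteq> S_word ` lists {..<4}"
  proof
    fix g assume "g \<in> carrier S_group"
    then have "g \<in> generate backlund_group ?gens"
      unfolding S_group_def carrier_subgroup_generated gens .
    then show "g \<in> S_word ` lists {..<4}"
    proof induction
      case one
      then show ?case by (intro image_eqI[of _ _ "[]"]) (simp_all add: S_word_simps)
    next
      case (incl h)
      then obtain i where "i < 4" "h = backlund_class (S i)" by auto
      then show ?case using letter by (intro image_eqI[of _ _ "[i]"]) simp_all
    next
      case (inv h)
      then obtain i where i: "i < 4" "h = backlund_class (S i)" by auto
      then show ?case using inverse[OF i(1)] letter[OF i(1)] by auto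
    next
      case (eng g h)
      then obtain u v where "u \<in> lists {..<4}" "v \<in> lists {..<4}" "g = S_word u" "h = S_word v" by blast
      then show ?case using S_word_append[of u v] by (intro image_eqI[of _ _ "u @ v"]) simp_all
    qed
  qed
  have "S_word u \<in> generate backlund_group ?gens" if "u \<in> lists {..<4}" for u
    using that
  proof (induction u)
    case Nil
    show ?case unfolding S_word_simps by (rule generate.one)
  next
    case (Cons i u)
    then have "backlund_class (S i) \<in> ?gens" and u: "S_word u \<in> generate backlund_group ?gens" by simp_all
    from generate.eng[OF generate.incl[OF this(1)] u] show ?case unfolding S_word_simps .
  qed
  then show "S_word ` lists {..<4} \<subseteq> carrier S_group"
    unfolding S_group_def carrier_subgroup_generated gens by blast
qed

lemma group_S_group: "group S_group"
  unfolding S_group_def by (rule group.group_subgroup_generated[OF group_backlund_group])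

lemma S_group_mult: "u \<in> lists {..<4} \<Longrightarrow> v \<in> lists {..<4} \<Longrightarrow> S_word u \<otimes>\<^bsub>S_group\<^esub> S_word v = S_word (u @ v)"
  by (simp add: S_group_def S_word_append)

lemma S_group_one: "\<one>\<^bsub>S_group\<^esub> = S_word []"
  by (simp add: S_group_def S_word_simps)

lemma sign_subgroup_words: "sign_subgroup = {S_word [], S_word [0, 0]}"
  by (simp add: sign_subgroup_def S_word_simps(1) backlund_group_one S_word_S0_square)

lemma sign_coset:
  assumes "u \<in> lists {..<4}"
  shows "sign_subgroup #>\<^bsub>S_group\<^esub> S_word u = {S_word u, S_word ([0, 0] @ u)}"
    and "S_word u <#\<^bsub>S_group\<^esub> sign_subgroup = {S_word u, S_word ([0, 0] @ u)}"
  using assms S_word_S0_square_central[OF assms] S_group_mult[of "[]" u] S_group_mult[of "[0, 0]" u]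
    S_group_mult[of u "[]"] S_group_mult[of u "[0, 0]"]
  unfolding r_coset_def l_coset_def sign_subgroup_words by auto

lemma sign_subgroup_normal: "sign_subgroup \<lhd> S_group"
proof -
  interpret G: group S_group by (rule group_S_group)
  have square: "S_word [0, 0] \<otimes>\<^bsub>S_group\<^esub> S_word [0, 0] = \<one>\<^bsub>S_group\<^esub>"
    using S_word_S0_fourth by (simp add: S_group_mult S_group_one)
  have mem: "S_word [0, 0] \<in> carrier S_group" "S_word [] \<in> carrier S_group" unfolding S_group_carrier by auto
  have products: "S_word [] \<otimes>\<^bsub>S_group\<^esub> S_word [] = S_word []"
    "S_word [] \<otimes>\<^bsub>S_group\<^esub> S_word [0, 0] = S_word [0, 0]"
    "S_word [0, 0] \<otimes>\<^bsub>S_group\<^esub> S_word [] = S_word [0, 0]"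
    by (simp_all add: S_group_mult)
  show ?thesis
  proof (rule G.normalI)
    show "subgroup sign_subgroup S_group"
    proof (rule G.subgroupI)
      show "sign_subgroup \<subseteq> carrier S_group" unfolding sign_subgroup_words using mem by blast
      show "sign_subgroup \<noteq> {}" unfolding sign_subgroup_words by blast
      show "inv\<^bsub>S_group\<^esub> a \<in> sign_subgroup" if "a \<in> sign_subgroup" for a
        using that G.inv_equality[OF square mem(1) mem(1)] G.inv_one
        unfolding sign_subgroup_words S_group_one by auto
      show "a \<otimes>\<^bsub>S_group\<^esub> b \<in> sign_subgroup" if "a \<in> sign_subgroup" "b \<in> sign_subgroup" for a b
        using that square[unfolded S_group_one] products unfolding sign_subgroup_words
        by (elim insertE emptyE) (simp_all only: insert_iff simp_thms)
    qed
    show "\<forall>x\<in>carrier S_group. sign_subgroup #>\<^bsub>S_group\<^esub> x = x <#\<^bsub>S_group\<^esub> sign_subgroup"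
      unfolding S_group_carrier using sign_coset by simp
  qed
qed

text \<open>The isomorphism.  As a set of words, its value does not depend on a chosen representative.\<close>

definition coset_words :: "transf set set \<Rightarrow> nat list set" where
  "coset_words C = {u \<in> lists {..<4}. S_word u \<in> C}"

lemma coset_words_eq:
  assumes u: "u \<in> lists {..<4}"
  shows "coset_words (sign_subgroup #>\<^bsub>S_group\<^esub> S_word u) = C31_cong `` {u}"
proof (rule Set.set_eqI)
  fix v
  show "v \<in> coset_words (sign_subgroup #>\<^bsub>S_group\<^esub> S_word u) \<longleftrightarrow> v \<in> C31_cong `` {u}"
    unfolding coset_words_def sign_coset(1)[OF u] mem_Collect_eq insert_iff Image_singleton_iff
    using C31_cong_imp_S_word[of u v] S_word_imp_C31_cong[OF u, of v] C31_cong_lists[of u v] by blast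
qed

lemma coset_words_iso: "coset_words \<in> iso (S_group Mod sign_subgroup) C31_group"
proof -
  let ?Q = "S_group Mod sign_subgroup"
  have Q: "carrier ?Q = (\<lambda>u. sign_subgroup #>\<^bsub>S_group\<^esub> S_word u) ` lists {..<4}"
    by (auto simp: carrier_FactGroup S_group_carrier)
  have mult: "(sign_subgroup #>\<^bsub>S_group\<^esub> S_word u) \<otimes>\<^bsub>?Q\<^esub> (sign_subgroup #>\<^bsub>S_group\<^esub> S_word v)
      = sign_subgroup #>\<^bsub>S_group\<^esub> S_word (u @ v)" if "u \<in> lists {..<4}" "v \<in> lists {..<4}" for u v
    using normal.rcos_sum[OF sign_subgroup_normal, of "S_word u" "S_word v"] that
    by (simp add: FactGroup_def S_group_carrier S_group_mult)
  have hom: "coset_words \<in> hom ?Q C31_group"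
  proof (rule homI)
    fix A B assume "A \<in> carrier ?Q" "B \<in> carrier ?Q"
    then obtain u v where uv: "u \<in> lists {..<4}" "A = sign_subgroup #>\<^bsub>S_group\<^esub> S_word u"
      "v \<in> lists {..<4}" "B = sign_subgroup #>\<^bsub>S_group\<^esub> S_word v" unfolding Q by blast
    show "coset_words A \<in> carrier C31_group" unfolding uv(2) coset_words_eq[OF uv(1)] C31_carrier using uv(1) by blast
    have "u @ v \<in> lists {..<4}" using uv by simp
    then show "coset_words (A \<otimes>\<^bsub>?Q\<^esub> B) = coset_words A \<otimes>\<^bsub>C31_group\<^esub> coset_words B"
      unfolding uv(2,4) mult[OF uv(1,3)] by (simp only: coset_words_eq uv(1,3) C31_mult)
  qed
  have "inj_on coset_words (carrier ?Q)"
  proof (rule inj_onI)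
    fix A B assume "A \<in> carrier ?Q" "B \<in> carrier ?Q" and eq: "coset_words A = coset_words B"
    then obtain u v where uv: "u \<in> lists {..<4}" "A = sign_subgroup #>\<^bsub>S_group\<^esub> S_word u"
      "v \<in> lists {..<4}" "B = sign_subgroup #>\<^bsub>S_group\<^esub> S_word v" unfolding Q by blast
    have "C31_cong `` {u} = C31_cong `` {v}" using eq unfolding uv(2,4) coset_words_eq[OF uv(1)] coset_words_eq[OF uv(3)] .
    then have "(v, u) \<in> C31_cong" unfolding C31_class_eq_iff[OF uv(1,3)] by (rule C31_cong.sym)
    then have "S_word u \<in> B" using C31_cong_imp_S_word[of v u] unfolding uv(4) sign_coset(1)[OF uv(3)] by blast
    then show "A = B"
      using group.repr_independence[OF group_S_group, of "S_word u" sign_subgroup "S_word v"] uv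
        normal_imp_subgroup[OF sign_subgroup_normal] by (auto simp: S_group_carrier)
  qed
  moreover have "coset_words ` carrier ?Q = carrier C31_group"
    unfolding Q C31_carrier image_image using coset_words_eq by (intro image_cong) auto
  ultimately show ?thesis using hom by (simp add: iso_def bij_betw_def)
qed

theorem theorem3p2:
  shows "group backlund_group
    \<and> (\<forall>i<4. backlund (S i) \<and> backlund_class (S i) \<in> carrier backlund_group)
    \<and> (\<forall>(u, v) \<in> C31_relations - {([0, 0], [])}. S_word u = S_word v)
    \<and> S_word [0, 0] = backlund_class sign_flip
    \<and> sign_subgroup \<lhd> S_group
    \<and> group C31_group
    \<and> (\<exists>\<Phi> \<in> iso (S_group Mod sign_subgroup) C31_group.
          \<forall>i<4. \<Phi> (sign_subgroup #>\<^bsub>S_group\<^esub> backlund_class (S i)) = C31_cong `` {[i]})"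
proof (intro conjI)
  show "group backlund_group" by (rule group_backlund_group)
  show "\<forall>i<4. backlund (S i) \<and> backlund_class (S i) \<in> carrier backlund_group"
    using backlund_S backlund_class_S_in_group by blast
  show "\<forall>(u, v) \<in> C31_relations - {([0, 0], [])}. S_word u = S_word v"
    using S_word_relations by blast
  show "S_word [0, 0] = backlund_class sign_flip" by (rule S_word_S0_square)
  show "sign_subgroup \<lhd> S_group" by (rule sign_subgroup_normal)
  show "group C31_group" by (rule group_C31_group)
  have "coset_words (sign_subgroup #>\<^bsub>S_group\<^esub> backlund_class (S i)) = C31_cong `` {[i]}" if "i < 4" for i
    using coset_words_eq[of "[i]"] that by (simp add: S_word_eq_class)
  then show "\<exists>\<Phi> \<in> iso (S_group Mod sign_subgroup) C31_group.
          \<forall>i<4. \<Phi> (sign_subgroup #>\<^bsub>S_group\<^esub> backlund_class (S i)) = C31_cong `` {[i]}"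
    using coset_words_iso by blast
qed

end
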